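(* Let $\mathcal{E}$ be the class of locally convex spaces $E$ such that for every $n\geq 1$, the $c^{\infty}$-topology on $E^n$ is the same as the product topology for the given topology on $E$. Let $M=(M_0,\mathcal{A})$ be a smooth $\mathcal{E}$-manifold, and let $N=(N_0,\mathcal{B})$ be a smooth regular manifold modeled on a nuclear Fréchet space. Let $\Phi:M_0\longrightarrow N_0$ be a continuous map. Then the following are equivalent: (i) $\Phi$ is smooth. (ii) For every $f\in\mathcal{C}^{\infty}_N(N_0)$, we have $f\circ\Phi\in\mathcal{C}^{\infty}_M(M_0)$.
   Context: Locally convex spaces are real and Hausdorff. Smoothness: for $E,F$ locally convex, $U\subset E$ open and $\Phi:U\to F$ continuous, put $d\Phi_{|x}(v)=\lim_{t\to 0}\frac{\Phi(x+tv)-\Phi(x)}{t}$. $\Phi$ is $\mathcal{C}^1$ if $d\Phi:U\times E\to F$, $(x,v)\mapsto d\Phi_{|x}(v)$ exists everywhere and is continuous; inductively $\Phi$ is $\mathcal{C}^{k+1}$ if it is $\mathcal{C}^1$ and $d\Phi$ is $\mathcal{C}^k$; $\Phi$ is smooth if it is $\mathcal{C}^k$ for all $k$. The $c^\infty$-topology on a locally convex space $E$ is the finest topology on $E$ making all smooth curves $c:\mathbb{R}\to E$ continuous. Manifolds: let $\mathcal{E}$ be a class of locally convex spaces. A smooth $\mathcal{E}$-atlas on a Hausdorff space $M_0$ is a family of pairs $(U_\alpha,\varphi_\alpha)$ such that the $U_\alpha$ form an open cover of $M_0$, each $\varphi_\alpha$ is a homeomorphism from $U_\alpha$ onto an open subset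 of some $E_\alpha\in\mathcal{E}$, and all transition maps $\varphi_\alpha\circ\varphi_\beta^{-1}:\varphi_\beta(U_\alpha\cap U_\beta)\to\varphi_\alpha(U_\alpha\cap U_\beta)$ are smooth. The atlas is maximal if it contains every chart (with values in spaces of $\mathcal{E}$) smoothly compatible with it. A smooth $\mathcal{E}$-manifold is a pair $M=(M_0,\mathcal{A})$ with $M_0$ Hausdorff (no countability assumption) and $\mathcal{A}$ a maximal smooth $\mathcal{E}$-atlas. A manifold is modeled on a given space if its charts take values in that space. A manifold is called regular if its underlying topological space is regular. A continuous map $\Phi:M_0\to N_0$ between manifolds $(M_0,\mathcal{A})$, $(N_0,\mathcal{B})$ is smooth if for all $(U,\varphi)\in\mathcal{A}$, $(V,\psi)\in\mathcal{B}$ with $\Phi(U)\subset V$, the map $\psi\circ\Phi_{|U}\circ\varphi^{-1}:\varphi(U)\to\psi(V)$ is smooth. $\mathcal{C}^\infty_M(U)$ denotes the $\mathbb{R}$-algebra of smooth functions $U\to\mathbb{R}$ on an open set $U\subset M_0$; in particular $\mathcal{C}^\infty_N(N_0)$ is the algebra of globally defined smooth real-valued functions on $N$. *)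

theory Defs
  imports "HOL-Analysis.Analysis" "HOL-Library.Function_Algebras"
begin

instantiation "fun" :: (type, real_vector) real_vector
begin

definition scaleR_fun :: "real \<Rightarrow> ('a \<Rightarrow> 'b) \<Rightarrow> 'a \<Rightarrow> 'b" where
  "scaleR_fun c f = (\<lambda>x. c *\<^sub>R f x)"

instance
  by standard (auto simp: scaleR_fun_def fun_eq_iff scaleR_add_right scaleR_add_left)

end

text \<open>
  A locally convex space is a topology whose carrier is a linear subspace of an ambient
  real vector space. The ambient type only supplies the linear structure and acts as a universe,
  so that spaces of different dimensions and topologies can occur side by side in one atlas.
\<close>

definition locally_convex_space :: "'e::real_vector topology \<Rightarrow> bool" where
  "locally_convex_space E \<longleftrightarrow>
     subspace (topspace E) \<and>
     Hausdorff_space E \<and>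
     continuous_map (prod_topology E E) E (\<lambda>(x, y). x + y) \<and>
     continuous_map (prod_topology euclideanreal E) E (\<lambda>(c, x). c *\<^sub>R x) \<and>
     (\<forall>U. openin E U \<and> 0 \<in> U \<longrightarrow> (\<exists>V. openin E V \<and> convex V \<and> 0 \<in> V \<and> V \<subseteq> U))"

text \<open>
  \<open>E\<^sup>n\<close> with the product topology. A tuple is a sequence that vanishes from index \<open>n\<close> on;
  the one-point factors make the carrier a linear subspace of \<open>nat \<Rightarrow> 'e\<close>.
\<close>

definition power_space :: "'e::real_vector topology \<Rightarrow> nat \<Rightarrow> (nat \<Rightarrow> 'e) topology" where
  "power_space E n =
     product_topology (\<lambda>i. if i < n then E else discrete_topology {0}) UNIV"

lemma topspace_power_space:
  "topspace (power_space E n) = {x. (\<forall>i<n. x i \<in> topspace E) \<and> (\<forall>i\<ge>n. x i = 0)}"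
proof -
  have "topspace (power_space E n) = {x. \<forall>i. x i \<in> (if i < n then topspace E else {0})}"
    by (simp add: power_space_def PiE_UNIV_domain Pi_def if_distrib cong: if_cong)
  also have "\<dots> = {x. (\<forall>i<n. x i \<in> topspace E) \<and> (\<forall>i\<ge>n. x i = 0)}"
    by (auto simp: not_less[symmetric])
  finally show ?thesis .
qed

text \<open>
  The domain \<open>U \<times> E\<close> of the differential changes with every step of the inductive definition of
  \<open>C\<^sup>k\<close>. The recursion is therefore carried out for maps defined on subsets of \<open>E\<^sup>m\<close>, where
  \<open>E\<^sup>m \<times> E\<^sup>m\<close> is identified with \<open>E\<^sup>2\<^sup>m\<close>: the first \<open>m\<close> entries are the base point and the
  last \<open>m\<close> entries the direction.
\<close>

definition base_point :: "nat \<Rightarrow> (nat \<Rightarrow> 'e::real_vector) \<Rightarrow> nat \<Rightarrow> 'e" where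
  "base_point m z = (\<lambda>i. if i < m then z i else 0)"

definition direction :: "nat \<Rightarrow> (nat \<Rightarrow> 'e::real_vector) \<Rightarrow> nat \<Rightarrow> 'e" where
  "direction m z = (\<lambda>i. if i < m then z (m + i) else 0)"

definition tangent_domain ::
    "nat \<Rightarrow> 'e::real_vector topology \<Rightarrow> (nat \<Rightarrow> 'e) set \<Rightarrow> (nat \<Rightarrow> 'e) set" where
  "tangent_domain m E U = {z \<in> topspace (power_space E (2 * m)). base_point m z \<in> U}"

definition has_directional_derivative ::
    "'f::real_vector topology \<Rightarrow> ('a::real_vector \<Rightarrow> 'f) \<Rightarrow> 'a \<Rightarrow> 'a \<Rightarrow> 'f \<Rightarrow> bool" where
  "has_directional_derivative F \<Phi> x v l \<longleftrightarrow>
     limitin F (\<lambda>t::real. (\<Phi> (x + t *\<^sub>R v) - \<Phi> x) /\<^sub>R t) l (at 0)"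

definition differential ::
    "nat \<Rightarrow> 'f::real_vector topology \<Rightarrow> ((nat \<Rightarrow> 'e::real_vector) \<Rightarrow> 'f) \<Rightarrow> (nat \<Rightarrow> 'e) \<Rightarrow> 'f" where
  "differential m F \<Phi> z =
     (THE l. has_directional_derivative F \<Phi> (base_point m z) (direction m z) l)"

definition C1_on ::
    "nat \<Rightarrow> 'e::real_vector topology \<Rightarrow> 'f::real_vector topology \<Rightarrow>
     (nat \<Rightarrow> 'e) set \<Rightarrow> ((nat \<Rightarrow> 'e) \<Rightarrow> 'f) \<Rightarrow> bool" where
  "C1_on m E F U \<Phi> \<longleftrightarrow>
     continuous_map (subtopology (power_space E m) U) F \<Phi> \<and>
     (\<forall>z \<in> tangent_domain m E U.
        \<exists>l. has_directional_derivative F \<Phi> (base_point m z) (direction m z) l) \<and>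
     continuous_map (subtopology (power_space E (2 * m)) (tangent_domain m E U)) F
       (differential m F \<Phi>)"

primrec Ck_on ::
    "nat \<Rightarrow> nat \<Rightarrow> 'e::real_vector topology \<Rightarrow> 'f::real_vector topology \<Rightarrow>
     (nat \<Rightarrow> 'e) set \<Rightarrow> ((nat \<Rightarrow> 'e) \<Rightarrow> 'f) \<Rightarrow> bool" where
  "Ck_on 0 m E F U \<Phi> \<longleftrightarrow> continuous_map (subtopology (power_space E m) U) F \<Phi>"
| "Ck_on (Suc k) m E F U \<Phi> \<longleftrightarrow>
     C1_on m E F U \<Phi> \<and> Ck_on k (2 * m) E F (tangent_domain m E U) (differential m F \<Phi>)"

text \<open>
  Smoothness on an open subset \<open>U\<close> of \<open>E\<close>, which is identified with \<open>E\<^sup>1\<close>. Values of \<open>f\<close>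
  outside \<open>U\<close> are irrelevant.
\<close>

definition smooth_on ::
    "'e::real_vector topology \<Rightarrow> 'f::real_vector topology \<Rightarrow> 'e set \<Rightarrow> ('e \<Rightarrow> 'f) \<Rightarrow> bool" where
  "smooth_on E F U f \<longleftrightarrow>
     (\<forall>k. Ck_on k 1 E F {x \<in> topspace (power_space E 1). x 0 \<in> U} (\<lambda>x. f (x 0)))"

abbreviation smooth_curve :: "'e::real_vector topology \<Rightarrow> (real \<Rightarrow> 'e) \<Rightarrow> bool" where
  "smooth_curve E c \<equiv> smooth_on euclideanreal E UNIV c"

definition c_infinity_topology :: "'e::real_vector topology \<Rightarrow> 'e topology" where
  "c_infinity_topology E =
     topology (\<lambda>U. U \<subseteq> topspace E \<and> (\<forall>c. smooth_curve E c \<longrightarrow> open (c -` U)))"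

lemma openin_c_infinity_topology:
  "openin (c_infinity_topology E) U \<longleftrightarrow>
     U \<subseteq> topspace E \<and> (\<forall>c. smooth_curve E c \<longrightarrow> open (c -` U))"
proof -
  have "istopology (\<lambda>U. U \<subseteq> topspace E \<and> (\<forall>c. smooth_curve E c \<longrightarrow> open (c -` U)))"
    unfolding istopology_def by (auto simp: vimage_Union)
  then show ?thesis
    by (simp add: c_infinity_topology_def topology_inverse')
qed

lemma smooth_curve_in_topspace:
  assumes "smooth_curve E c"
  shows "c t \<in> topspace E"
proof -
  let ?U = "topspace (power_space euclideanreal 1)"
  have "Ck_on 0 1 euclideanreal E {x \<in> ?U. x 0 \<in> UNIV} (\<lambda>x. c (x 0))"
    using assms unfolding smooth_on_def by blast
  then have "continuous_map (subtopology (power_space euclideanreal 1) ?U) E (\<lambda>x. c (x 0))"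
    by simp
  moreover have "(\<lambda>i. if i = 0 then t else 0) \<in> ?U"
    by (simp add: topspace_power_space)
  ultimately show ?thesis
    by (fastforce simp: continuous_map_def Pi_iff)
qed

lemma topspace_c_infinity_topology: "topspace (c_infinity_topology E) = topspace E"
proof -
  have "openin (c_infinity_topology E) (topspace E)"
    unfolding openin_c_infinity_topology
    using smooth_curve_in_topspace by (metis UNIV_eq_I open_UNIV order_refl vimageI2)
  then show ?thesis
    by (meson openin_c_infinity_topology openin_subset openin_topspace subset_antisym)
qed

lemma continuous_map_smooth_curve:
  assumes "smooth_curve E c"
  shows "continuous_map euclideanreal (c_infinity_topology E) c"
  using assms smooth_curve_in_topspace[OF assms]
  by (auto simp: continuous_map_def topspace_c_infinity_topology openin_c_infinity_topology
      vimage_def)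

lemma c_infinity_topology_finest:
  assumes "topspace T = topspace E"
    and "\<And>c. smooth_curve E c \<Longrightarrow> continuous_map euclideanreal T c"
    and "openin T U"
  shows "openin (c_infinity_topology E) U"
  using assms openin_subset[OF assms(3)]
  by (auto simp: continuous_map_def openin_c_infinity_topology vimage_def)

definition c_infinity_power_spaces :: "'e::real_vector topology set" where
  "c_infinity_power_spaces =
     {E. locally_convex_space E \<and>
         (\<forall>n\<ge>1. c_infinity_topology (power_space E n) = power_space E n)}"

definition frechet_space :: "'e::real_vector topology \<Rightarrow> bool" where
  "frechet_space E \<longleftrightarrow>
     locally_convex_space E \<and>
     (\<exists>d. Metric_space (topspace E) d \<and>
          Metric_space.mtopology (topspace E) d = E \<and>
          Metric_space.mcomplete (topspace E) d \<and>
          (\<forall>x \<in> topspace E. \<forall>y \<in> topspace E. \<forall>z \<in> topspace E. d (x + z) (y + z) = d x y))"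

definition continuous_seminorm :: "'e::real_vector topology \<Rightarrow> ('e \<Rightarrow> real) \<Rightarrow> bool" where
  "continuous_seminorm E p \<longleftrightarrow>
     (\<forall>x \<in> topspace E. \<forall>y \<in> topspace E. p (x + y) \<le> p x + p y) \<and>
     (\<forall>c. \<forall>x \<in> topspace E. p (c *\<^sub>R x) = \<bar>c\<bar> * p x) \<and>
     continuous_map E euclideanreal p"

definition linear_functional :: "'e::real_vector topology \<Rightarrow> ('e \<Rightarrow> real) \<Rightarrow> bool" where
  "linear_functional E f \<longleftrightarrow>
     (\<forall>x \<in> topspace E. \<forall>y \<in> topspace E. f (x + y) = f x + f y) \<and>
     (\<forall>c. \<forall>x \<in> topspace E. f (c *\<^sub>R x) = c * f x)"

text \<open>
  For continuous seminorms \<open>p \<le> q\<close>, nuclearity of the canonical map \<open>E\<^sub>q \<rightarrow> E\<^sub>p\<close> between the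
  normed spaces \<open>E/ker q\<close> and \<open>E/ker p\<close>, written on representatives:
  \<open>[x]\<^sub>p = (\<Sum>n. f\<^sub>n(x) [y\<^sub>n]\<^sub>p)\<close> with the sum of the products of the norms of \<open>f\<^sub>n\<close> in the dual of
  \<open>E\<^sub>q\<close> (bounded by \<open>a\<^sub>n\<close>) and of \<open>[y\<^sub>n]\<^sub>p\<close> finite. Passing to the completion of \<open>E\<^sub>p\<close> gives
  nothing new, since every element of it is the sum of an absolutely convergent series in \<open>E\<^sub>p\<close> with
  total norm arbitrarily close to its own.
\<close>

definition nuclear_canonical_map ::
    "'e::real_vector topology \<Rightarrow> ('e \<Rightarrow> real) \<Rightarrow> ('e \<Rightarrow> real) \<Rightarrow> bool" where
  "nuclear_canonical_map E q p \<longleftrightarrow>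
     (\<exists>(f :: nat \<Rightarrow> 'e \<Rightarrow> real) (a :: nat \<Rightarrow> real) (y :: nat \<Rightarrow> 'e).
        (\<forall>n. linear_functional E (f n) \<and> 0 \<le> a n \<and> (\<forall>x \<in> topspace E. \<bar>f n x\<bar> \<le> a n * q x)) \<and>
        (\<forall>n. y n \<in> topspace E) \<and>
        summable (\<lambda>n. a n * p (y n)) \<and>
        (\<forall>x \<in> topspace E. (\<lambda>N. p (x - (\<Sum>n<N. f n x *\<^sub>R y n))) \<longlonglongrightarrow> 0))"

definition nuclear_space :: "'e::real_vector topology \<Rightarrow> bool" where
  "nuclear_space E \<longleftrightarrow>
     locally_convex_space E \<and>
     (\<forall>p. continuous_seminorm E p \<longrightarrow>
        (\<exists>q. continuous_seminorm E q \<and> (\<forall>x \<in> topspace E. p x \<le> q x) \<and>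
             nuclear_canonical_map E q p))"

text \<open>
  A chart \<open>(U, \<phi>, E)\<close> consists of its domain, its coordinate map and its model space. Values of
  \<open>\<phi>\<close> outside \<open>U\<close> are irrelevant, and a maximal atlas contains all such variants of a chart.
\<close>

type_synonym ('m, 'e) chart = "'m set \<times> ('m \<Rightarrow> 'e) \<times> 'e topology"

definition is_chart ::
    "'e::real_vector topology set \<Rightarrow> 'm topology \<Rightarrow> ('m, 'e) chart \<Rightarrow> bool" where
  "is_chart \<E> M = (\<lambda>(U, \<phi>, E).
     E \<in> \<E> \<and> openin M U \<and> openin E (\<phi> ` U) \<and>
     homeomorphic_map (subtopology M U) (subtopology E (\<phi> ` U)) \<phi>)"

definition smoothly_compatible ::
    "('m, 'e::real_vector) chart \<Rightarrow> ('m, 'e) chart \<Rightarrow> bool" where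
  "smoothly_compatible = (\<lambda>(U, \<phi>, E) (V, \<psi>, F).
     smooth_on F E (\<psi> ` (U \<inter> V)) (\<phi> \<circ> inv_into V \<psi>) \<and>
     smooth_on E F (\<phi> ` (U \<inter> V)) (\<psi> \<circ> inv_into U \<phi>))"

definition smooth_atlas ::
    "'e::real_vector topology set \<Rightarrow> 'm topology \<Rightarrow> ('m, 'e) chart set \<Rightarrow> bool" where
  "smooth_atlas \<E> M \<A> \<longleftrightarrow>
     (\<forall>c \<in> \<A>. is_chart \<E> M c) \<and>
     (\<Union>c \<in> \<A>. fst c) = topspace M \<and>
     (\<forall>c \<in> \<A>. \<forall>c' \<in> \<A>. smoothly_compatible c c')"

definition smooth_manifold ::
    "'e::real_vector topology set \<Rightarrow> 'm topology \<Rightarrow> ('m, 'e) chart set \<Rightarrow> bool" where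
  "smooth_manifold \<E> M \<A> \<longleftrightarrow>
     Hausdorff_space M \<and>
     smooth_atlas \<E> M \<A> \<and>
     (\<forall>c. is_chart \<E> M c \<and> (\<forall>c' \<in> \<A>. smoothly_compatible c c') \<longrightarrow> c \<in> \<A>)"

definition smooth_map ::
    "'m topology \<Rightarrow> ('m, 'e::real_vector) chart set \<Rightarrow>
     'n topology \<Rightarrow> ('n, 'f::real_vector) chart set \<Rightarrow> ('m \<Rightarrow> 'n) \<Rightarrow> bool" where
  "smooth_map M \<A> N \<B> \<Phi> \<longleftrightarrow>
     continuous_map M N \<Phi> \<and>
     (\<forall>(U, \<phi>, E) \<in> \<A>. \<forall>(V, \<psi>, F) \<in> \<B>. \<Phi> ` U \<subseteq> V \<longrightarrow>
        smooth_on E F (\<phi> ` U) (\<psi> \<circ> \<Phi> \<circ> inv_into U \<phi>))"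

text \<open>
  Charts compatible with the identity chart are compatible with each other, so this is the standard
  maximal atlas of \<open>\<real>\<close>.
\<close>

definition real_atlas :: "(real, real) chart set" where
  "real_atlas =
     {c. is_chart {euclideanreal} euclideanreal c \<and>
         smoothly_compatible c (UNIV, id, euclideanreal)}"

definition smooth_functions ::
    "'m topology \<Rightarrow> ('m, 'e::real_vector) chart set \<Rightarrow> ('m \<Rightarrow> real) set" where
  "smooth_functions M \<A> = {f. smooth_map M \<A> euclideanreal real_atlas f}"

end

theory Submission
  imports Defs "HOL-Computational_Algebra.Polynomial"
begin

text \<open>
  That (i) implies (ii) is the chain rule. For the converse, let \<open>g = \<psi> \<circ> \<Phi> \<circ> \<phi>\<^sup>-\<^sup>1\<close> be the expression of
  \<open>\<Phi>\<close> in charts, with values in the nuclear Frechet space \<open>F\<close>.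

  First, \<open>g\<close> is weakly smooth: \<open>l \<circ> g\<close> is smooth for every continuous linear functional \<open>l\<close> on \<open>F\<close>. Near a
  given point of \<open>N\<close> the function \<open>l \<circ> \<psi>\<close> coincides with a smooth function defined on all of \<open>N\<close>
  (\<open>coordinate_functional_extends\<close>), whose pullback along \<open>\<Phi>\<close> is smooth by (ii). The extension uses
  regularity of \<open>N\<close> and bump functions on \<open>F\<close>. These exist because the topology of a nuclear space is
  given by seminorms whose squares are continuous, hence smooth, quadratic forms
  (\<open>nuclear_quadratic_form\<close>, \<open>nuclear_bump_function\<close>).

  Second, weakly smooth maps are smooth (\<open>weakly_smooth_imp_Ck_on\<close>). The link between \<open>F\<close> and
  its functionals is that weakly bounded sets are bounded (\<open>nuclear_weakly_bounded_imp_bounded\<close>). Applied to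
  difference quotients of \<open>g\<close> along smooth curves it gives Lipschitz estimates, so \<open>g\<close> is continuous along such
  curves and therefore continuous, as the domain carries the \<open>c\<^sup>\<infinity>\<close>-topology
  (\<open>weakly_C1_imp_continuous\<close>). Applied to differences of difference quotients along lines it shows, together
  with completeness, that directional derivatives exist (\<open>weakly_C2_imp_directional_derivative\<close>). Since
  \<open>l \<circ> dg = d(l \<circ> g)\<close>, the differential \<open>dg\<close> is weakly smooth on the tangent domain in the square of the
  original power of \<open>E\<close>, and the argument repeats.

  All composites that occur have a real-valued outer map, so the chain rule (\<open>Ck_on_compose\<close>) can rest
  on the classical mean value theorem. That weakly bounded sets are bounded follows from the nuclear expansion of seminorms
  and a uniform boundedness argument for functionals
  (\<open>linear_functionals_pointwise_bounded_imp_uniformly_bounded\<close>).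
\<close>

section \<open>Vector space topologies\<close>

text \<open>
  The class in which the differential calculus below takes place. It contains the locally convex spaces and
  is visibly closed under the passage to \<open>E\<^sup>n\<close>; local convexity enters later, through seminorms.
\<close>

definition vector_topology :: "'e::real_vector topology \<Rightarrow> bool" where
  "vector_topology E \<longleftrightarrow>
     subspace (topspace E) \<and> Hausdorff_space E \<and>
     continuous_map (prod_topology E E) E (\<lambda>(x, y). x + y) \<and>
     continuous_map (prod_topology euclideanreal E) E (\<lambda>(c, x). c *\<^sub>R x)"

lemma locally_convex_imp_vector_topology: "locally_convex_space E \<Longrightarrow> vector_topology E"
  by (simp add: locally_convex_space_def vector_topology_def)

lemma vector_topologyD:
  assumes "vector_topology E"
  shows "0 \<in> topspace E"
    and "x \<in> topspace E \<Longrightarrow> y \<in> topspace E \<Longrightarrow> x + y \<in> topspace E"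
    and "x \<in> topspace E \<Longrightarrow> y \<in> topspace E \<Longrightarrow> x - y \<in> topspace E"
    and "x \<in> topspace E \<Longrightarrow> c *\<^sub>R x \<in> topspace E"
  using assms by (auto simp: vector_topology_def subspace_0 subspace_add subspace_diff subspace_scale)

lemma continuous_map_plus:
  assumes "vector_topology E" "continuous_map X E f" "continuous_map X E g"
  shows "continuous_map X E (\<lambda>x. f x + g x)"
proof -
  have "continuous_map X (prod_topology E E) (\<lambda>x. (f x, g x))"
    using assms(2,3) by (rule continuous_map_pairedI)
  from continuous_map_compose[OF this] assms(1) show ?thesis
    unfolding vector_topology_def by (force simp: o_def)
qed

lemma continuous_map_scaleR:
  assumes "vector_topology E" "continuous_map X euclideanreal c" "continuous_map X E f"
  shows "continuous_map X E (\<lambda>x. c x *\<^sub>R f x)"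
proof -
  have "continuous_map X (prod_topology euclideanreal E) (\<lambda>x. (c x, f x))"
    using assms(2,3) by (rule continuous_map_pairedI)
  from continuous_map_compose[OF this] assms(1) show ?thesis
    unfolding vector_topology_def by (force simp: o_def)
qed

lemma continuous_map_minus_vector:
  assumes "vector_topology E" "continuous_map X E f" "continuous_map X E g"
  shows "continuous_map X E (\<lambda>x. f x - g x)"
proof -
  have "continuous_map X E (\<lambda>x. f x + (-1) *\<^sub>R g x)"
    by (intro continuous_map_plus continuous_map_scaleR assms) simp
  then show ?thesis by simp
qed

lemma vector_topology_euclideanreal: "vector_topology (euclideanreal)"
  unfolding vector_topology_def
  by (auto simp: case_prod_unfold intro!: continuous_intros continuous_map_fst continuous_map_snd
        continuous_map_real_mult)

lemma continuous_map_power_space: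
  "continuous_map X (power_space E n) f \<longleftrightarrow>
     (\<forall>i<n. continuous_map X E (\<lambda>x. f x i)) \<and> (\<forall>x\<in>topspace X. \<forall>i\<ge>n. f x i = 0)"
proof -
  have "continuous_map X (discrete_topology {0}) g \<longleftrightarrow> (\<forall>x\<in>topspace X. g x = 0)" for g :: "_ \<Rightarrow> 'b"
  proof
    assume "continuous_map X (discrete_topology {0}) g"
    then show "\<forall>x\<in>topspace X. g x = 0" by (auto simp: continuous_map_def)
  next
    assume "\<forall>x\<in>topspace X. g x = 0"
    then have "\<And>x. x \<in> topspace X \<Longrightarrow> (\<lambda>x. 0) x = g x" by simp
    then show "continuous_map X (discrete_topology {0}) g"
      using continuous_map_eq[of X "discrete_topology {0}" "\<lambda>x. 0" g] by (simp add: continuous_map_def)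
  qed
  then show ?thesis
    unfolding power_space_def continuous_map_componentwise_UNIV
    by (auto simp: not_less)
qed

lemma continuous_map_component:
  "i < n \<Longrightarrow> continuous_map (power_space E n) E (\<lambda>x. x i)"
  using continuous_map_power_space[of "power_space E n" E n "\<lambda>x. x"]
  by (simp add: continuous_map_id[unfolded id_def])

lemma vector_topology_power_space:
  assumes E: "vector_topology E"
  shows "vector_topology (power_space E n)"
proof -
  have "subspace (topspace (power_space E n))"
    using vector_topologyD[OF E] unfolding subspace_def topspace_power_space
    by (auto simp: scaleR_fun_def)
  moreover have "Hausdorff_space (power_space E n)"
    using E by (auto simp: power_space_def Hausdorff_space_product_topology vector_topology_def)
  moreover have "continuous_map (prod_topology (power_space E n) (power_space E n)) (power_space E n)
      (\<lambda>(x, y). x + y)"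
    unfolding continuous_map_power_space case_prod_unfold plus_fun_def
    by (auto intro!: continuous_map_plus[OF E] continuous_map_compose[OF continuous_map_fst continuous_map_component, unfolded o_def]
      continuous_map_compose[OF continuous_map_snd continuous_map_component, unfolded o_def] simp: topspace_power_space)
  moreover have "continuous_map (prod_topology euclideanreal (power_space E n)) (power_space E n)
      (\<lambda>(c, x). c *\<^sub>R x)"
    unfolding continuous_map_power_space case_prod_unfold scaleR_fun_def
    by (auto intro!: continuous_map_scaleR[OF E] continuous_map_fst
      continuous_map_compose[OF continuous_map_snd continuous_map_component, unfolded o_def] simp: topspace_power_space)
  ultimately show ?thesis
    by (simp add: vector_topology_def)
qed

lemma limitin_power_space:
  assumes "\<And>i. i < n \<Longrightarrow> limitin E (\<lambda>t. f t i) (l i) A" "\<And>i. i \<ge> n \<Longrightarrow> l i = 0"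
    and "\<And>t i. i \<ge> n \<Longrightarrow> f t i = 0"
  shows "limitin (power_space E n) f l A"
  unfolding power_space_def limitin_componentwise
proof (intro conjI ballI)
  have "\<forall>i\<in>{..<n}. \<forall>\<^sub>F t in A. f t i \<in> topspace E"
    using assms(1) by (auto simp: limitin_def)
  then have "\<forall>\<^sub>F t in A. \<forall>i\<in>{..<n}. f t i \<in> topspace E"
    by (intro eventually_ball_finite) simp_all
  then have ev: "\<forall>\<^sub>F t in A. \<forall>i<n. f t i \<in> topspace E"
    by (rule eventually_mono) auto
  show "l \<in> extensional UNIV" by simp
  show "\<forall>\<^sub>F a in A. f a \<in> topspace (product_topology (\<lambda>i. if i < n then E else discrete_topology {0}) UNIV)"
    using ev by (rule eventually_mono)
      (use assms(3) in \<open>simp add: topspace_power_space[unfolded power_space_def] del: topspace_product_topology\<close>)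
  show "limitin (if i < n then E else discrete_topology {0}) (\<lambda>c. f c i) (l i) A" for i
    using assms(1-3) by (auto simp: not_less)
qed

section \<open>Tangent domains\<close>

text \<open>
  The inverse of the splitting of \<open>E\<^sup>2\<^sup>m\<close> into base point and direction.
\<close>

definition join :: "nat \<Rightarrow> (nat \<Rightarrow> 'e::real_vector) \<Rightarrow> (nat \<Rightarrow> 'e) \<Rightarrow> nat \<Rightarrow> 'e" where
  "join m x v = (\<lambda>i. if i < m then x i else if i < 2 * m then v (i - m) else 0)"

lemma base_point_join [simp]: "x \<in> topspace (power_space E m) \<Longrightarrow> base_point m (join m x v) = x"
  by (auto simp: base_point_def join_def topspace_power_space fun_eq_iff)

lemma direction_join [simp]: "v \<in> topspace (power_space E m) \<Longrightarrow> direction m (join m x v) = v"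
  by (auto simp: direction_def join_def topspace_power_space fun_eq_iff)

lemma join_in_power_space [simp]:
  "x \<in> topspace (power_space E m) \<Longrightarrow> v \<in> topspace (power_space E m) \<Longrightarrow>
    join m x v \<in> topspace (power_space E (2 * m))"
  by (auto simp: join_def topspace_power_space)

lemma base_point_in [simp]:
  "z \<in> topspace (power_space E (2 * m)) \<Longrightarrow> base_point m z \<in> topspace (power_space E m)"
  by (auto simp: base_point_def topspace_power_space)

lemma direction_in [simp]:
  "z \<in> topspace (power_space E (2 * m)) \<Longrightarrow> direction m z \<in> topspace (power_space E m)"
  by (auto simp: direction_def topspace_power_space)

lemma continuous_map_join:
  assumes "continuous_map X (power_space E m) f" "continuous_map X (power_space E m) g"
  shows "continuous_map X (power_space E (2 * m)) (\<lambda>x. join m (f x) (g x))"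
  unfolding continuous_map_power_space
proof (intro conjI allI impI ballI)
  fix i assume "i < 2 * m"
  then show "continuous_map X E (\<lambda>x. join m (f x) (g x) i)"
    using assms by (cases "i < m") (auto simp: join_def continuous_map_power_space)
qed (auto simp: join_def)

lemma continuous_map_base_point:
  "continuous_map (power_space E (2 * m)) (power_space E m) (base_point m)"
  unfolding continuous_map_power_space
  by (auto simp: base_point_def intro!: continuous_map_component)

lemma tangent_domain_in: "z \<in> tangent_domain m E U \<Longrightarrow> z \<in> topspace (power_space E (2 * m))"
  by (simp add: tangent_domain_def)

lemma join_in_tangent_domain:
  "U \<subseteq> topspace (power_space E m) \<Longrightarrow> x \<in> U \<Longrightarrow> v \<in> topspace (power_space E m) \<Longrightarrow> join m x v \<in> tangent_domain m E U"
  unfolding tangent_domain_def by (auto simp: subset_iff)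

lemma tangent_domain_mono: "U \<subseteq> V \<Longrightarrow> tangent_domain m E U \<subseteq> tangent_domain m E V"
  by (auto simp: tangent_domain_def)

lemma openin_tangent_domain:
  "openin (power_space E m) U \<Longrightarrow> openin (power_space E (2 * m)) (tangent_domain m E U)"
  unfolding tangent_domain_def by (rule openin_continuous_map_preimage[OF continuous_map_base_point])

section \<open>Maps of class \<open>C\<^sup>k\<close>\<close>

lemma has_directional_derivative_unique:
  assumes "Hausdorff_space F" "has_directional_derivative F f x v l" "has_directional_derivative F f x v l'"
  shows "l = l'"
  using assms limitin_Hausdorff_unique[of F _ l "at (0::real)" l']
  unfolding has_directional_derivative_def by simp

lemma differential_eq:
  assumes "Hausdorff_space F" "has_directional_derivative F f (base_point m z) (direction m z) l"
  shows "differential m F f z = l"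
  unfolding differential_def
  using has_directional_derivative_unique[OF assms(1)] assms(2) by blast

lemma continuous_map_line:
  assumes E: "vector_topology E" and "x \<in> topspace E" "v \<in> topspace E"
  shows "continuous_map euclideanreal E (\<lambda>t. x + t *\<^sub>R v)"
  using assms by (intro continuous_map_plus[OF E] continuous_map_scaleR[OF E])
    (auto simp: continuous_map_id[unfolded id_def])

lemma open_line_preimage:
  assumes "vector_topology E" "openin E U" "x \<in> topspace E" "v \<in> topspace E"
  shows "open {t::real. x + t *\<^sub>R v \<in> U}"
  using openin_continuous_map_preimage[OF continuous_map_line[OF assms(1,3,4)] assms(2)] by simp

lemma eventually_line_in:
  assumes "vector_topology E" "openin E U" "x \<in> U" "v \<in> topspace E"
  shows "eventually (\<lambda>t::real. x + t *\<^sub>R v \<in> U) (at 0)"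
proof -
  have "x \<in> topspace E" using assms openin_subset by blast
  from open_line_preimage[OF assms(1,2) this assms(4)] have "open {t. x + t *\<^sub>R v \<in> U}" .
  then have "eventually (\<lambda>t. t \<in> {t. x + t *\<^sub>R v \<in> U}) (nhds 0)"
    using assms(3) by (intro eventually_nhds_in_open) auto
  then show ?thesis by (auto simp: eventually_at_filter elim: eventually_mono)
qed

text \<open>
  The points \<open>x + t v\<close> lie in the open set \<open>U\<close> for small \<open>t\<close>, so a directional derivative is a local
  notion. This is what lets \<open>C\<^sup>k\<close> maps be changed outside their domain and glued together.
\<close>

lemma has_directional_derivative_cong:
  assumes "vector_topology E" "openin E U" "x \<in> U" "v \<in> topspace E"
    and eq: "\<And>x. x \<in> U \<Longrightarrow> f x = g x" and d: "has_directional_derivative F f x v l"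
  shows "has_directional_derivative F g x v l"
  unfolding has_directional_derivative_def
proof (rule limitin_transform_eventually[OF _ d[unfolded has_directional_derivative_def]])
  show "\<forall>\<^sub>F t in at 0. (f (x + t *\<^sub>R v) - f x) /\<^sub>R t = (g (x + t *\<^sub>R v) - g x) /\<^sub>R t"
    using eventually_line_in[OF assms(1-4)] by eventually_elim (simp add: eq assms(3))
qed

lemma has_directional_derivative_tangent_cong:
  assumes E: "vector_topology E" and U: "openin (power_space E m) U" and z: "z \<in> tangent_domain m E U"
    and eq: "\<And>x. x \<in> U \<Longrightarrow> f x = g x"
    and d: "has_directional_derivative F f (base_point m z) (direction m z) l"
  shows "has_directional_derivative F g (base_point m z) (direction m z) l"
  using z by (intro has_directional_derivative_cong[OF vector_topology_power_space[OF E] U _ _ eq d])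
    (auto simp: tangent_domain_def)

lemma Ck_on_imp_continuous: "Ck_on k m E F U f \<Longrightarrow> continuous_map (subtopology (power_space E m) U) F f"
  by (cases k) (auto simp: C1_on_def)

text \<open>
  Elimination form of the recursion, which hides the definite description inside
  \<open>differential\<close>.
\<close>

lemma Ck_on_SucD:
  assumes "Hausdorff_space F" "Ck_on (Suc k) m E F U f"
  shows "z \<in> tangent_domain m E U \<Longrightarrow>
      has_directional_derivative F f (base_point m z) (direction m z) (differential m F f z)"
    and "Ck_on k (2 * m) E F (tangent_domain m E U) (differential m F f)"
  using assms differential_eq[OF assms(1)] by (fastforce simp: C1_on_def)+

lemma Ck_on_cong:
  assumes E: "vector_topology E" and F: "Hausdorff_space F"
  shows "openin (power_space E m) U \<Longrightarrow> (\<And>x. x \<in> U \<Longrightarrow> f x = g x) \<Longrightarrow> Ck_on k m E F U f \<Longrightarrow> Ck_on k m E F U g"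
proof (induction k arbitrary: m U f g)
  case 0
  then show ?case by (auto elim: continuous_map_eq)
next
  case (Suc k)
  have d: "has_directional_derivative F g (base_point m z) (direction m z) (differential m F f z)"
    if "z \<in> tangent_domain m E U" for z
    by (rule has_directional_derivative_tangent_cong[OF E Suc.prems(1) that Suc.prems(2)
          Ck_on_SucD(1)[OF F Suc.prems(3) that]])
  have eq: "differential m F f z = differential m F g z" if "z \<in> tangent_domain m E U" for z
    using differential_eq[OF F d[OF that]] by simp
  have "Ck_on k (2 * m) E F (tangent_domain m E U) (differential m F g)"
    using Suc.IH[OF openin_tangent_domain[OF Suc.prems(1)] eq Ck_on_SucD(2)[OF F Suc.prems(3)]] by simp
  moreover have "continuous_map (subtopology (power_space E m) U) F g"
    using Ck_on_imp_continuous[OF Suc.prems(3)] Suc.prems(2) by (auto elim: continuous_map_eq)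
  ultimately show ?case
    using d by (auto simp: C1_on_def dest: Ck_on_imp_continuous)
qed

text \<open>
  The working form of the recursion: it suffices to guess the differential on the tangent domain and to
  check that the guess is \<open>C\<^sup>k\<close>. The inductions on \<open>k\<close> below go through this rule,
  with the statement generalised over \<open>m\<close> because the guess lives on \<open>E\<^sup>2\<^sup>m\<close>.
\<close>

lemma Ck_on_SucI:
  assumes E: "vector_topology E" and F: "Hausdorff_space F" and U: "openin (power_space E m) U"
    and "continuous_map (subtopology (power_space E m) U) F f"
    and d: "\<And>z. z \<in> tangent_domain m E U \<Longrightarrow> has_directional_derivative F f (base_point m z) (direction m z) (f' z)"
    and f': "Ck_on k (2 * m) E F (tangent_domain m E U) f'"
  shows "Ck_on (Suc k) m E F U f"
proof -
  have "Ck_on k (2 * m) E F (tangent_domain m E U) (differential m F f)"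
    by (rule Ck_on_cong[OF E F openin_tangent_domain[OF U] _ f'])
      (simp add: differential_eq[OF F d])
  then show ?thesis
    using assms by (auto simp: C1_on_def dest: Ck_on_imp_continuous)
qed

lemma Ck_on_subset: "Ck_on k m E F U f \<Longrightarrow> V \<subseteq> U \<Longrightarrow> Ck_on k m E F V f"
proof (induction k arbitrary: m U V f)
  case 0
  then show ?case by (auto intro: continuous_map_from_subtopology_mono)
next
  case (Suc k)
  note tangent_domain_mono[OF Suc.prems(2), of m E]
  then show ?case
    using Suc by (auto simp: C1_on_def intro: continuous_map_from_subtopology_mono)
qed

lemma Ck_on_Suc_imp: "Ck_on (Suc k) m E F U f \<Longrightarrow> Ck_on k m E F U f"
proof (induction k arbitrary: m U f)
  case 0
  then show ?case by (simp add: C1_on_def)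
next
  case (Suc k)
  then show ?case by (metis Ck_on.simps(2))
qed

lemma continuous_map_local:
  assumes "\<And>x. x \<in> topspace X \<Longrightarrow> x \<in> U \<Longrightarrow> \<exists>V. openin X V \<and> x \<in> V \<and> continuous_map (subtopology X (U \<inter> V)) Y f"
  shows "continuous_map (subtopology X U) Y f"
  unfolding continuous_map_def
proof (intro conjI allI impI)
  show "f \<in> topspace (subtopology X U) \<rightarrow> topspace Y"
  proof
    fix x assume "x \<in> topspace (subtopology X U)"
    then have x: "x \<in> topspace X" "x \<in> U" by auto
    with assms obtain V where V: "x \<in> V" "continuous_map (subtopology X (U \<inter> V)) Y f" by blast
    with x show "f x \<in> topspace Y"
      by (auto simp: continuous_map_def Pi_iff)
  qed
next
  fix O' assume O: "openin Y O'"
  let ?P = "{x \<in> topspace (subtopology X U). f x \<in> O'}"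
  show "openin (subtopology X U) ?P"
  proof (subst openin_subopen, intro ballI)
    fix x assume x: "x \<in> ?P"
    then obtain V where V: "openin X V" "x \<in> V" "continuous_map (subtopology X (U \<inter> V)) Y f"
      using assms by auto
    have "openin (subtopology X (U \<inter> V)) {x \<in> topspace (subtopology X (U \<inter> V)). f x \<in> O'}"
      using openin_continuous_map_preimage[OF V(3) O] .
    then obtain T where T: "openin X T" "{x \<in> topspace (subtopology X (U \<inter> V)). f x \<in> O'} = T \<inter> (U \<inter> V)"
      by (auto simp: openin_subtopology)
    have "openin (subtopology X U) ((T \<inter> V) \<inter> U)"
      using T(1) V(1) by (auto simp: openin_subtopology)
    moreover have "x \<in> (T \<inter> V) \<inter> U" using T(2) x V(2) by auto
    moreover have "(T \<inter> V) \<inter> U \<subseteq> ?P" using T(2) by auto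
    ultimately show "\<exists>T. openin (subtopology X U) T \<and> x \<in> T \<and> T \<subseteq> ?P" by blast
  qed
qed

text \<open>
  The differential is defined pointwise, without reference to the domain, so the differentials on the
  pieces are restrictions of one and the same map.
\<close>

lemma Ck_on_local:
  assumes "Hausdorff_space F"
  shows "(\<And>x. x \<in> U \<Longrightarrow> x \<in> topspace (power_space E m) \<Longrightarrow> \<exists>V. openin (power_space E m) V \<and> x \<in> V \<and> Ck_on k m E F (U \<inter> V) f) \<Longrightarrow>
     Ck_on k m E F U f"
proof (induction k arbitrary: m U f)
  case 0
  then show ?case using continuous_map_local[of "power_space E m" U F f] by (simp only: Ck_on.simps)
next
  case (Suc k)
  have loc: "\<exists>W. openin (power_space E (2 * m)) W \<and> z \<in> W \<and>
        has_directional_derivative F f (base_point m z) (direction m z) (differential m F f z) \<and>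
        Ck_on k (2 * m) E F (tangent_domain m E U \<inter> W) (differential m F f)"
    if z: "z \<in> tangent_domain m E U" for z
  proof -
    from z have "base_point m z \<in> U" "base_point m z \<in> topspace (power_space E m)"
      by (auto simp: tangent_domain_def)
    with Suc.prems obtain V where V: "openin (power_space E m) V" "base_point m z \<in> V"
      "Ck_on (Suc k) m E F (U \<inter> V) f" by blast
    have eq: "tangent_domain m E (U \<inter> V) = tangent_domain m E U \<inter> tangent_domain m E V"
      by (auto simp: tangent_domain_def)
    have "Ck_on k (2 * m) E F (tangent_domain m E U \<inter> tangent_domain m E V) (differential m F f)"
      using Ck_on_SucD(2)[OF assms V(3)] by (simp add: eq)
    moreover have zV: "z \<in> tangent_domain m E V" using z V by (simp add: tangent_domain_def)
    moreover have "has_directional_derivative F f (base_point m z) (direction m z) (differential m F f z)"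
      by (rule Ck_on_SucD(1)[OF assms V(3)]) (use z zV eq in simp)
    ultimately show ?thesis using openin_tangent_domain[OF V(1)] by blast
  qed
  have "continuous_map (subtopology (power_space E m) U) F f"
  proof (rule continuous_map_local)
    fix x assume "x \<in> topspace (power_space E m)" "x \<in> U"
    from Suc.prems[OF this(2,1)] obtain V where "openin (power_space E m) V" "x \<in> V"
      "Ck_on (Suc k) m E F (U \<inter> V) f" by blast
    moreover from this(3) have "continuous_map (subtopology (power_space E m) (U \<inter> V)) F f"
      by (rule Ck_on_imp_continuous)
    ultimately show "\<exists>V. openin (power_space E m) V \<and> x \<in> V \<and>
        continuous_map (subtopology (power_space E m) (U \<inter> V)) F f"
      by (intro exI[of _ V] conjI)
  qed
  moreover have "Ck_on k (2 * m) E F (tangent_domain m E U) (differential m F f)"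
  proof (rule Suc.IH)
    fix z assume "z \<in> tangent_domain m E U"
    from loc[OF this] show "\<exists>W. openin (power_space E (2 * m)) W \<and> z \<in> W \<and>
        Ck_on k (2 * m) E F (tangent_domain m E U \<inter> W) (differential m F f)" by blast
  qed
  ultimately show ?case
    using loc by (auto simp: C1_on_def dest: Ck_on_imp_continuous)
qed

section \<open>Directional derivatives of real-valued maps\<close>

lemma scaleR_fun_apply: "(c *\<^sub>R f) x = c *\<^sub>R f x"
  by (simp add: scaleR_fun_def)

lemma has_directional_derivative_real_iff:
  "has_directional_derivative euclideanreal f x v l \<longleftrightarrow>
     ((\<lambda>t. f (x + t *\<^sub>R v)) has_real_derivative l) (at 0)"
  unfolding has_directional_derivative_def DERIV_def
  by (simp add: divide_inverse mult.commute)

lemma has_real_derivative_along_line: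
  assumes "has_directional_derivative euclideanreal f (x + t *\<^sub>R v) v l"
  shows "((\<lambda>s. f (x + s *\<^sub>R v)) has_real_derivative l) (at t)"
proof -
  have "((\<lambda>s. f (x + (s + t) *\<^sub>R v)) has_real_derivative l) (at 0)"
    using assms unfolding has_directional_derivative_real_iff
    by (simp add: scaleR_add_left add.assoc add.commute add.left_commute)
  then show ?thesis
    using DERIV_shift[of "\<lambda>s. f (x + s *\<^sub>R v)" l 0 t] by simp
qed

text \<open>
  Along a line the base point moves while the direction stays fixed; the derivative at each parameter
  is therefore a value of the differential.
\<close>

lemma C1_has_real_derivative_along_line:
  assumes U: "openin (power_space E m) U" and f: "Ck_on (Suc k) m E euclideanreal U f"
    and x: "x + t *\<^sub>R v \<in> U" and v: "v \<in> topspace (power_space E m)"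
  shows "((\<lambda>s. f (x + s *\<^sub>R v)) has_real_derivative
    differential m euclideanreal f (join m (x + t *\<^sub>R v) v)) (at t)"
proof (rule has_real_derivative_along_line[where f = f and x = x and v = v and t = t])
  have "x + t *\<^sub>R v \<in> topspace (power_space E m)" using U x openin_subset by blast
  then show "has_directional_derivative euclideanreal f (x + t *\<^sub>R v) v
      (differential m euclideanreal f (join m (x + t *\<^sub>R v) v))"
    using Ck_on_SucD(1)[OF _ f, of "join m (x + t *\<^sub>R v) v"]
      join_in_tangent_domain[OF openin_subset[OF U] x v] v by simp
qed

lemma mean_value_symmetric:
  fixes h h' :: "real \<Rightarrow> real"
  assumes "\<And>s. \<bar>s\<bar> \<le> \<bar>t\<bar> \<Longrightarrow> (h has_real_derivative h' s) (at s)"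
  obtains s where "\<bar>s\<bar> \<le> \<bar>t\<bar>" "h t - h 0 = t * h' s"
proof -
  consider "t = 0" | "t > 0" | "t < 0" by linarith
  then have "\<exists>s. \<bar>s\<bar> \<le> \<bar>t\<bar> \<and> h t - h 0 = t * h' s"
  proof cases
    case 1 then show ?thesis by auto
  next
    case 2
    then show ?thesis using MVT2[of 0 t h h'] assms by force
  next
    case 3
    then obtain z where "z > t" "z < 0" "h 0 - h t = (0 - t) * h' z"
      using MVT2[of t 0 h h'] assms by force
    then show ?thesis using 3 by (intro exI[of _ z]) (auto simp: algebra_simps)
  qed
  then show thesis using that by blast
qed

text \<open>
  The pointwise chain rule, for a curve that is merely differentiable at one parameter. Write
  \<open>\<gamma> t = \<gamma> 0 + t u\<close> where \<open>u\<close> is the difference quotient, which tends to \<open>w\<close>. The mean value theorem on the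
  segment from \<open>\<gamma> 0\<close> to \<open>\<gamma> t\<close> turns the quotient of \<open>f \<circ> \<gamma>\<close> into a value of the differential of \<open>f\<close> at
  \<open>(\<gamma> 0 + s u, u)\<close> with \<open>\<bar>s\<bar> \<le> \<bar>t\<bar>\<close>, and the differential is jointly continuous. The
  mean value theorem is the reason for taking \<open>f\<close> real-valued.
\<close>

lemma C1_chain_rule_curve:
  assumes F: "vector_topology F" and V: "openin (power_space F n) V"
    and f: "Ck_on (Suc k) n F euclideanreal V f" and \<gamma>0: "\<gamma> 0 \<in> V"
    and \<gamma>: "limitin (power_space F n) (\<lambda>t::real. (\<gamma> t - \<gamma> 0) /\<^sub>R t) w (at 0)"
  shows "((\<lambda>t. f (\<gamma> t)) has_real_derivative differential n euclideanreal f (join n (\<gamma> 0) w)) (at 0)"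
proof -
  let ?X = "power_space F n" and ?D = "differential n euclideanreal f"
  let ?z = "join n (\<gamma> 0) w"
  have X: "vector_topology ?X" using vector_topology_power_space[OF F] .
  have w: "w \<in> topspace ?X" using \<gamma> by (rule limitin_topspace)
  have g0: "\<gamma> 0 \<in> topspace ?X" using openin_subset[OF V] \<gamma>0 by blast
  have "((\<lambda>t. (f (\<gamma> t) - f (\<gamma> 0)) / t) \<longlongrightarrow> ?D ?z) (at 0)"
    unfolding tendsto_iff
  proof (intro allI impI)
    fix e :: real assume e: "e > 0"
    have cD: "continuous_map (subtopology (power_space F (2 * n)) (tangent_domain n F V)) euclideanreal ?D"
      using f by (simp add: C1_on_def)
    \<comment> \<open>The points of the tangent domain at which the differential is within \<open>e\<close> of its value at the
      expected limit; a product neighbourhood \<open>S \<times> W\<close> of \<open>(0, w)\<close> is mapped into \<open>Z\<close>.\<close>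
    define Z where "Z = {z \<in> topspace (subtopology (power_space F (2 * n)) (tangent_domain n F V)). ?D z \<in> ball (?D ?z) e}"
    have "openin (subtopology (power_space F (2 * n)) (tangent_domain n F V)) Z"
      unfolding Z_def by (rule openin_continuous_map_preimage[OF cD]) simp
    then have Zo: "openin (power_space F (2 * n)) Z"
      using openin_tangent_domain[OF V] by (simp add: openin_open_subtopology)
    let ?P = "prod_topology euclideanreal ?X"
    have cK: "continuous_map ?P (power_space F (2 * n)) (\<lambda>p. join n (\<gamma> 0 + fst p *\<^sub>R snd p) (snd p))"
      by (intro continuous_map_join continuous_map_plus[OF X] continuous_map_scaleR[OF X]
          continuous_map_fst continuous_map_snd) (simp add: continuous_map_const g0)
    define Q where "Q = {p \<in> topspace ?P. join n (\<gamma> 0 + fst p *\<^sub>R snd p) (snd p) \<in> Z}"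
    have Qo: "openin ?P Q"
      unfolding Q_def by (rule openin_continuous_map_preimage[OF cK Zo])
    have "join n (\<gamma> 0) w \<in> Z"
      using w g0 e join_in_tangent_domain[OF openin_subset[OF V] \<gamma>0 w]
      by (simp add: Z_def)
    then have "(0, w) \<in> Q" using w by (simp add: Q_def)
    with Qo obtain S W where SW': "openin euclideanreal S" "openin ?X W" "0 \<in> S" "w \<in> W" "S \<times> W \<subseteq> Q"
      by (metis openin_prod_topology_alt)
    then have S: "open S" "0 \<in> S" and W: "openin ?X W" "w \<in> W" and SW: "S \<times> W \<subseteq> Q"
      by simp_all
    obtain \<delta> where \<delta>: "\<delta> > 0" "ball 0 \<delta> \<subseteq> S" using S open_contains_ball by blast
    have "eventually (\<lambda>t. (\<gamma> t - \<gamma> 0) /\<^sub>R t \<in> W) (at 0)"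
      using \<gamma> W by (rule limitinD)
    moreover have "eventually (\<lambda>t::real. \<bar>t\<bar> < \<delta> \<and> t \<noteq> 0) (at 0)"
      using \<delta>(1) by (auto simp: eventually_at intro!: exI[of _ \<delta>])
    ultimately show "eventually (\<lambda>t. dist ((f (\<gamma> t) - f (\<gamma> 0)) / t) (?D ?z) < e) (at 0)"
    proof eventually_elim
      case (elim t)
      define u where "u = (\<gamma> t - \<gamma> 0) /\<^sub>R t"
      have uX: "u \<in> topspace ?X" using elim W openin_subset u_def by blast
      have gt: "\<gamma> t = \<gamma> 0 + t *\<^sub>R u" using elim by (simp add: u_def)
      have in_Z: "join n (\<gamma> 0 + s *\<^sub>R u) u \<in> Z" if "\<bar>s\<bar> \<le> \<bar>t\<bar>" for s
      proof -
        have "s \<in> S" using that elim \<delta> by (auto simp: dist_real_def subset_iff)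
        then have "(s, u) \<in> Q" using SW elim by (auto simp: u_def)
        then show ?thesis by (simp add: Q_def)
      qed
      have in_V: "\<gamma> 0 + s *\<^sub>R u \<in> V" if "\<bar>s\<bar> \<le> \<bar>t\<bar>" for s
      proof -
        have "\<gamma> 0 + s *\<^sub>R u \<in> topspace ?X" using vector_topologyD[OF X] uX g0 by blast
        with in_Z[OF that] uX show ?thesis by (auto simp: Z_def tangent_domain_def)
      qed
      obtain s where s: "\<bar>s\<bar> \<le> \<bar>t\<bar>"
        "f (\<gamma> 0 + t *\<^sub>R u) - f (\<gamma> 0 + 0 *\<^sub>R u) = t * ?D (join n (\<gamma> 0 + s *\<^sub>R u) u)"
        using mean_value_symmetric[of t "\<lambda>s. f (\<gamma> 0 + s *\<^sub>R u)" "\<lambda>s. ?D (join n (\<gamma> 0 + s *\<^sub>R u) u)"]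
          C1_has_real_derivative_along_line[OF V f in_V uX] by blast
      then have "(f (\<gamma> t) - f (\<gamma> 0)) / t = ?D (join n (\<gamma> 0 + s *\<^sub>R u) u)"
        using elim by (simp add: gt[symmetric])
      with in_Z[OF s(1)] show ?case by (simp add: Z_def dist_commute)
    qed
  qed
  then show ?thesis by (simp add: DERIV_def)
qed

section \<open>Closure properties of \<open>C\<^sup>k\<close> maps\<close>

text \<open>
  Rearranging and repeating coordinates. Such maps are stable under differentiation: the
  differential of \<open>f \<circ> select n \<sigma>\<close> is the differential of \<open>f\<close> composed with another selection.
\<close>

definition select :: "nat \<Rightarrow> (nat \<Rightarrow> nat) \<Rightarrow> (nat \<Rightarrow> 'e::real_vector) \<Rightarrow> nat \<Rightarrow> 'e" where
  "select n \<sigma> x = (\<lambda>i. if i < n then x (\<sigma> i) else 0)"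

lemma select_line: "select n \<sigma> (x + t *\<^sub>R v) = select n \<sigma> x + t *\<^sub>R select n \<sigma> v"
  by (auto simp: select_def fun_eq_iff scaleR_fun_def)

lemma select_in:
  "(\<And>i. i < n \<Longrightarrow> \<sigma> i < m) \<Longrightarrow> x \<in> topspace (power_space E m) \<Longrightarrow> select n \<sigma> x \<in> topspace (power_space E n)"
  by (auto simp: select_def topspace_power_space)

lemma continuous_map_select:
  assumes "\<And>i. i < n \<Longrightarrow> \<sigma> i < m"
  shows "continuous_map (power_space E m) (power_space E n) (select n \<sigma>)"
  using assms unfolding continuous_map_power_space
  by (auto simp: select_def intro!: continuous_map_component)

lemma Ck_on_select:
  assumes E: "vector_topology E" and F: "Hausdorff_space F"
  shows "openin (power_space E n) V \<Longrightarrow> openin (power_space E m) U \<Longrightarrow>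
    (\<And>i. i < n \<Longrightarrow> \<sigma> i < m) \<Longrightarrow> (\<And>x. x \<in> U \<Longrightarrow> select n \<sigma> x \<in> V) \<Longrightarrow>
    Ck_on k n E F V f \<Longrightarrow> Ck_on k m E F U (\<lambda>x. f (select n \<sigma> x))"
proof (induction k arbitrary: n V m U \<sigma> f)
  case 0
  have "continuous_map (subtopology (power_space E m) U) (subtopology (power_space E n) V) (select n \<sigma>)"
    using 0 by (auto simp: continuous_map_in_subtopology intro: continuous_map_from_subtopology continuous_map_select)
  from continuous_map_compose[OF this] 0(5) show ?case by (force simp: o_def)
next
  case (Suc k)
  let ?\<sigma> = "\<lambda>i. if i < n then \<sigma> i else m + \<sigma> (i - n)"
  have eq: "select (2 * n) ?\<sigma> z = join n (select n \<sigma> (base_point m z)) (select n \<sigma> (direction m z))" for z :: "nat \<Rightarrow> 'a"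
    using Suc.prems(3) by (auto simp: select_def join_def base_point_def direction_def fun_eq_iff)
  have dir: "select n \<sigma> (direction m z) \<in> topspace (power_space E n)" if "z \<in> tangent_domain m E U" for z
    using that Suc.prems(3) by (intro select_in direction_in) (auto simp: tangent_domain_def)
  have bas: "select n \<sigma> (base_point m z) \<in> V" if "z \<in> tangent_domain m E U" for z
    using that Suc.prems(4) by (auto simp: tangent_domain_def)
  have in_T: "select (2 * n) ?\<sigma> z \<in> tangent_domain n E V" if "z \<in> tangent_domain m E U" for z
    unfolding eq using join_in_tangent_domain[OF openin_subset[OF Suc.prems(1)] bas[OF that] dir[OF that]] .
  show ?case
  proof (rule Ck_on_SucI[OF E F Suc.prems(2)])
    show "continuous_map (subtopology (power_space E m) U) F (\<lambda>x. f (select n \<sigma> x))"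
    proof -
      have "continuous_map (subtopology (power_space E m) U) (subtopology (power_space E n) V) (select n \<sigma>)"
        using Suc.prems by (auto simp: continuous_map_in_subtopology intro: continuous_map_from_subtopology continuous_map_select)
      from continuous_map_compose[OF this Ck_on_imp_continuous[OF Suc.prems(5)]] show ?thesis by (simp add: o_def)
    qed
    show "has_directional_derivative F (\<lambda>x. f (select n \<sigma> x)) (base_point m z) (direction m z)
            (differential n F f (select (2 * n) ?\<sigma> z))" if z: "z \<in> tangent_domain m E U" for z
    proof -
      have "select n \<sigma> (base_point m z) \<in> topspace (power_space E n)"
        using bas[OF z] Suc.prems(1) openin_subset by blast
      then show ?thesis
        using Ck_on_SucD(1)[OF F Suc.prems(5) in_T[OF z]] dir[OF z]
        by (simp add: has_directional_derivative_def select_line eq)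
    qed
    show "Ck_on k (2 * m) E F (tangent_domain m E U) (\<lambda>z. differential n F f (select (2 * n) ?\<sigma> z))"
    proof (rule Suc.IH[OF openin_tangent_domain[OF Suc.prems(1)] openin_tangent_domain[OF Suc.prems(2)] _ in_T
            Ck_on_SucD(2)[OF F Suc.prems(5)]])
      fix i assume "i < 2 * n"
      then show "?\<sigma> i < 2 * m"
        using Suc.prems(3)[of i] Suc.prems(3)[of "i - n"] by (cases "i < n") auto
    qed
  qed
qed

text \<open>
  Differentials of products and composites contain undifferentiated factors, evaluated at the base point.
  This rule regards them as maps on the tangent domain.
\<close>

lemma Ck_on_base_point:
  assumes E: "vector_topology E" and F: "Hausdorff_space F" and U: "openin (power_space E m) U"
    and f: "Ck_on k m E F U f"
  shows "Ck_on k (2 * m) E F (tangent_domain m E U) (\<lambda>z. f (base_point m z))"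
proof -
  have eq: "select m id z = base_point m z" for z :: "nat \<Rightarrow> 'a"
    by (auto simp: select_def base_point_def)
  have "Ck_on k (2 * m) E F (tangent_domain m E U) (\<lambda>z. f (select m id z))"
    by (rule Ck_on_select[OF E F U openin_tangent_domain[OF U] _ _ f]) (auto simp: eq tangent_domain_def)
  then show ?thesis by (simp add: eq)
qed

definition tuple :: "nat \<Rightarrow> (nat \<Rightarrow> 'x \<Rightarrow> 'e::real_vector) \<Rightarrow> 'x \<Rightarrow> nat \<Rightarrow> 'e" where
  "tuple n G x = (\<lambda>i. if i < n then G i x else 0)"

text \<open>
  The chain rule for a tuple \<open>G\<close> of maps into \<open>F\<close>. Tuples make the induction close: the
  differential of the composite is the differential of \<open>f\<close>, a map on \<open>F\<^sup>2\<^sup>n\<close>, composed with the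
  \<open>2n\<close>-tuple formed by the \<open>G\<^sub>i\<close> at the base point and the differentials of the \<open>G\<^sub>i\<close>.
\<close>

lemma Ck_on_compose:
  assumes E: "vector_topology E" and F: "vector_topology F"
  shows "openin (power_space E m) U \<Longrightarrow> openin (power_space F n) V \<Longrightarrow>
    (\<And>i. i < n \<Longrightarrow> Ck_on k m E F U (G i)) \<Longrightarrow> (\<And>x. x \<in> U \<Longrightarrow> tuple n G x \<in> V) \<Longrightarrow>
    Ck_on k n F euclideanreal V f \<Longrightarrow> Ck_on k m E euclideanreal U (\<lambda>x. f (tuple n G x))"
proof (induction k arbitrary: n V m U G f)
  case 0
  have "continuous_map (subtopology (power_space E m) U) (subtopology (power_space F n) V) (tuple n G)"
    using 0 by (auto simp: continuous_map_in_subtopology continuous_map_power_space tuple_def)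
  from continuous_map_compose[OF this] 0(5) show ?case by (force simp: o_def)
next
  case (Suc k)
  have HF: "Hausdorff_space F" using F by (simp add: vector_topology_def)
  have X: "vector_topology (power_space F n)" using vector_topology_power_space[OF F] .
  define G' where "G' i z = (if i < n then G i (base_point m z) else differential m F (G (i - n)) z)" for i z
  let ?w = "\<lambda>z. tuple n (\<lambda>i. differential m F (G i)) z"
  have eq: "tuple (2 * n) G' z = join n (tuple n G (base_point m z)) (?w z)" for z
    by (auto simp: tuple_def G'_def join_def fun_eq_iff)
  have bas: "tuple n G (base_point m z) \<in> V" if "z \<in> tangent_domain m E U" for z
    using that Suc.prems(4) by (auto simp: tangent_domain_def)
  have dd: "has_directional_derivative F (G i) (base_point m z) (direction m z) (differential m F (G i) z)"
    if "z \<in> tangent_domain m E U" "i < n" for i z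
    using Ck_on_SucD(1)[OF HF Suc.prems(3)[OF that(2)] that(1)] .
  have dir: "?w z \<in> topspace (power_space F n)" if "z \<in> tangent_domain m E U" for z
    using dd[OF that, unfolded has_directional_derivative_def, THEN limitin_topspace]
    by (simp add: tuple_def topspace_power_space)
  have in_T: "tuple (2 * n) G' z \<in> tangent_domain n F V" if "z \<in> tangent_domain m E U" for z
    unfolding eq using join_in_tangent_domain[OF openin_subset[OF Suc.prems(2)] bas[OF that] dir[OF that]] .
  show ?case
  proof (rule Ck_on_SucI[OF E _ Suc.prems(1)])
    show "continuous_map (subtopology (power_space E m) U) euclideanreal (\<lambda>x. f (tuple n G x))"
    proof -
      have "continuous_map (subtopology (power_space E m) U) (subtopology (power_space F n) V) (tuple n G)"
        using Suc.prems Ck_on_imp_continuous[OF Suc.prems(3)]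
        by (auto simp: continuous_map_in_subtopology continuous_map_power_space tuple_def)
      from continuous_map_compose[OF this Ck_on_imp_continuous[OF Suc.prems(5)]] show ?thesis by (simp add: o_def)
    qed
    show "has_directional_derivative euclideanreal (\<lambda>x. f (tuple n G x)) (base_point m z) (direction m z)
            (differential n euclideanreal f (tuple (2 * n) G' z))" if z: "z \<in> tangent_domain m E U" for z
    proof -
      let ?x = "base_point m z" and ?v = "direction m z"
      let ?\<gamma> = "\<lambda>t::real. tuple n G (?x + t *\<^sub>R ?v)"
      have "limitin (power_space F n) (\<lambda>t::real. (?\<gamma> t - ?\<gamma> 0) /\<^sub>R t) (?w z) (at 0)"
      proof (rule limitin_power_space)
        have quot: "((?\<gamma> t - ?\<gamma> 0) /\<^sub>R t) i = (G i (?x + t *\<^sub>R ?v) - G i ?x) /\<^sub>R t" if "i < n" for i t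
          using that by (simp add: tuple_def scaleR_fun_apply)
        show "limitin F (\<lambda>t. ((?\<gamma> t - ?\<gamma> 0) /\<^sub>R t) i) (?w z i) (at 0)" if i: "i < n" for i
          unfolding quot[OF i] using dd[OF z i] i by (simp add: tuple_def has_directional_derivative_def)
        show "?w z i = 0" if "n \<le> i" for i using that by (simp add: tuple_def)
        show "((?\<gamma> t - ?\<gamma> 0) /\<^sub>R t) i = 0" if "n \<le> i" for i t
          using that by (simp add: tuple_def scaleR_fun_def)
      qed
      then have "((\<lambda>t. f (?\<gamma> t)) has_real_derivative differential n euclideanreal f (join n (?\<gamma> 0) (?w z))) (at 0)"
        by (intro C1_chain_rule_curve[OF F Suc.prems(2) Suc.prems(5)]) (simp_all add: bas[OF z])
      then show ?thesis
        by (simp add: has_directional_derivative_real_iff eq)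
    qed
    show "Ck_on k (2 * m) E euclideanreal (tangent_domain m E U)
            (\<lambda>z. differential n euclideanreal f (tuple (2 * n) G' z))"
    proof (rule Suc.IH[OF openin_tangent_domain[OF Suc.prems(1)] openin_tangent_domain[OF Suc.prems(2)] _ in_T
            Ck_on_SucD(2)[OF _ Suc.prems(5)]])
      fix i assume i: "i < 2 * n"
      show "Ck_on k (2 * m) E F (tangent_domain m E U) (G' i)"
      proof (cases "i < n")
        case True
        then show ?thesis unfolding G'_def
          using Ck_on_base_point[OF E HF Suc.prems(1) Ck_on_Suc_imp[OF Suc.prems(3)[OF True]]] by simp
      next
        case False
        then have "i - n < n" using i by simp
        then show ?thesis unfolding G'_def
          using False Ck_on_SucD(2)[OF HF Suc.prems(3)] by simp
      qed
    qed (auto simp: Hausdorff_space_euclidean)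
  qed (auto simp: Hausdorff_space_euclidean)
qed

lemma Ck_on_add:
  assumes E: "vector_topology E"
  shows "openin (power_space E m) U \<Longrightarrow> Ck_on k m E euclideanreal U f \<Longrightarrow> Ck_on k m E euclideanreal U g \<Longrightarrow>
    Ck_on k m E euclideanreal U (\<lambda>x. f x + g x)"
proof (induction k arbitrary: m U f g)
  case 0
  then show ?case by (auto intro: continuous_map_add)
next
  case (Suc k)
  note D = Ck_on_SucD[OF Hausdorff_space_euclidean]
  show ?case
  proof (rule Ck_on_SucI[OF E _ Suc.prems(1)])
    show "continuous_map (subtopology (power_space E m) U) euclideanreal (\<lambda>x. f x + g x)"
      using Suc.prems(2,3)[THEN Ck_on_imp_continuous] by (rule continuous_map_add)
    show "has_directional_derivative euclideanreal (\<lambda>x. f x + g x) (base_point m z) (direction m z)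
       (differential m euclideanreal f z + differential m euclideanreal g z)" if "z \<in> tangent_domain m E U" for z
      using D(1)[OF Suc.prems(2) that] D(1)[OF Suc.prems(3) that]
      unfolding has_directional_derivative_real_iff by (rule DERIV_add)
    show "Ck_on k (2 * m) E euclideanreal (tangent_domain m E U)
        (\<lambda>z. differential m euclideanreal f z + differential m euclideanreal g z)"
      by (rule Suc.IH[OF openin_tangent_domain[OF Suc.prems(1)] D(2)[OF Suc.prems(2)] D(2)[OF Suc.prems(3)]])
  qed simp
qed

lemma Ck_on_mult:
  assumes E: "vector_topology E"
  shows "openin (power_space E m) U \<Longrightarrow> Ck_on k m E euclideanreal U f \<Longrightarrow> Ck_on k m E euclideanreal U g \<Longrightarrow>
    Ck_on k m E euclideanreal U (\<lambda>x. f x * g x)"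
proof (induction k arbitrary: m U f g)
  case 0
  then show ?case by (auto intro: continuous_map_real_mult)
next
  case (Suc k)
  note D = Ck_on_SucD[OF Hausdorff_space_euclidean]
  note H = Hausdorff_space_euclidean
  note T = openin_tangent_domain[OF Suc.prems(1)]
  let ?df = "differential m euclideanreal f" and ?dg = "differential m euclideanreal g"
  show ?case
  proof (rule Ck_on_SucI[OF E _ Suc.prems(1)])
    show "continuous_map (subtopology (power_space E m) U) euclideanreal (\<lambda>x. f x * g x)"
      using Suc.prems(2,3)[THEN Ck_on_imp_continuous] by (rule continuous_map_real_mult)
    show "has_directional_derivative euclideanreal (\<lambda>x. f x * g x) (base_point m z) (direction m z)
       (?df z * g (base_point m z) + ?dg z * f (base_point m z))" if "z \<in> tangent_domain m E U" for z
      using DERIV_mult[OF D(1)[OF Suc.prems(2) that, unfolded has_directional_derivative_real_iff]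
          D(1)[OF Suc.prems(3) that, unfolded has_directional_derivative_real_iff]]
      by (simp add: has_directional_derivative_real_iff)
    show "Ck_on k (2 * m) E euclideanreal (tangent_domain m E U)
        (\<lambda>z. ?df z * g (base_point m z) + ?dg z * f (base_point m z))"
      using Suc.IH[OF T D(2)[OF Suc.prems(2)] Ck_on_base_point[OF E H Suc.prems(1) Ck_on_Suc_imp[OF Suc.prems(3)]]]
        Suc.IH[OF T D(2)[OF Suc.prems(3)] Ck_on_base_point[OF E H Suc.prems(1) Ck_on_Suc_imp[OF Suc.prems(2)]]]
      by (rule Ck_on_add[OF E T])
  qed simp
qed

text \<open>
  The sequence \<open>\<rho>\<close> lists the successive derivatives of an infinitely differentiable function of one real
  variable; carrying all of them lets the induction step pass from \<open>\<rho> j\<close> to \<open>\<rho> (Suc j)\<close>.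
\<close>

lemma Ck_on_compose_real:
  fixes \<rho> :: "nat \<Rightarrow> real \<Rightarrow> real"
  assumes E: "vector_topology E"
    and \<rho>: "\<And>j t. t \<in> S \<Longrightarrow> (\<rho> j has_real_derivative \<rho> (Suc j) t) (at t)"
  shows "openin (power_space E m) U \<Longrightarrow> Ck_on k m E euclideanreal U f \<Longrightarrow> f ` U \<subseteq> S \<Longrightarrow>
    Ck_on k m E euclideanreal U (\<lambda>x. \<rho> j (f x))"
proof (induction k arbitrary: m U f j)
  case (0 m U f j)
  have "continuous_map (subtopology (power_space E m) U) euclideanreal (\<lambda>x. \<rho> j (f x))"
    unfolding continuous_map_atin
  proof
    fix x assume x: "x \<in> topspace (subtopology (power_space E m) U)"
    then have "(f \<longlongrightarrow> f x) (atin (subtopology (power_space E m) U) x)"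
      using 0(2) by (simp add: continuous_map_atin)
    moreover have "isCont (\<rho> j) (f x)" using \<rho>[of "f x" j] x 0(3) by (auto intro: DERIV_isCont)
    ultimately show "limitin euclideanreal (\<lambda>x. \<rho> j (f x)) (\<rho> j (f x)) (atin (subtopology (power_space E m) U) x)"
      by (simp add: isCont_tendsto_compose)
  qed
  then show ?case by simp
next
  case (Suc k m U f j)
  note H = Hausdorff_space_euclidean
  note D = Ck_on_SucD[OF H]
  note T = openin_tangent_domain[OF Suc.prems(1)]
  let ?df = "differential m euclideanreal f"
  show ?case
  proof (rule Ck_on_SucI[OF E _ Suc.prems(1)])
    have "Ck_on k m E euclideanreal U (\<lambda>x. \<rho> j (f x))"
      using Suc.IH[OF Suc.prems(1) Ck_on_Suc_imp[OF Suc.prems(2)] Suc.prems(3)] .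
    then show "continuous_map (subtopology (power_space E m) U) euclideanreal (\<lambda>x. \<rho> j (f x))"
      by (rule Ck_on_imp_continuous)
    show "has_directional_derivative euclideanreal (\<lambda>x. \<rho> j (f x)) (base_point m z) (direction m z)
       (\<rho> (Suc j) (f (base_point m z)) * ?df z)" if z: "z \<in> tangent_domain m E U" for z
    proof -
      have "f (base_point m z) \<in> S" using z Suc.prems(3) by (auto simp: tangent_domain_def)
      then have "(\<rho> j has_real_derivative \<rho> (Suc j) (f (base_point m z + 0 *\<^sub>R direction m z)))
          (at (f (base_point m z + 0 *\<^sub>R direction m z)))" using \<rho> by simp
      from DERIV_chain2[OF this D(1)[OF Suc.prems(2) z, unfolded has_directional_derivative_real_iff]]
      show ?thesis by (simp add: has_directional_derivative_real_iff)
    qed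
    have "(\<lambda>z. f (base_point m z)) ` tangent_domain m E U \<subseteq> S"
      using Suc.prems(3) by (auto simp: tangent_domain_def)
    then show "Ck_on k (2 * m) E euclideanreal (tangent_domain m E U)
        (\<lambda>z. \<rho> (Suc j) (f (base_point m z)) * ?df z)"
      by (intro Ck_on_mult[OF E T _ D(2)[OF Suc.prems(2)]]
          Suc.IH[OF T Ck_on_base_point[OF E H Suc.prems(1) Ck_on_Suc_imp[OF Suc.prems(2)]]])
  qed simp
qed

lemma Ck_on_const:
  assumes E: "vector_topology E"
  shows "openin (power_space E m) U \<Longrightarrow> Ck_on k m E euclideanreal U (\<lambda>x. c)"
proof (induction k arbitrary: m U c)
  case (Suc k)
  show ?case
    by (rule Ck_on_SucI[OF E _ Suc.prems _ _ Suc.IH[OF openin_tangent_domain[OF Suc.prems], of 0]])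
      (auto simp: has_directional_derivative_real_iff)
qed simp

lemma Ck_on_linear:
  assumes E: "vector_topology E" and l: "linear_functional E l" "continuous_map E euclideanreal l"
  shows "openin (power_space E m) U \<Longrightarrow> i < m \<Longrightarrow> Ck_on k m E euclideanreal U (\<lambda>x. l (x i))"
proof (induction k arbitrary: m U i)
  case (0 m U i)
  have "continuous_map (power_space E m) euclideanreal (\<lambda>x. l (x i))"
    using continuous_map_compose[OF continuous_map_component[OF 0(2)] l(2)] by (simp add: o_def)
  then show ?case by (simp add: continuous_map_from_subtopology)
next
  case (Suc k m U i)
  show ?case
  proof (rule Ck_on_SucI[OF E _ Suc.prems(1)])
    have "continuous_map (power_space E m) euclideanreal (\<lambda>x. l (x i))"
      using continuous_map_compose[OF continuous_map_component[OF Suc.prems(2)] l(2)] by (simp add: o_def)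
    then show "continuous_map (subtopology (power_space E m) U) euclideanreal (\<lambda>x. l (x i))"
      by (simp add: continuous_map_from_subtopology)
    show "has_directional_derivative euclideanreal (\<lambda>x. l (x i)) (base_point m z) (direction m z) (l (z (m + i)))"
      if z: "z \<in> tangent_domain m E U" for z
    proof -
      have "z i \<in> topspace E" "z (m + i) \<in> topspace E"
        using tangent_domain_in[OF z] Suc.prems(2) by (auto simp: topspace_power_space)
      then have "l (z i + t *\<^sub>R z (m + i)) = l (z i) + t * l (z (m + i))" for t
        using l(1) vector_topologyD[OF E] by (simp add: linear_functional_def)
      then show ?thesis
        using Suc.prems(2) unfolding has_directional_derivative_real_iff
        by (auto simp: base_point_def direction_def scaleR_fun_def intro!: derivative_eq_intros)
    qed
    show "Ck_on k (2 * m) E euclideanreal (tangent_domain m E U) (\<lambda>z. l (z (m + i)))"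
      by (rule Suc.IH[OF openin_tangent_domain[OF Suc.prems(1)]]) (use Suc.prems in simp)
  qed simp
qed

text \<open>
  The differential of \<open>B(x\<^sub>i, x\<^sub>j)\<close> at \<open>(x, v)\<close> is \<open>B(x\<^sub>i, v\<^sub>j) + B(v\<^sub>i, x\<^sub>j)\<close>, a sum of two maps of the same form on
  \<open>E\<^sup>2\<^sup>m\<close>, which is why the coordinates \<open>i\<close> and \<open>j\<close> are kept general.
\<close>

lemma Ck_on_bilinear:
  assumes E: "vector_topology E" and B: "continuous_map (prod_topology E E) euclideanreal (\<lambda>(x, y). B x y)"
    and l: "\<And>x. x \<in> topspace E \<Longrightarrow> linear_functional E (B x)"
    and l': "\<And>y. y \<in> topspace E \<Longrightarrow> linear_functional E (\<lambda>x. B x y)"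
  shows "openin (power_space E m) U \<Longrightarrow> i < m \<Longrightarrow> j < m \<Longrightarrow> Ck_on k m E euclideanreal U (\<lambda>x. B (x i) (x j))"
proof (induction k arbitrary: m U i j)
  case (0 m U i j)
  have "continuous_map (power_space E m) euclideanreal (\<lambda>x. B (x i) (x j))"
    using continuous_map_compose[OF continuous_map_pairedI[OF continuous_map_component[OF 0(2)] continuous_map_component[OF 0(3)]] B]
    by (simp add: o_def)
  then show ?case by (simp add: continuous_map_from_subtopology)
next
  case (Suc k m U i j)
  show ?case
  proof (rule Ck_on_SucI[OF E _ Suc.prems(1)])
    have "continuous_map (power_space E m) euclideanreal (\<lambda>x. B (x i) (x j))"
      using continuous_map_compose[OF continuous_map_pairedI[OF continuous_map_component[OF Suc.prems(2)] continuous_map_component[OF Suc.prems(3)]] B]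
      by (simp add: o_def)
    then show "continuous_map (subtopology (power_space E m) U) euclideanreal (\<lambda>x. B (x i) (x j))"
      by (simp add: continuous_map_from_subtopology)
    show "has_directional_derivative euclideanreal (\<lambda>x. B (x i) (x j)) (base_point m z) (direction m z)
       (B (z i) (z (m + j)) + B (z (m + i)) (z j))"
      if z: "z \<in> tangent_domain m E U" for z
    proof -
      have zs: "z i \<in> topspace E" "z (m + i) \<in> topspace E" "z j \<in> topspace E" "z (m + j) \<in> topspace E"
        using tangent_domain_in[OF z] Suc.prems by (auto simp: topspace_power_space)
      then have "B (z i + t *\<^sub>R z (m + i)) (z j + t *\<^sub>R z (m + j)) =
         B (z i) (z j) + t * B (z i) (z (m + j)) + t * (B (z (m + i)) (z j) + t * B (z (m + i)) (z (m + j)))" for t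
        using l l' vector_topologyD[OF E] by (simp add: linear_functional_def algebra_simps)
      then show ?thesis
        using Suc.prems unfolding has_directional_derivative_real_iff
        by (auto simp: base_point_def direction_def scaleR_fun_def intro!: derivative_eq_intros)
    qed
    show "Ck_on k (2 * m) E euclideanreal (tangent_domain m E U)
       (\<lambda>z. B (z i) (z (m + j)) + B (z (m + i)) (z j))"
      using Suc.prems(2,3) openin_tangent_domain[OF Suc.prems(1)]
      by (intro Ck_on_add[OF E _ Suc.IH Suc.IH]) simp_all
  qed simp
qed

section \<open>Continuous seminorms\<close>

lemma continuous_map_real_criterion:
  assumes "\<And>x e. x \<in> topspace X \<Longrightarrow> e > 0 \<Longrightarrow> \<exists>U. openin X U \<and> x \<in> U \<and> (\<forall>y\<in>U. \<bar>f y - f x\<bar> < e)"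
  shows "continuous_map X euclideanreal f"
  unfolding continuous_map_atin limitin_canonical_iff tendsto_iff dist_real_def
proof (intro ballI allI impI)
  fix x and e :: real assume "x \<in> topspace X" "e > 0"
  from assms[OF this] show "\<forall>\<^sub>F y in atin X x. \<bar>f y - f x\<bar> < e"
    by (auto simp: eventually_atin)
qed

lemma continuous_seminormD:
  assumes "continuous_seminorm E p"
  shows "x \<in> topspace E \<Longrightarrow> y \<in> topspace E \<Longrightarrow> p (x + y) \<le> p x + p y"
    and "x \<in> topspace E \<Longrightarrow> p (c *\<^sub>R x) = \<bar>c\<bar> * p x"
    and "continuous_map E euclideanreal p"
  using assms by (auto simp: continuous_seminorm_def)

lemma
  assumes E: "vector_topology E" and p: "continuous_seminorm E p"
  shows seminorm_0: "p 0 = 0"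
    and seminorm_nonneg: "x \<in> topspace E \<Longrightarrow> 0 \<le> p x"
    and seminorm_triangle: "x \<in> topspace E \<Longrightarrow> y \<in> topspace E \<Longrightarrow> z \<in> topspace E \<Longrightarrow>
      p (x - z) \<le> p (x - y) + p (y - z)"
proof -
  note V = vector_topologyD[OF E] and P = continuous_seminormD[OF p]
  show p0: "p 0 = 0" using P(2)[OF V(1), of 0] by simp
  have neg: "p (- x) = p x" if "x \<in> topspace E" for x
    using P(2)[OF that, of "-1"] by simp
  show "0 \<le> p x" if "x \<in> topspace E" for x
  proof -
    have "- x \<in> topspace E" using V(4)[OF that, of "-1"] by simp
    from P(1)[OF that this] p0 neg[OF that] show ?thesis by simp
  qed
  show "p (x - z) \<le> p (x - y) + p (y - z)" if "x \<in> topspace E" "y \<in> topspace E" "z \<in> topspace E"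
    using P(1)[OF V(3)[OF that(1,2)] V(3)[OF that(2,3)]] by simp
qed

lemma linear_functional_diff:
  assumes E: "vector_topology E" and f: "linear_functional E f" and "x \<in> topspace E" "y \<in> topspace E"
  shows "f (x - y) = f x - f y"
proof -
  have "f (x + (-1) *\<^sub>R y) = f x + (-1) * f y"
    using f vector_topologyD(4)[OF E assms(4)] assms(3,4) unfolding linear_functional_def by metis
  then show ?thesis by simp
qed

lemma linear_functional_quotient:
  assumes F: "vector_topology F" and l: "linear_functional F l" and "x \<in> topspace F" "y \<in> topspace F"
  shows "l ((x - y) /\<^sub>R t) = (l x - l y) / t"
  using l linear_functional_diff[OF F l assms(3,4)] vector_topologyD(3)[OF F assms(3,4)]
  by (simp add: linear_functional_def divide_inverse mult.commute)

lemma openin_seminorm_ball: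
  assumes E: "vector_topology E" and p: "continuous_seminorm E p" and x: "x \<in> topspace E"
  shows "openin E {y \<in> topspace E. p (y - x) < e}"
proof -
  have "continuous_map E E (\<lambda>y. y - x)"
    by (intro continuous_map_minus_vector[OF E]) (use x in \<open>simp_all add: continuous_map_id[unfolded id_def] continuous_map_const\<close>)
  from continuous_map_compose[OF this continuous_seminormD(3)[OF p]]
  have c: "continuous_map E euclideanreal (\<lambda>y. p (y - x))" by (simp add: o_def)
  have "openin E {y \<in> topspace E. p (y - x) \<in> {..<e}}"
    by (rule openin_continuous_map_preimage[OF c]) simp
  then show ?thesis by simp
qed

text \<open>
  For a linear functional \<open>f\<close> the increment \<open>f y - f x\<close> is \<open>f (y - x)\<close>, which the seminorm controls.
\<close>

lemma dominated_linear_functional_continuous: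
  assumes E: "vector_topology E" and p: "continuous_seminorm E p" and f: "linear_functional E f"
    and le: "\<And>x. x \<in> topspace E \<Longrightarrow> \<bar>f x\<bar> \<le> C * p x"
  shows "continuous_map E euclideanreal f"
proof (rule continuous_map_real_criterion)
  fix x and e :: real assume x: "x \<in> topspace E" and e: "e > 0"
  define D where "D = \<bar>C\<bar> + 1"
  have D: "D > 0" "C \<le> D" by (auto simp: D_def)
  let ?U = "{y \<in> topspace E. p (y - x) < e / D}"
  have "\<bar>f y - f x\<bar> < e" if y: "y \<in> ?U" for y
  proof -
    have yx: "y - x \<in> topspace E" using y x vector_topologyD(3)[OF E] by blast
    have "\<bar>f y - f x\<bar> = \<bar>f (y - x)\<bar>" using linear_functional_diff[OF E f] x y by simp
    also have "\<dots> \<le> C * p (y - x)" using le[OF yx] .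
    also have "\<dots> \<le> D * p (y - x)" using D seminorm_nonneg[OF E p yx] by (simp add: mult_right_mono)
    also have "\<dots> < e" using y D by (simp add: field_simps)
    finally show ?thesis .
  qed
  moreover have "x \<in> ?U" using x e D seminorm_0[OF E p] by simp
  ultimately show "\<exists>U. openin E U \<and> x \<in> U \<and> (\<forall>y\<in>U. \<bar>f y - f x\<bar> < e)"
    using openin_seminorm_ball[OF E p x] by blast
qed

text \<open>
  The seminorm is the gauge of a convex symmetric neighbourhood contained in \<open>U\<close>.
\<close>

lemma seminorm_inside_neighbourhood_of_0:
  fixes E :: "'e::real_vector topology"
  assumes lc: "locally_convex_space E" and U: "openin E U" "0 \<in> U"
  obtains p where "continuous_seminorm E p" "\<And>x. x \<in> topspace E \<Longrightarrow> p x < 1 \<Longrightarrow> x \<in> U"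
proof -
  have E: "vector_topology E" using lc by (rule locally_convex_imp_vector_topology)
  note T = vector_topologyD[OF E]
  obtain V where V: "openin E V" "convex V" "0 \<in> V" "V \<subseteq> U"
    using lc U unfolding locally_convex_space_def by blast
  \<comment> \<open>Intersecting \<open>V\<close> with its reflection makes the gauge absolutely homogeneous.\<close>
  define W where "W = {x \<in> topspace E. x \<in> V \<and> (-1) *\<^sub>R x \<in> V}"
  have scont: "continuous_map E E (\<lambda>x. c *\<^sub>R x)" for c
    by (intro continuous_map_scaleR[OF E]) (simp_all add: continuous_map_id[unfolded id_def])
  have Wo: "openin E W"
  proof -
    have "openin E {x \<in> topspace E. (-1) *\<^sub>R x \<in> V}"
      by (rule openin_continuous_map_preimage[OF scont V(1)])
    from openin_Int[OF V(1) this] have "openin E (V \<inter> {x \<in> topspace E. (-1) *\<^sub>R x \<in> V})" .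
    moreover have "V \<inter> {x \<in> topspace E. (-1) *\<^sub>R x \<in> V} = W"
      using openin_subset[OF V(1)] by (auto simp: W_def)
    ultimately show ?thesis by simp
  qed
  have W0: "0 \<in> W" using V T by (simp add: W_def)
  have W_convex: "a *\<^sub>R x + b *\<^sub>R y \<in> W" if "x \<in> W" "y \<in> W" "a \<ge> 0" "b \<ge> 0" "a + b = 1" for a b x y
  proof -
    have "a *\<^sub>R ((-1) *\<^sub>R x) + b *\<^sub>R ((-1) *\<^sub>R y) \<in> V"
      using that V(2) unfolding W_def by (intro convexD) auto
    moreover have "a *\<^sub>R x + b *\<^sub>R y \<in> V"
      using that V(2) unfolding W_def by (intro convexD) auto
    ultimately show ?thesis using that T by (simp add: W_def algebra_simps)
  qed
  have W_neg: "- x \<in> W" if "x \<in> W" for x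
    using that T(4)[of x "-1"] by (simp add: W_def)
  have W_shrink: "a *\<^sub>R x \<in> W" if "x \<in> W" "0 \<le> a" "a \<le> 1" for a x
    using W_convex[OF that(1) W0, of a "1 - a"] that by simp
  define S where "S x = {t::real. t > 0 \<and> x /\<^sub>R t \<in> W}" for x
  define p where "p x = Inf (S x)" for x
  have S_pos: "t > 0" if "t \<in> S x" for t x using that by (simp add: S_def)
  have S_bdd: "bdd_below (S x)" for x using S_pos by (meson bdd_belowI less_imp_le)
  have S_ne: "S x \<noteq> {}" if x: "x \<in> topspace E" for x
  proof -
    have "eventually (\<lambda>t::real. 0 + t *\<^sub>R x \<in> W) (at 0)"
      by (rule eventually_line_in[OF E Wo W0 x])
    then obtain d where d: "d > 0" "\<And>t. t \<noteq> 0 \<Longrightarrow> \<bar>t\<bar> < d \<Longrightarrow> t *\<^sub>R x \<in> W"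
      by (auto simp: eventually_at)
    have "x /\<^sub>R (2 / d) \<in> W" using d(2)[of "d / 2"] d(1) by (simp add: field_simps)
    then have "2 / d \<in> S x" using d(1) by (simp add: S_def)
    then show ?thesis by blast
  qed
  have p_le: "p x \<le> t" if "t \<in> S x" for x t
    unfolding p_def using that S_bdd by (rule cInf_lower)
  have S_up: "s \<in> S x" if "t \<in> S x" "t \<le> s" for s t x
  proof -
    have "t > 0" using that S_pos by blast
    moreover have "(t / s) *\<^sub>R (x /\<^sub>R t) \<in> W"
      using that \<open>t > 0\<close> by (intro W_shrink[of "x /\<^sub>R t" "t / s"]) (auto simp: S_def)
    ultimately show ?thesis using that by (simp add: S_def field_simps)
  qed
  have p_less: "t \<in> S x" if x: "x \<in> topspace E" and px: "p x < t" for x t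
  proof -
    obtain s where "s \<in> S x" "s < t"
      using cInf_lessD[OF S_ne[OF x]] px unfolding p_def by blast
    then show ?thesis using S_up by fastforce
  qed
  have p_nonneg: "0 \<le> p x" if "x \<in> topspace E" for x
    unfolding p_def using S_ne[OF that] S_pos by (intro cInf_greatest) (auto intro: less_imp_le)
  have add: "p (x + y) \<le> p x + p y" if x: "x \<in> topspace E" and y: "y \<in> topspace E" for x y
  proof (rule field_le_epsilon)
    fix e :: real assume e: "e > 0"
    define s t where "s = p x + e / 2" and "t = p y + e / 2"
    have s: "s \<in> S x" and t: "t \<in> S y" using p_less x y e by (auto simp: s_def t_def)
    have pos: "s > 0" "t > 0" using s t S_pos by auto
    have "(s / (s + t)) *\<^sub>R (x /\<^sub>R s) + (t / (s + t)) *\<^sub>R (y /\<^sub>R t) \<in> W"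
      using s t pos by (intro W_convex) (auto simp: S_def add_divide_distrib[symmetric])
    also have "(s / (s + t)) *\<^sub>R (x /\<^sub>R s) + (t / (s + t)) *\<^sub>R (y /\<^sub>R t) = (x + y) /\<^sub>R (s + t)"
      using pos by (simp add: scaleR_add_right field_simps)
    finally have "s + t \<in> S (x + y)" using pos by (simp add: S_def)
    from p_le[OF this] show "p (x + y) \<le> p x + p y + e" by (simp add: s_def t_def)
  qed
  have le: "p (c *\<^sub>R x) \<le> \<bar>c\<bar> * p x" if x: "x \<in> topspace E" and c: "c \<noteq> 0" for x c
  proof (rule field_le_epsilon)
    fix e :: real assume e: "e > 0"
    define t where "t = p x + e / \<bar>c\<bar>"
    have t: "t \<in> S x" using p_less x e c by (simp add: t_def)
    have "t > 0" using t S_pos by auto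
    have "(c *\<^sub>R x) /\<^sub>R (\<bar>c\<bar> * t) = (if c > 0 then x /\<^sub>R t else - (x /\<^sub>R t))"
      using c \<open>t > 0\<close> by (simp add: field_simps)
    also have "\<dots> \<in> W" using t W_neg by (auto simp: S_def)
    finally have "\<bar>c\<bar> * t \<in> S (c *\<^sub>R x)" using c \<open>t > 0\<close> by (simp add: S_def)
    from p_le[OF this] have "p (c *\<^sub>R x) \<le> \<bar>c\<bar> * t" .
    also have "\<bar>c\<bar> * t = \<bar>c\<bar> * p x + e" using c by (simp add: t_def distrib_left)
    finally show "p (c *\<^sub>R x) \<le> \<bar>c\<bar> * p x + e" .
  qed
  have p0: "p 0 = 0"
  proof -
    have "p 0 \<le> e" if "e > 0" for e using that W0 by (intro p_le) (simp add: S_def)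
    then have "p 0 \<le> 0" by (rule field_le_epsilon) simp
    then show ?thesis using p_nonneg[OF T(1)] by simp
  qed
  have scale: "p (c *\<^sub>R x) = \<bar>c\<bar> * p x" if x: "x \<in> topspace E" for x c
  proof (cases "c = 0")
    case True then show ?thesis by (simp add: p0)
  next
    case False
    have "p x \<le> \<bar>inverse c\<bar> * p (c *\<^sub>R x)"
      using le[OF T(4)[OF x, of c], of "inverse c"] False by simp
    then have "\<bar>c\<bar> * p x \<le> \<bar>c\<bar> * (\<bar>inverse c\<bar> * p (c *\<^sub>R x))"
      by (rule mult_left_mono) simp
    then have "\<bar>c\<bar> * p x \<le> p (c *\<^sub>R x)"
      using False by (simp add: mult.assoc[symmetric] abs_mult[symmetric])
    with le[OF x False] show ?thesis by simp
  qed
  have cont: "continuous_map E euclideanreal p"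
  proof (rule continuous_map_real_criterion)
    fix x and e :: real assume x: "x \<in> topspace E" and e: "e > 0"
    let ?O = "{y \<in> topspace E. (2 / e) *\<^sub>R (y - x) \<in> W}"
    have "continuous_map E E (\<lambda>y. (2 / e) *\<^sub>R (y - x))"
      by (intro continuous_map_scaleR[OF E] continuous_map_minus_vector[OF E])
        (use x in \<open>simp_all add: continuous_map_id[unfolded id_def] continuous_map_const\<close>)
    from openin_continuous_map_preimage[OF this Wo] have "openin E ?O" .
    moreover have "x \<in> ?O" using x W0 by simp
    moreover have "\<bar>p y - p x\<bar> < e" if y: "y \<in> ?O" for y
    proof -
      have yx: "y - x \<in> topspace E" "x - y \<in> topspace E" using y x T by auto
      have "e / 2 \<in> S (y - x)" using y e by (simp add: S_def)
      from p_le[OF this] have 1: "p (y - x) \<le> e / 2" .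
      have 2: "p (x - y) = p (y - x)" using scale[OF yx(1), of "-1"] by simp
      have "p y \<le> p (y - x) + p x" "p x \<le> p (x - y) + p y"
        using add[OF yx(1) x] add[OF yx(2), of y] y by auto
      with 1 2 e show ?thesis by linarith
    qed
    ultimately show "\<exists>U. openin E U \<and> x \<in> U \<and> (\<forall>y\<in>U. \<bar>p y - p x\<bar> < e)" by blast
  qed
  have "continuous_seminorm E p"
    using add scale cont by (simp add: continuous_seminorm_def)
  moreover have "x \<in> U" if "x \<in> topspace E" "p x < 1" for x
  proof -
    have "1 \<in> S x" using p_less that by blast
    then show ?thesis using V by (auto simp: S_def W_def)
  qed
  ultimately show thesis using that by blast
qed

lemma seminorm_inside_neighbourhood:
  assumes lc: "locally_convex_space E" and U: "openin E U" "y \<in> U"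
  obtains p where "continuous_seminorm E p" "\<And>x. x \<in> topspace E \<Longrightarrow> p (x - y) < 1 \<Longrightarrow> x \<in> U"
proof -
  have E: "vector_topology E" using lc by (rule locally_convex_imp_vector_topology)
  have y: "y \<in> topspace E" using openin_subset[OF U(1)] U(2) by blast
  have "continuous_map E E (\<lambda>w. y + w)"
    by (intro continuous_map_plus[OF E]) (use y in \<open>simp_all add: continuous_map_id[unfolded id_def] continuous_map_const\<close>)
  from openin_continuous_map_preimage[OF this U(1)] have o: "openin E {w \<in> topspace E. y + w \<in> U}" .
  have "0 \<in> {w \<in> topspace E. y + w \<in> U}" using U vector_topologyD(1)[OF E] by simp
  from seminorm_inside_neighbourhood_of_0[OF lc o this]
  obtain p where p: "continuous_seminorm E p" "\<And>x. x \<in> topspace E \<Longrightarrow> p x < 1 \<Longrightarrow> x \<in> {w \<in> topspace E. y + w \<in> U}"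
    by blast
  have "x \<in> U" if "x \<in> topspace E" "p (x - y) < 1" for x
    using p(2)[OF vector_topologyD(3)[OF E that(1) y] that(2)] by simp
  with p(1) that show thesis by blast
qed

lemma limitin_seminorm:
  assumes lc: "locally_convex_space E" and l: "l \<in> topspace E"
    and ev: "eventually (\<lambda>x. f x \<in> topspace E) A"
    and lim: "\<And>p. continuous_seminorm E p \<Longrightarrow> ((\<lambda>x. p (f x - l)) \<longlongrightarrow> 0) A"
  shows "limitin E f l A"
  unfolding limitin_def
proof (intro conjI allI impI l)
  fix U assume U: "openin E U \<and> l \<in> U"
  then obtain p where p: "continuous_seminorm E p" "\<And>x. x \<in> topspace E \<Longrightarrow> p (x - l) < 1 \<Longrightarrow> x \<in> U"
    using seminorm_inside_neighbourhood[OF lc] by blast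
  have "eventually (\<lambda>x. p (f x - l) < 1) A"
    using order_tendstoD(2)[OF lim[OF p(1)]] by simp
  with ev show "eventually (\<lambda>x. f x \<in> U) A"
    by eventually_elim (rule p(2))
qed

section \<open>Boundedness and completeness\<close>

text \<open>
  A uniform boundedness principle for the points of \<open>B\<close>, seen as operators on the Banach space of
  functionals dominated by a multiple of \<open>q\<close>. Let \<open>N x\<close> be the norm of the operator given by \<open>x\<close>. If
  \<open>N\<close> were unbounded on \<open>B\<close>, pick points \<open>X n\<close> with \<open>N (X n) > 4\<^sup>n\<close> and almost norming functionals \<open>H n\<close> in
  the unit ball. Adding to a partial sum the term \<open>3\<^sup>-\<^sup>n H n\<close> with one of the two signs makes the absolute value
  at \<open>X n\<close> at least \<open>2/3 \<cdot> 3\<^sup>-\<^sup>n N (X n)\<close>, and all later terms together change it by at most \<open>1/2 \<cdot> 3\<^sup>-\<^sup>n N (X n)\<close>.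
  The sum of the series is then a continuous functional that is unbounded on \<open>B\<close>. As
  \<open>N\<close> is a supremum over the functionals below \<open>q\<close>, almost norming functionals exist by definition.
\<close>

lemma linear_functionals_pointwise_bounded_imp_uniformly_bounded:
  fixes F :: "'f::real_vector topology"
  assumes F: "vector_topology F" and q: "continuous_seminorm F q" and B: "B \<subseteq> topspace F"
    and wb: "\<And>l. linear_functional F l \<Longrightarrow> continuous_map F euclideanreal l \<Longrightarrow> \<exists>K. \<forall>x\<in>B. \<bar>l x\<bar> \<le> K"
  shows "\<exists>K. \<forall>x\<in>B. \<forall>h. linear_functional F h \<longrightarrow> (\<forall>z\<in>topspace F. \<bar>h z\<bar> \<le> q z) \<longrightarrow> \<bar>h x\<bar> \<le> K"
    (is ?thesis)
proof (rule ccontr)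
  assume contra: "\<not> ?thesis"
  define D where "D = {h. linear_functional F h \<and> (\<forall>x\<in>topspace F. \<bar>h x\<bar> \<le> q x)}"
  define N where "N x = Sup ((\<lambda>h. \<bar>h x\<bar>) ` D)" for x
  have D0: "(\<lambda>_. 0) \<in> D" using seminorm_nonneg[OF F q] by (simp add: D_def linear_functional_def)
  have bdd: "bdd_above ((\<lambda>h. \<bar>h x\<bar>) ` D)" if "x \<in> topspace F" for x
    using that by (intro bdd_aboveI[of _ "q x"]) (auto simp: D_def)
  have le_N: "\<bar>h x\<bar> \<le> N x" if "x \<in> topspace F" "h \<in> D" for x h
    unfolding N_def using that bdd by (intro cSup_upper) auto
  have "\<exists>x h. x \<in> B \<and> h \<in> D \<and> \<bar>h x\<bar> > K" for K
    using contra unfolding D_def by (simp add: not_le Bex_def)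
  then have "\<exists>x h. x \<in> B \<and> h \<in> D \<and> N x > 4 ^ n \<and> \<bar>h x\<bar> \<ge> 2/3 * N x" for n :: nat
  proof -
    obtain x h where xh: "x \<in> B" "h \<in> D" "\<bar>h x\<bar> > 4 ^ n"
      using \<open>\<And>K. \<exists>x h. x \<in> B \<and> h \<in> D \<and> \<bar>h x\<bar> > K\<close> by blast
    then have N: "N x > 4 ^ n" using le_N[of x h] B by auto
    moreover have "0 < N x" using N by (meson less_trans zero_less_power zero_less_numeral)
    ultimately have "2/3 * N x < N x" by simp
    then obtain h' where "h' \<in> D" "\<bar>h' x\<bar> > 2/3 * N x"
      unfolding N_def using less_cSupE[of "2/3 * N x" "(\<lambda>h. \<bar>h x\<bar>) ` D"] D0 by (auto simp: N_def)
    then show ?thesis using xh N by (intro exI[of _ x] exI[of _ h']) auto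
  qed
  then obtain X H where XH: "\<And>n. X n \<in> B" "\<And>n. H n \<in> D" "\<And>n. N (X n) > 4 ^ n" "\<And>n. \<bar>H n (X n)\<bar> \<ge> 2/3 * N (X n)"
    by metis
  have XT: "X n \<in> topspace F" for n using XH(1) B by blast
  define r where "r n = (1/3 :: real) ^ n" for n
  have r: "r n > 0" for n by (simp add: r_def)
  \<comment> \<open>The partial sums; of the two possible signs the one with the larger value at \<open>X n\<close> is taken, for
    which \<open>\<bar>y + h\<bar> \<ge> \<bar>h\<bar>\<close> or \<open>\<bar>y - h\<bar> \<ge> \<bar>h\<bar>\<close>.\<close>
  define Y where "Y = rec_nat (\<lambda>_. 0) (\<lambda>n y.
      if \<bar>y (X n) + r n * H n (X n)\<bar> \<ge> r n * \<bar>H n (X n)\<bar>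
      then (\<lambda>x. y x + r n * H n x) else (\<lambda>x. y x - r n * H n x))"
  have Y0: "Y 0 = (\<lambda>_. 0)" by (simp add: Y_def)
  have YS: "Y (Suc n) = (if \<bar>Y n (X n) + r n * H n (X n)\<bar> \<ge> r n * \<bar>H n (X n)\<bar>
      then (\<lambda>x. Y n x + r n * H n x) else (\<lambda>x. Y n x - r n * H n x))" for n
    by (simp add: Y_def)
  have Y_large: "\<bar>Y (Suc n) (X n)\<bar> \<ge> r n * \<bar>H n (X n)\<bar>" for n
  proof (cases "\<bar>Y n (X n) + r n * H n (X n)\<bar> \<ge> r n * \<bar>H n (X n)\<bar>")
    case False
    have "r n * \<bar>H n (X n)\<bar> = \<bar>r n * H n (X n)\<bar>" using r[of n] by (simp add: abs_mult)
    with False show ?thesis unfolding YS by auto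
  qed (simp add: YS)
  have "\<exists>s. \<bar>s\<bar> = 1 \<and> (\<forall>x. Y (Suc n) x - Y n x = s * r n * H n x)" for n
    by (cases "\<bar>Y n (X n) + r n * H n (X n)\<bar> \<ge> r n * \<bar>H n (X n)\<bar>")
      (auto simp: YS intro: exI[of _ 1] exI[of _ "-1"])
  then obtain \<sigma> where s1: "\<And>n. \<bar>\<sigma> n\<bar> = (1::real)" and inc: "\<And>n x. Y (Suc n) x - Y n x = \<sigma> n * r n * H n x"
    by metis
  have r_sum: "summable r" "suminf r = 3/2" "(\<Sum>k. r (k + n)) = 3/2 * r n" for n
  proof -
    show 1: "summable r" unfolding r_def by (rule summable_geometric) simp
    show 2: "suminf r = 3/2" unfolding r_def by (subst suminf_geometric) simp_all
    have "(\<lambda>k. r (k + n)) = (\<lambda>k. r k * r n)" by (simp add: r_def power_add)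
    then show "(\<Sum>k. r (k + n)) = 3/2 * r n" using suminf_mult2[OF 1, of "r n"] 2 by simp
  qed
  define g where "g n x = \<sigma> n * r n * H n x" for n x
  have g_le: "\<bar>g n x\<bar> \<le> r n * N x" if "x \<in> topspace F" for n x
    using le_N[OF that XH(2)[of n]] r[of n] s1[of n] by (simp add: g_def abs_mult)
  have N_le: "N x \<le> q x" if "x \<in> topspace F" for x
    unfolding N_def using that D0 by (intro cSup_least) (auto simp: D_def)
  have abs_sum: "summable (\<lambda>n. \<bar>g n x\<bar>)" if "x \<in> topspace F" for x
    by (rule summable_comparison_test'[OF summable_mult2[OF r_sum(1), of "N x"], of 0])
      (use g_le[OF that] in simp)
  have sum_g: "summable (\<lambda>n. g n x)" if "x \<in> topspace F" for x
    using summable_rabs_cancel[OF abs_sum[OF that]] .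
  define l where "l x = (\<Sum>n. g n x)" for x
  have lin_g: "linear_functional F (g n)" for n
    using XH(2)[of n] by (auto simp: D_def g_def linear_functional_def algebra_simps)
  have lin: "linear_functional F l"
    unfolding linear_functional_def
  proof (intro conjI ballI allI)
    fix x y assume xy: "x \<in> topspace F" "y \<in> topspace F"
    have "(\<lambda>n. g n (x + y)) = (\<lambda>n. g n x + g n y)" using lin_g xy by (auto simp: linear_functional_def)
    then show "l (x + y) = l x + l y" unfolding l_def using suminf_add[OF sum_g sum_g] xy by simp
  next
    fix c x assume x: "x \<in> topspace F"
    have "(\<lambda>n. g n (c *\<^sub>R x)) = (\<lambda>n. c * g n x)" using lin_g x by (auto simp: linear_functional_def)
    then show "l (c *\<^sub>R x) = c * l x" unfolding l_def using suminf_mult[OF sum_g[OF x]] by simp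
  qed
  have "\<bar>l x\<bar> \<le> 3/2 * q x" if x: "x \<in> topspace F" for x
  proof -
    have "\<bar>l x\<bar> \<le> (\<Sum>n. \<bar>g n x\<bar>)" unfolding l_def using summable_rabs[OF abs_sum[OF x]] .
    also have "\<dots> \<le> (\<Sum>n. r n * N x)"
      by (rule suminf_le[OF g_le[OF x] abs_sum[OF x] summable_mult2[OF r_sum(1)]])
    also have "\<dots> = 3/2 * N x" using suminf_mult2[OF r_sum(1), of "N x"] r_sum(2) by simp
    also have "\<dots> \<le> 3/2 * q x" using N_le[OF x] by simp
    finally show ?thesis .
  qed
  from dominated_linear_functional_continuous[OF F q lin this] have "continuous_map F euclideanreal l" .
  from wb[OF lin this] obtain K where K: "\<And>x. x \<in> B \<Longrightarrow> \<bar>l x\<bar> \<le> K" by blast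
  have Y_sum: "Y n x = (\<Sum>k<n. g k x)" for n x
    by (induction n) (use Y0 inc in \<open>auto simp: g_def algebra_simps\<close>)
  have big: "\<bar>l (X n)\<bar> \<ge> (4/3) ^ n / 6" for n
  proof -
    let ?x = "X n"
    have "l ?x = (\<Sum>k. g (k + Suc n) ?x) + (\<Sum>k<Suc n. g k ?x)"
      unfolding l_def by (rule suminf_split_initial_segment[OF sum_g[OF XT]])
    then have eq: "l ?x = (\<Sum>k. g (k + Suc n) ?x) + Y (Suc n) ?x" by (simp only: Y_sum)
    have "\<bar>\<Sum>k. g (k + Suc n) ?x\<bar> \<le> (\<Sum>k. \<bar>g (k + Suc n) ?x\<bar>)"
      by (rule summable_rabs[OF summable_ignore_initial_segment[OF abs_sum[OF XT]]])
    also have "\<dots> \<le> (\<Sum>k. r (k + Suc n) * N ?x)"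
      by (rule suminf_le[OF g_le[OF XT] summable_ignore_initial_segment[OF abs_sum[OF XT]]
          summable_mult2[OF summable_ignore_initial_segment[OF r_sum(1)]]])
    also have "\<dots> = 3/2 * r (Suc n) * N ?x"
      by (simp only: suminf_mult2[OF summable_ignore_initial_segment[OF r_sum(1)], symmetric] r_sum(3))
    also have "\<dots> = 1/2 * (r n * N ?x)" by (simp add: r_def)
    finally have tail: "\<bar>\<Sum>k. g (k + Suc n) ?x\<bar> \<le> 1/2 * (r n * N ?x)" .
    have "2/3 * (r n * N ?x) \<le> r n * \<bar>H n ?x\<bar>"
      using mult_left_mono[OF XH(4)[of n], of "r n"] r[of n] by (simp add: mult.left_commute)
    with Y_large[of n] tail eq have 1: "\<bar>l ?x\<bar> \<ge> r n * N ?x / 6" by linarith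
    have "(4/3) ^ n = r n * 4 ^ n" by (simp add: r_def power_divide)
    also have "\<dots> \<le> r n * N ?x" using XH(3)[of n] r[of n] by (intro mult_left_mono) auto
    finally show ?thesis using 1 by simp
  qed
  obtain n where "6 * K < (4/3 :: real) ^ n" using real_arch_pow[of "4/3" "6 * K"] by auto
  with big[of n] K[OF XH(1)[of n]] show False by linarith
qed

text \<open>
  The nuclear expansion of \<open>x\<close> converges to \<open>x\<close> in the seminorm \<open>p\<close>, and the triangle inequality passes to
  the limit. The estimate is stated at a single \<open>x\<close> with a bound \<open>a n * c\<close> on the coefficients, since it is used
  with \<open>c = q x\<close> as well as with a bound \<open>c\<close> that is uniform on a weakly bounded set.
\<close>

lemma nuclear_seminorm_le_suminf:
  fixes f :: "nat \<Rightarrow> 'e::real_vector \<Rightarrow> real"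
  assumes E: "vector_topology E" and p: "continuous_seminorm E p"
    and y: "\<And>n. y n \<in> topspace E" and sm: "summable (\<lambda>n. a n * p (y n))"
    and f: "\<And>n. \<bar>f n x\<bar> \<le> a n * c" and x: "x \<in> topspace E"
    and lim: "(\<lambda>N. p (x - (\<Sum>n<N. f n x *\<^sub>R y n))) \<longlonglongrightarrow> 0"
  shows "summable (\<lambda>n. \<bar>f n x\<bar> * p (y n))" and "p x \<le> (\<Sum>n. \<bar>f n x\<bar> * p (y n))"
proof -
  note T = vector_topologyD[OF E]
  have py: "0 \<le> p (y n)" for n using seminorm_nonneg[OF E p y] .
  have "\<bar>f n x\<bar> * p (y n) \<le> a n * p (y n) * c" for n
    using mult_right_mono[OF f py, of n n] by (simp add: mult_ac)
  then show sum: "summable (\<lambda>n. \<bar>f n x\<bar> * p (y n))"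
    by (intro summable_comparison_test'[OF summable_mult2[OF sm, of c], of 0]) (use py in \<open>simp add: abs_mult\<close>)
  have sT: "(\<Sum>n<N. f n x *\<^sub>R y n) \<in> topspace E" for N
    by (induction N) (use T y in auto)
  have sp: "p (\<Sum>n<N. f n x *\<^sub>R y n) \<le> (\<Sum>n<N. \<bar>f n x\<bar> * p (y n))" for N
  proof (induction N)
    case (Suc N)
    have "p ((\<Sum>n<N. f n x *\<^sub>R y n) + f N x *\<^sub>R y N) \<le> p (\<Sum>n<N. f n x *\<^sub>R y n) + p (f N x *\<^sub>R y N)"
      using continuous_seminormD(1)[OF p sT T(4)[OF y]] .
    then show ?case using Suc continuous_seminormD(2)[OF p y] by simp
  qed (simp add: seminorm_0[OF E p])
  have "p x \<le> p (x - (\<Sum>n<N. f n x *\<^sub>R y n)) + (\<Sum>n. \<bar>f n x\<bar> * p (y n))" for N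
  proof -
    have "p x \<le> p (x - (\<Sum>n<N. f n x *\<^sub>R y n)) + p (\<Sum>n<N. f n x *\<^sub>R y n)"
      using continuous_seminormD(1)[OF p T(3)[OF x sT] sT, of N N] by simp
    also have "p (\<Sum>n<N. f n x *\<^sub>R y n) \<le> (\<Sum>n. \<bar>f n x\<bar> * p (y n))"
      using sp[of N] sum_le_suminf[OF sum, of "{..<N}"] py by fastforce
    finally show ?thesis by simp
  qed
  moreover have "(\<lambda>N. p (x - (\<Sum>n<N. f n x *\<^sub>R y n)) + (\<Sum>n. \<bar>f n x\<bar> * p (y n))) \<longlonglongrightarrow>
      0 + (\<Sum>n. \<bar>f n x\<bar> * p (y n))"
    by (intro tendsto_add lim tendsto_const)
  ultimately show "p x \<le> (\<Sum>n. \<bar>f n x\<bar> * p (y n))"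
    using LIMSEQ_le_const[of _ "0 + (\<Sum>n. \<bar>f n x\<bar> * p (y n))" "p x"] by auto
qed

text \<open>
  In a nuclear space the seminorm \<open>p\<close> is dominated by a weighted sum of the functionals
  \<open>f n / a n\<close>, which all lie in the polar of the unit ball of \<open>q\<close>. The uniform boundedness principle bounds
  them simultaneously on \<open>B\<close>, and the weights are summable.
\<close>

lemma nuclear_weakly_bounded_imp_bounded:
  assumes nuc: "nuclear_space F" and B: "B \<subseteq> topspace F"
    and wb: "\<And>l. linear_functional F l \<Longrightarrow> continuous_map F euclideanreal l \<Longrightarrow> \<exists>K. \<forall>x\<in>B. \<bar>l x\<bar> \<le> K"
    and p: "continuous_seminorm F p"
  obtains C where "C \<ge> 0" "\<And>x. x \<in> B \<Longrightarrow> p x \<le> C"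
proof -
  have F: "vector_topology F"
    using nuc by (simp add: nuclear_space_def locally_convex_imp_vector_topology)
  obtain q where q: "continuous_seminorm F q" and "nuclear_canonical_map F q p"
    using nuc p by (auto simp: nuclear_space_def)
  then obtain f a y where H: "\<forall>n. linear_functional F (f n) \<and> 0 \<le> a n \<and> (\<forall>x\<in>topspace F. \<bar>f n x\<bar> \<le> a n * q x)"
    "\<forall>n. y n \<in> topspace F" "summable (\<lambda>n. a n * p (y n))"
    "\<forall>x\<in>topspace F. (\<lambda>N. p (x - (\<Sum>n<N. f n x *\<^sub>R y n))) \<longlonglongrightarrow> 0"
    unfolding nuclear_canonical_map_def by (elim exE conjE)
  have lf: "\<And>n. linear_functional F (f n)" and a: "\<And>n. 0 \<le> a n"
    and fa: "\<And>n x. x \<in> topspace F \<Longrightarrow> \<bar>f n x\<bar> \<le> a n * q x"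
    and y: "\<And>n. y n \<in> topspace F" and sm: "summable (\<lambda>n. a n * p (y n))"
    and lim: "\<And>x. x \<in> topspace F \<Longrightarrow> (\<lambda>N. p (x - (\<Sum>n<N. f n x *\<^sub>R y n))) \<longlonglongrightarrow> 0"
    using H by simp_all
  obtain K where K': "\<forall>x\<in>B. \<forall>h. linear_functional F h \<longrightarrow> (\<forall>z\<in>topspace F. \<bar>h z\<bar> \<le> q z) \<longrightarrow> \<bar>h x\<bar> \<le> K"
    using linear_functionals_pointwise_bounded_imp_uniformly_bounded[OF F q B wb] by (rule exE)
  have K: "\<And>x h. x \<in> B \<Longrightarrow> linear_functional F h \<Longrightarrow> (\<And>x. x \<in> topspace F \<Longrightarrow> \<bar>h x\<bar> \<le> q x) \<Longrightarrow> \<bar>h x\<bar> \<le> K"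
    using K' by blast
  have py: "0 \<le> p (y n)" for n using seminorm_nonneg[OF F p y] .
  have fK: "\<bar>f n x\<bar> \<le> a n * K" if "x \<in> B" for n x
  proof (cases "a n = 0")
    case True
    then show ?thesis using fa[of x n] that B by auto
  next
    case False
    then have an: "a n > 0" using a[of n] by simp
    have "\<bar>f n x / a n\<bar> \<le> K"
    proof (rule K[OF that])
      show "linear_functional F (\<lambda>x. f n x / a n)"
        using lf[of n] by (simp add: linear_functional_def add_divide_distrib)
      show "\<bar>f n z / a n\<bar> \<le> q z" if "z \<in> topspace F" for z
        using fa[OF that, of n] an by (simp add: abs_divide divide_le_eq mult.commute)
    qed
    then show ?thesis using an by (simp add: abs_divide divide_le_eq mult.commute)
  qed
  have "p x \<le> \<bar>(\<Sum>n. a n * p (y n)) * K\<bar>" if x: "x \<in> B" for x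
  proof -
    have xT: "x \<in> topspace F" using x B by blast
    note S = nuclear_seminorm_le_suminf[where f = f and a = a and c = K, OF F p y sm fK[OF x] xT lim[OF xT]]
    have "p x \<le> (\<Sum>n. \<bar>f n x\<bar> * p (y n))" by (rule S(2))
    also have "\<dots> \<le> (\<Sum>n. a n * p (y n) * K)"
    proof (rule suminf_le[OF _ S(1) summable_mult2[OF sm]])
      show "\<bar>f n x\<bar> * p (y n) \<le> a n * p (y n) * K" for n
        using mult_right_mono[OF fK[OF x] py, of n n] by (simp add: mult_ac)
    qed
    also have "\<dots> = (\<Sum>n. a n * p (y n)) * K" using suminf_mult2[OF sm, of K] by simp
    finally show ?thesis by linarith
  qed
  then show thesis by (intro that[of "\<bar>(\<Sum>n. a n * p (y n)) * K\<bar>"]) auto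
qed

text \<open>
  The estimate is the Cauchy condition at \<open>0\<close> in every seminorm. Translation invariance of the metric
  turns it into the metric Cauchy condition for \<open>D\<close> along a null sequence, and the same estimate carries
  the limit over to all \<open>t \<rightarrow> 0\<close>.
\<close>

lemma frechet_Cauchy_at_0_convergent:
  fixes D :: "real \<Rightarrow> 'f::real_vector"
  assumes fr: "frechet_space F" and \<epsilon>: "\<epsilon> > 0"
    and D: "\<And>t. t \<noteq> 0 \<Longrightarrow> \<bar>t\<bar> < \<epsilon> \<Longrightarrow> D t \<in> topspace F"
    and C: "\<And>p. continuous_seminorm F p \<Longrightarrow> \<exists>C. \<forall>s t. s \<noteq> 0 \<longrightarrow> t \<noteq> 0 \<longrightarrow> \<bar>s\<bar> < \<epsilon> \<longrightarrow> \<bar>t\<bar> < \<epsilon> \<longrightarrow>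
        p (D t - D s) \<le> C * (\<bar>t\<bar> + \<bar>s\<bar>)"
  obtains l where "limitin F D l (at 0)"
proof -
  have lc: "locally_convex_space F" using fr by (simp add: frechet_space_def)
  have F: "vector_topology F" using lc by (rule locally_convex_imp_vector_topology)
  note T = vector_topologyD[OF F]
  obtain d where d: "Metric_space (topspace F) d" "Metric_space.mtopology (topspace F) d = F"
    "Metric_space.mcomplete (topspace F) d"
    "\<And>x y z. x \<in> topspace F \<Longrightarrow> y \<in> topspace F \<Longrightarrow> z \<in> topspace F \<Longrightarrow> d (x + z) (y + z) = d x y"
    using fr by (auto simp: frechet_space_def)
  interpret M: Metric_space "topspace F" d by (rule d(1))
  define \<tau> where "\<tau> n = \<epsilon> / real (n + 2)" for n
  have \<tau>: "\<tau> n > 0" "\<tau> n < \<epsilon>" for n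
  proof -
    show "\<tau> n > 0" using \<epsilon> by (simp add: \<tau>_def)
    have "\<epsilon> / real (n + 2) < \<epsilon> / 1" using \<epsilon> by (intro divide_strict_left_mono) auto
    then show "\<tau> n < \<epsilon>" by (simp add: \<tau>_def)
  qed
  have \<tau>0: "\<tau> \<longlonglongrightarrow> 0" unfolding \<tau>_def
    using LIMSEQ_ignore_initial_segment[OF lim_const_over_n[of \<epsilon>], of 2] by simp
  define \<sigma> where "\<sigma> n = D (\<tau> n)" for n
  have \<sigma>T: "\<sigma> n \<in> topspace F" for n
    unfolding \<sigma>_def using \<tau>[of n] by (intro D) auto
  have "M.MCauchy \<sigma>"
    unfolding M.MCauchy_def
  proof (intro conjI allI impI)
    show "range \<sigma> \<subseteq> topspace F" using \<sigma>T by blast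
    fix e :: real assume e: "e > 0"
    have "openin F (M.mball 0 e)" using M.openin_mball[of 0 e] d(2) by simp
    moreover have "0 \<in> M.mball 0 e" using e T(1) by simp
    ultimately obtain p where p: "continuous_seminorm F p" "\<And>x. x \<in> topspace F \<Longrightarrow> p x < 1 \<Longrightarrow> x \<in> M.mball 0 e"
      using seminorm_inside_neighbourhood_of_0[OF lc] by blast
    obtain C where C: "\<And>s t. s \<noteq> 0 \<Longrightarrow> t \<noteq> 0 \<Longrightarrow> \<bar>s\<bar> < \<epsilon> \<Longrightarrow> \<bar>t\<bar> < \<epsilon> \<Longrightarrow> p (D t - D s) \<le> C * (\<bar>t\<bar> + \<bar>s\<bar>)"
      using C[OF p(1)] by blast
    have "(\<lambda>n. \<bar>C\<bar> * \<tau> n) \<longlonglongrightarrow> \<bar>C\<bar> * 0" by (intro tendsto_intros \<tau>0)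
    then have "eventually (\<lambda>n. \<bar>C\<bar> * \<tau> n < 1/2) sequentially"
      by (intro order_tendstoD(2)) auto
    then obtain n0 where n0: "\<And>n. n \<ge> n0 \<Longrightarrow> \<bar>C\<bar> * \<tau> n < 1/2" by (auto simp: eventually_sequentially)
    show "\<exists>N. \<forall>n n'. N \<le> n \<longrightarrow> N \<le> n' \<longrightarrow> d (\<sigma> n) (\<sigma> n') < e"
    proof (intro exI[of _ n0] allI impI)
      fix n n' assume n: "n0 \<le> n" "n0 \<le> n'"
      have "p (\<sigma> n' - \<sigma> n) \<le> C * (\<bar>\<tau> n'\<bar> + \<bar>\<tau> n\<bar>)"
        unfolding \<sigma>_def using \<tau>[of n] \<tau>[of n'] by (intro C) auto
      also have "\<dots> \<le> \<bar>C\<bar> * (\<bar>\<tau> n'\<bar> + \<bar>\<tau> n\<bar>)" by (intro mult_right_mono) auto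
      also have "\<dots> < 1" using n0[OF n(1)] n0[OF n(2)] \<tau>[of n] \<tau>[of n'] by (simp add: distrib_left)
      finally have "\<sigma> n' - \<sigma> n \<in> M.mball 0 e" using p(2)[OF T(3)[OF \<sigma>T \<sigma>T]] by blast
      then have "d 0 (\<sigma> n' - \<sigma> n) < e" by simp
      moreover have "d (0 + \<sigma> n) (\<sigma> n' - \<sigma> n + \<sigma> n) = d 0 (\<sigma> n' - \<sigma> n)"
        by (intro d(4) T \<sigma>T)
      ultimately show "d (\<sigma> n) (\<sigma> n') < e" by simp
    qed
  qed
  then obtain l where "limitin M.mtopology \<sigma> l sequentially"
    using d(3) M.mcomplete_def by blast
  then have l: "limitin F \<sigma> l sequentially" using d(2) by simp
  have lT: "l \<in> topspace F" using l by (rule limitin_topspace)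
  have "limitin F D l (at 0)"
  proof (rule limitin_seminorm[OF lc lT])
    have ev: "eventually (\<lambda>t. t \<noteq> 0 \<and> \<bar>t\<bar> < \<epsilon>) (at (0::real))"
      using \<epsilon> by (auto simp: eventually_at intro!: exI[of _ \<epsilon>])
    then show "\<forall>\<^sub>F t in at 0. D t \<in> topspace F" by eventually_elim (auto intro: D)
    fix p assume p: "continuous_seminorm F p"
    obtain C where C: "\<And>s t. s \<noteq> 0 \<Longrightarrow> t \<noteq> 0 \<Longrightarrow> \<bar>s\<bar> < \<epsilon> \<Longrightarrow> \<bar>t\<bar> < \<epsilon> \<Longrightarrow> p (D t - D s) \<le> C * (\<bar>t\<bar> + \<bar>s\<bar>)"
      using C[OF p] by blast
    have cm: "continuous_map F F (\<lambda>x. x - l)"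
      by (intro continuous_map_minus_vector[OF F]) (use lT in \<open>simp_all add: continuous_map_id[unfolded id_def] continuous_map_const\<close>)
    have "limitin euclideanreal ((p \<circ> (\<lambda>x. x - l)) \<circ> \<sigma>) ((p \<circ> (\<lambda>x. x - l)) l) sequentially"
      by (rule continuous_map_limit[OF continuous_map_compose[OF cm continuous_seminormD(3)[OF p]] l])
    then have p\<sigma>: "(\<lambda>n. p (\<sigma> n - l)) \<longlonglongrightarrow> 0" by (simp add: o_def seminorm_0[OF F p])
    have bound: "p (D t - l) \<le> C * \<bar>t\<bar>" if t: "t \<noteq> 0" "\<bar>t\<bar> < \<epsilon>" for t
    proof -
      have "p (D t - l) \<le> C * (\<bar>t\<bar> + \<tau> n) + p (\<sigma> n - l)" for n
      proof -
        have "p (D t - l) \<le> p (D t - \<sigma> n) + p (\<sigma> n - l)"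
          by (rule seminorm_triangle[OF F p D[OF t] \<sigma>T lT])
        also have "p (D t - \<sigma> n) \<le> C * (\<bar>t\<bar> + \<bar>\<tau> n\<bar>)"
          unfolding \<sigma>_def using \<tau>[of n] t by (intro C) auto
        finally show ?thesis using \<tau>[of n] by simp
      qed
      moreover have "(\<lambda>n. C * (\<bar>t\<bar> + \<tau> n) + p (\<sigma> n - l)) \<longlonglongrightarrow> C * (\<bar>t\<bar> + 0) + 0"
        by (intro tendsto_intros \<tau>0 p\<sigma>)
      ultimately show ?thesis
        using LIMSEQ_le_const[of _ "C * (\<bar>t\<bar> + 0) + 0" "p (D t - l)"] by auto
    qed
    show "((\<lambda>t. p (D t - l)) \<longlongrightarrow> 0) (at 0)"
    proof (rule tendsto_sandwich[of "\<lambda>_. 0" _ _ "\<lambda>t. C * \<bar>t\<bar>"])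
      show "\<forall>\<^sub>F t in at 0. 0 \<le> p (D t - l)"
        using ev by eventually_elim (intro seminorm_nonneg[OF F p] T(3) D lT, auto)
      show "\<forall>\<^sub>F t in at 0. p (D t - l) \<le> C * \<bar>t\<bar>" using ev by eventually_elim (auto intro: bound)
      have "((\<lambda>t. C * \<bar>t\<bar>) \<longlongrightarrow> C * \<bar>0\<bar>) (at (0::real))" by (intro tendsto_intros)
      then show "((\<lambda>t. C * \<bar>t\<bar>) \<longlongrightarrow> 0) (at (0::real))" by simp
    qed simp
  qed
  then show thesis by (rule that)
qed

section \<open>Weakly smooth maps are smooth\<close>

lemma continuous_map_singleton_tuple:
  "continuous_map euclideanreal (power_space euclideanreal 1) (\<lambda>t i. if i = (0::nat) then t else 0)"
  unfolding continuous_map_power_space by (auto simp: continuous_map_id[unfolded id_def])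

text \<open>
  Smooth curves are defined as smooth maps on \<open>\<real>\<^sup>1\<close>; this extracts the ordinary velocity \<open>c'\<close>, which the
  chain rule for curves asks for.
\<close>

lemma smooth_curve_C1:
  assumes X: "vector_topology X" and c: "smooth_curve X c"
  obtains c' where "continuous_map euclideanreal X c" "continuous_map euclideanreal X c'"
    "\<And>t. limitin X (\<lambda>s. (c (t + s) - c t) /\<^sub>R s) (c' t) (at 0)"
proof -
  let ?R = "power_space euclideanreal 1"
  let ?U = "{x \<in> topspace ?R. x 0 \<in> UNIV}"
  let ?one = "\<lambda>t i. if i = (0::nat) then t else (0::real)"
  have HX: "Hausdorff_space X" using X by (simp add: vector_topology_def)
  have U: "openin ?R ?U" "?U = topspace ?R" by auto
  have Ck: "Ck_on (Suc 0) 1 euclideanreal X ?U (\<lambda>x. c (x 0))"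
    using c unfolding smooth_on_def by blast
  have one: "?one t \<in> topspace ?R" for t by (simp add: topspace_power_space)
  have "continuous_map euclideanreal (subtopology ?R ?U) ?one"
    using continuous_map_singleton_tuple one by (simp add: continuous_map_in_subtopology image_subset_iff)
  from continuous_map_compose[OF this Ck_on_imp_continuous[OF Ck]]
  have 1: "continuous_map euclideanreal X c" by (simp add: o_def)
  define d where "d = differential 1 X (\<lambda>x. c (x 0))"
  define c' where "c' t = d (join 1 (?one t) (?one 1))" for t
  have in_T: "join 1 (?one t) (?one 1) \<in> tangent_domain 1 euclideanreal ?U" for t
    using one by (intro join_in_tangent_domain) auto
  have "continuous_map euclideanreal (power_space euclideanreal (2 * 1)) (\<lambda>t. join 1 (?one t) (?one 1))"
    by (intro continuous_map_join continuous_map_singleton_tuple) (simp only: continuous_map_const one simp_thms)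
  then have "continuous_map euclideanreal (subtopology (power_space euclideanreal (2 * 1)) (tangent_domain 1 euclideanreal ?U))
      (\<lambda>t. join 1 (?one t) (?one 1))"
    using in_T by (simp only: continuous_map_in_subtopology image_subset_iff) blast
  from continuous_map_compose[OF this Ck_on_imp_continuous[OF Ck_on_SucD(2)[OF HX Ck]]]
  have 2: "continuous_map euclideanreal X c'" by (simp only: o_def c'_def[abs_def] d_def)
  have 3: "limitin X (\<lambda>s. (c (t + s) - c t) /\<^sub>R s) (c' t) (at 0)" for t
  proof -
    have "has_directional_derivative X (\<lambda>x. c (x 0)) (?one t) (?one 1) (c' t)"
      using Ck_on_SucD(1)[OF HX Ck in_T[of t]] unfolding base_point_join[OF one] direction_join[OF one]
      by (simp only: c'_def d_def)
    then show ?thesis by (simp add: has_directional_derivative_def scaleR_fun_def)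
  qed
  from 1 2 3 show thesis by (rule that)
qed

lemma continuous_bounded_on_symmetric_interval:
  fixes f :: "real \<Rightarrow> real"
  assumes "continuous_on {-e..e} f"
  shows "\<exists>K\<ge>0. \<forall>s. \<bar>s\<bar> \<le> e \<longrightarrow> \<bar>f s\<bar> \<le> K"
proof -
  have "compact (f ` {-e..e})" using assms by (intro compact_continuous_image) auto
  then have "bounded (f ` {-e..e})" by (rule compact_imp_bounded)
  then obtain K where "\<forall>y \<in> f ` {-e..e}. norm y \<le> K" unfolding bounded_iff by blast
  then have "\<bar>f s\<bar> \<le> max K 0" if "\<bar>s\<bar> \<le> e" for s
  proof -
    have "f s \<in> f ` {-e..e}" using that by (intro imageI) auto
    with \<open>\<forall>y \<in> f ` {-e..e}. norm y \<le> K\<close> have "norm (f s) \<le> K" by (rule bspec)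
    then show ?thesis by simp
  qed
  then show ?thesis by (intro exI[of _ "max K 0"]) simp
qed

lemma C1_along_curve:
  assumes F: "vector_topology F" and V: "openin (power_space F n) V"
    and f: "Ck_on (Suc k) n F euclideanreal V f"
    and c: "continuous_map euclideanreal (power_space F n) c" "continuous_map euclideanreal (power_space F n) c'"
      "\<And>t. limitin (power_space F n) (\<lambda>s. (c (t + s) - c t) /\<^sub>R s) (c' t) (at 0)"
  defines "u' \<equiv> \<lambda>t. differential n euclideanreal f (join n (c t) (c' t))"
  shows "c t \<in> V \<Longrightarrow> ((\<lambda>t. f (c t)) has_real_derivative u' t) (at t)"
    and "(\<And>t. t \<in> S \<Longrightarrow> c t \<in> V) \<Longrightarrow> continuous_on S u'"
proof -
  assume ct: "c t \<in> V"
  have "((\<lambda>s. f (c (t + s))) has_real_derivative u' t) (at 0)"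
    using C1_chain_rule_curve[OF F V f, of "\<lambda>s. c (t + s)" "c' t"] ct c(3)[of t] by (simp add: u'_def)
  then show "((\<lambda>t. f (c t)) has_real_derivative u' t) (at t)"
    using DERIV_shift[of "\<lambda>t. f (c t)" "u' t" 0 t] by (simp add: add.commute)
next
  assume S: "\<And>t. t \<in> S \<Longrightarrow> c t \<in> V"
  have c'T: "c' t \<in> topspace (power_space F n)" for t
    using c(3)[of t] by (rule limitin_topspace)
  have "continuous_map (subtopology euclideanreal S) (power_space F (2 * n)) (\<lambda>t. join n (c t) (c' t))"
    by (intro continuous_map_join continuous_map_from_subtopology c)
  then have "continuous_map (subtopology euclideanreal S)
      (subtopology (power_space F (2 * n)) (tangent_domain n F V)) (\<lambda>t. join n (c t) (c' t))"
    using join_in_tangent_domain[OF openin_subset[OF V] S c'T]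
    by (simp add: continuous_map_in_subtopology image_subset_iff)
  from continuous_map_compose[OF this Ck_on_imp_continuous[OF Ck_on_SucD(2)[OF Hausdorff_space_euclidean f]]]
  show "continuous_on S u'" by (simp add: o_def u'_def)
qed

text \<open>
  By the assumption on the \<open>c\<^sup>\<infinity>\<close>-topology it suffices to be continuous along smooth curves \<open>c\<close>. By the chain
  rule \<open>l \<circ> g \<circ> c\<close> is continuously differentiable for every continuous functional \<open>l\<close>, so the difference
  quotients of \<open>g \<circ> c\<close> at a parameter \<open>t0\<close> form a weakly bounded set. This set is bounded, which is a
  Lipschitz estimate for \<open>g \<circ> c\<close> at \<open>t0\<close> in every continuous seminorm.
\<close>

lemma weakly_C1_imp_continuous:
  assumes lcE: "locally_convex_space E" and cinf: "c_infinity_topology (power_space E m) = power_space E m"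
    and nuc: "nuclear_space F" and U: "openin (power_space E m) U"
    and gU: "\<And>x. x \<in> U \<Longrightarrow> g x \<in> topspace F"
    and w: "\<And>l. linear_functional F l \<Longrightarrow> continuous_map F euclideanreal l \<Longrightarrow>
      Ck_on (Suc 0) m E euclideanreal U (\<lambda>x. l (g x))"
  shows "continuous_map (subtopology (power_space E m) U) F g"
  unfolding continuous_map_def
proof (intro conjI allI impI)
  let ?X = "power_space E m"
  have E: "vector_topology E" using lcE by (rule locally_convex_imp_vector_topology)
  have X: "vector_topology ?X" by (rule vector_topology_power_space[OF E])
  have lcF: "locally_convex_space F" using nuc by (simp add: nuclear_space_def)
  have F: "vector_topology F" using lcF by (rule locally_convex_imp_vector_topology)
  note T = vector_topologyD[OF F]
  show "g \<in> topspace (subtopology ?X U) \<rightarrow> topspace F" using gU by auto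
  fix V assume V: "openin F V"
  let ?P = "{x \<in> topspace (subtopology ?X U). g x \<in> V}"
  have UX: "U \<subseteq> topspace ?X" by (rule openin_subset[OF U])
  then have P: "?P = {x \<in> U. g x \<in> V}" by auto
  have "open (c -` {x \<in> U. g x \<in> V})" if c: "smooth_curve ?X c" for c
    unfolding open_contains_ball
  proof
    fix t0 assume t0: "t0 \<in> c -` {x \<in> U. g x \<in> V}"
    obtain c' where c': "continuous_map euclideanreal ?X c" "continuous_map euclideanreal ?X c'"
      "\<And>t. limitin ?X (\<lambda>s. (c (t + s) - c t) /\<^sub>R s) (c' t) (at 0)"
      using smooth_curve_C1[OF X c] by metis
    have "open {t. c t \<in> U}" using openin_continuous_map_preimage[OF c'(1) U] by simp
    then obtain e0 where e0: "e0 > 0" "cball t0 e0 \<subseteq> {t. c t \<in> U}"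
      using t0 by (auto simp: open_contains_cball)
    then have in_U: "c t \<in> U" if "\<bar>t - t0\<bar> \<le> e0" for t
      using that by (auto simp: dist_real_def abs_minus_commute subset_iff)
    let ?B = "(\<lambda>t. (g (c t) - g (c t0)) /\<^sub>R (t - t0)) ` {t. t \<noteq> t0 \<and> \<bar>t - t0\<bar> \<le> e0}"
    have gT: "g (c t) \<in> topspace F" if "\<bar>t - t0\<bar> \<le> e0" for t using gU in_U that by blast
    have gT0: "g (c t0) \<in> topspace F" using gT e0 by simp
    have B: "?B \<subseteq> topspace F" using gT gT0 by (auto intro!: T)
    have wb: "\<exists>K. \<forall>x\<in>?B. \<bar>l x\<bar> \<le> K" if l: "linear_functional F l" "continuous_map F euclideanreal l" for l
    proof -
      define u' where "u' t = differential m euclideanreal (\<lambda>x. l (g x)) (join m (c t) (c' t))" for t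
      note der = C1_along_curve[OF E U w[OF l] c', folded u'_def]
      have "continuous_on {t0 - e0..t0 + e0} u'"
        using in_U by (intro der(2)) (auto simp: abs_le_iff)
      then have "continuous_on {-e0..e0} (\<lambda>s. u' (t0 + s))"
        by (rule continuous_on_compose2) (auto intro!: continuous_intros)
      from continuous_bounded_on_symmetric_interval[OF this]
      obtain K where K: "K \<ge> 0" "\<And>s. \<bar>s\<bar> \<le> e0 \<Longrightarrow> \<bar>u' (t0 + s)\<bar> \<le> K"
        by blast
      have "\<bar>l ((g (c t) - g (c t0)) /\<^sub>R (t - t0))\<bar> \<le> K" if t: "t \<noteq> t0" "\<bar>t - t0\<bar> \<le> e0" for t
      proof -
        have dd: "((\<lambda>s. l (g (c (t0 + s)))) has_real_derivative u' (t0 + s)) (at s)" if "\<bar>s\<bar> \<le> \<bar>t - t0\<bar>" for s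
        proof -
          have "((\<lambda>t. l (g (c t))) has_real_derivative u' (t0 + s)) (at (s + t0))"
            using der(1)[of "t0 + s"] in_U[of "t0 + s"] that t by (simp add: add.commute)
          then show ?thesis using DERIV_shift[of "\<lambda>t. l (g (c t))" "u' (t0 + s)" s t0] by (simp add: add.commute)
        qed
        obtain s where s: "\<bar>s\<bar> \<le> \<bar>t - t0\<bar>" "l (g (c (t0 + (t - t0)))) - l (g (c (t0 + 0))) = (t - t0) * u' (t0 + s)"
          using mean_value_symmetric[OF dd] by blast
        have "l ((g (c t) - g (c t0)) /\<^sub>R (t - t0)) = (l (g (c t)) - l (g (c t0))) / (t - t0)"
          by (rule linear_functional_quotient[OF F l(1) gT[OF t(2)] gT0])
        also have "\<dots> = u' (t0 + s)" using s(2) t(1) by simp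
        finally show ?thesis using K(2)[of s] s(1) t(2) by simp
      qed
      then show ?thesis by blast
    qed
    have gV: "g (c t0) \<in> V" using t0 by simp
    obtain p where p: "continuous_seminorm F p" "\<And>x. x \<in> topspace F \<Longrightarrow> p (x - g (c t0)) < 1 \<Longrightarrow> x \<in> V"
      using seminorm_inside_neighbourhood[OF lcF V gV] by blast
    obtain C where C: "C \<ge> 0" "\<And>x. x \<in> ?B \<Longrightarrow> p x \<le> C"
      using nuclear_weakly_bounded_imp_bounded[OF nuc B wb p(1)] by blast
    \<comment> \<open>At distance less than \<open>1 / (C + 1)\<close> the Lipschitz bound \<open>C\<close> keeps the seminorm of the increment below \<open>1\<close>.\<close>
    define d where "d = min e0 (1 / (C + 1))"
    have "d > 0" using e0 C(1) by (simp add: d_def)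
    moreover have "t \<in> c -` {x \<in> U. g x \<in> V}" if "t \<in> ball t0 d" for t
    proof (cases "t = t0")
      case True
      then show ?thesis using t0 by simp
    next
      case False
      from that have td: "\<bar>t - t0\<bar> < d" by (simp add: dist_real_def abs_minus_commute)
      then have te: "\<bar>t - t0\<bar> \<le> e0" by (simp add: d_def)
      have dT: "g (c t) - g (c t0) \<in> topspace F" using T(3)[OF gT[OF te] gT0] .
      have "p ((g (c t) - g (c t0)) /\<^sub>R (t - t0)) \<le> C" using False te by (intro C(2)) auto
      then have "p (g (c t) - g (c t0)) \<le> C * \<bar>t - t0\<bar>"
        using False continuous_seminormD(2)[OF p(1) dT] by (simp add: field_simps)
      also have "\<dots> \<le> C * (1 / (C + 1))" using td C(1) by (intro mult_left_mono) (auto simp: d_def)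
      also have "\<dots> < 1" using C(1) by (simp add: field_simps)
      finally have "g (c t) \<in> V" using p(2)[OF gT[OF te]] by blast
      then show ?thesis using in_U[OF te] by simp
    qed
    ultimately show "\<exists>e>0. ball t0 e \<subseteq> c -` {x \<in> U. g x \<in> V}" by blast
  qed
  then have "openin (c_infinity_topology ?X) {x \<in> U. g x \<in> V}"
    unfolding openin_c_infinity_topology using UX by auto
  then have "openin ?X ?P" using cinf P by simp
  then show "openin (subtopology ?X U) ?P"
    using U by (auto simp: openin_open_subtopology)
qed

lemma join_line: "join m (x + t *\<^sub>R v) v = join m x v + t *\<^sub>R join m v 0"
  by (auto simp: join_def fun_eq_iff scaleR_fun_def)

text \<open>
  Let \<open>D t\<close> be the difference quotient of \<open>g\<close> at \<open>x\<close> in direction \<open>v\<close>. For every continuous functional \<open>l\<close>, two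
  applications of the mean value theorem to \<open>l \<circ> g\<close> along the line give \<open>\<bar>l (D t) - l (D s)\<bar> \<le> K (\<bar>t\<bar> + \<bar>s\<bar>)\<close>
  with \<open>K\<close> a bound for the second derivative. So the elements \<open>(D t - D s) / (\<bar>t\<bar> + \<bar>s\<bar>)\<close> form a weakly bounded
  set; it is bounded, and completeness provides the limit of \<open>D\<close>.
\<close>

lemma weakly_C2_imp_directional_derivative:
  assumes E: "vector_topology E" and fr: "frechet_space F" and nuc: "nuclear_space F"
    and U: "openin (power_space E m) U" and gU: "\<And>x. x \<in> U \<Longrightarrow> g x \<in> topspace F"
    and w: "\<And>l. linear_functional F l \<Longrightarrow> continuous_map F euclideanreal l \<Longrightarrow>
      Ck_on (Suc (Suc 0)) m E euclideanreal U (\<lambda>x. l (g x))"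
    and x: "x \<in> U" and v: "v \<in> topspace (power_space E m)"
  obtains d where "has_directional_derivative F g x v d"
proof -
  let ?X = "power_space E m" and ?X2 = "power_space E (2 * m)"
  have X: "vector_topology ?X" by (rule vector_topology_power_space[OF E])
  have F: "vector_topology F"
    using fr by (simp add: frechet_space_def locally_convex_imp_vector_topology)
  note T = vector_topologyD[OF F]
  have UX: "U \<subseteq> topspace ?X" by (rule openin_subset[OF U])
  have xX: "x \<in> topspace ?X" using x UX by blast
  have "open {t. x + t *\<^sub>R v \<in> U}" by (rule open_line_preimage[OF X U xX v])
  moreover have "0 \<in> {t. x + t *\<^sub>R v \<in> U}" using x by simp
  ultimately obtain e where e: "e > 0" "cball 0 e \<subseteq> {t. x + t *\<^sub>R v \<in> U}"
    unfolding open_contains_cball by blast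
  then have in_U: "x + t *\<^sub>R v \<in> U" if "\<bar>t\<bar> \<le> e" for t
    using that by (auto simp: subset_iff)
  define D where "D t = (g (x + t *\<^sub>R v) - g x) /\<^sub>R t" for t
  have DT: "D t \<in> topspace F" if "\<bar>t\<bar> \<le> e" for t
    unfolding D_def using gU[OF in_U[OF that]] gU[OF x] by (intro T)
  let ?I = "{(s, t). s \<noteq> 0 \<and> t \<noteq> 0 \<and> \<bar>s\<bar> < e \<and> \<bar>t\<bar> < e}"
  let ?B = "(\<lambda>(s, t). (D t - D s) /\<^sub>R (\<bar>t\<bar> + \<bar>s\<bar>)) ` ?I"
  have B: "?B \<subseteq> topspace F" by (auto intro!: T DT)
  have wb: "\<exists>K. \<forall>x\<in>?B. \<bar>l x\<bar> \<le> K" if l: "linear_functional F l" "continuous_map F euclideanreal l" for l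
  proof -
    let ?f = "\<lambda>x. l (g x)"
    define f1 where "f1 = differential m euclideanreal ?f"
    define u u' u'' where "u t = ?f (x + t *\<^sub>R v)" and "u' t = f1 (join m (x + t *\<^sub>R v) v)"
      and "u'' t = differential (2 * m) euclideanreal f1 (join (2 * m) (join m (x + t *\<^sub>R v) v) (join m v 0))" for t
    have z0: "(0 :: nat \<Rightarrow> 'a) \<in> topspace ?X" by (rule vector_topologyD(1)[OF X])
    have f1: "Ck_on (Suc 0) (2 * m) E euclideanreal (tangent_domain m E U) f1"
      unfolding f1_def by (rule Ck_on_SucD(2)[OF Hausdorff_space_euclidean w[OF l]])
    have U2: "openin ?X2 (tangent_domain m E U)" by (rule openin_tangent_domain[OF U])
    have in_T: "join m (x + t *\<^sub>R v) v \<in> tangent_domain m E U" if "\<bar>t\<bar> \<le> e" for t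
      using join_in_tangent_domain[OF UX in_U[OF that] v] .
    have v2: "join m v 0 \<in> topspace ?X2" using v z0 by (rule join_in_power_space)
    have du: "(u has_real_derivative u' t) (at t)" if "\<bar>t\<bar> \<le> e" for t
      using C1_has_real_derivative_along_line[OF U w[OF l] in_U[OF that] v]
      unfolding u_def[abs_def] u'_def f1_def .
    have du': "(u' has_real_derivative u'' t) (at t)" if "\<bar>t\<bar> \<le> e" for t
      using C1_has_real_derivative_along_line[OF U2 f1 in_T[OF that, unfolded join_line] v2]
      unfolding u'_def[abs_def] u''_def join_line .
    have "continuous_on {-e..e} u''"
    proof -
      have l1: "continuous_map (subtopology euclideanreal {-e..e}) ?X2 (\<lambda>t. join m x v + t *\<^sub>R join m v 0)"
        using xX v v2 by (intro continuous_map_from_subtopology continuous_map_line vector_topology_power_space[OF E]) simp_all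
      have "continuous_map (subtopology euclideanreal {-e..e}) (power_space E (2 * (2 * m)))
         (\<lambda>t. join (2 * m) (join m (x + t *\<^sub>R v) v) (join m v 0))"
        unfolding join_line[of m x] by (rule continuous_map_join[OF l1]) (simp add: continuous_map_const v2 del: join_in_power_space)
      then have "continuous_map (subtopology euclideanreal {-e..e})
          (subtopology (power_space E (2 * (2 * m))) (tangent_domain (2 * m) E (tangent_domain m E U)))
         (\<lambda>t. join (2 * m) (join m (x + t *\<^sub>R v) v) (join m v 0))"
        using join_in_tangent_domain[OF openin_subset[OF U2] in_T v2]
        by (auto simp: continuous_map_in_subtopology abs_le_iff)
      from continuous_map_compose[OF this Ck_on_imp_continuous[OF Ck_on_SucD(2)[OF Hausdorff_space_euclidean f1]]]
      show ?thesis by (simp add: o_def u''_def)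
    qed
    from continuous_bounded_on_symmetric_interval[OF this]
    obtain K where K: "K \<ge> 0" "\<And>s. \<bar>s\<bar> \<le> e \<Longrightarrow> \<bar>u'' s\<bar> \<le> K"
      by blast
    have near: "\<bar>l (D t) - u' 0\<bar> \<le> K * \<bar>t\<bar>" if t: "t \<noteq> 0" "\<bar>t\<bar> < e" for t
    proof -
      have "\<And>s. \<bar>s\<bar> \<le> \<bar>t\<bar> \<Longrightarrow> (u has_real_derivative u' s) (at s)" using du t(2) by auto
      then obtain \<xi> where \<xi>: "\<bar>\<xi>\<bar> \<le> \<bar>t\<bar>" "u t - u 0 = t * u' \<xi>" by (rule mean_value_symmetric)
      have "\<And>s. \<bar>s\<bar> \<le> \<bar>\<xi>\<bar> \<Longrightarrow> (u' has_real_derivative u'' s) (at s)" using du' t(2) \<xi>(1) by auto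
      then obtain \<eta> where \<eta>: "\<bar>\<eta>\<bar> \<le> \<bar>\<xi>\<bar>" "u' \<xi> - u' 0 = \<xi> * u'' \<eta>" by (rule mean_value_symmetric)
      have "l (D t) = (u t - u 0) / t"
        unfolding D_def using linear_functional_quotient[OF F l(1) gU[OF in_U] gU[OF x]] t(2)
        by (simp add: u_def)
      also have "\<dots> = u' \<xi>" using \<xi>(2) t(1) by simp
      finally have "\<bar>l (D t) - u' 0\<bar> = \<bar>\<xi>\<bar> * \<bar>u'' \<eta>\<bar>" using \<eta>(2) by (simp add: abs_mult)
      also have "\<dots> \<le> \<bar>t\<bar> * K" using \<xi>(1) \<eta>(1) t(2) by (intro mult_mono K) auto
      finally show ?thesis by (simp add: mult.commute)
    qed
    have "\<bar>l ((D t - D s) /\<^sub>R (\<bar>t\<bar> + \<bar>s\<bar>))\<bar> \<le> K" if "s \<noteq> 0" "t \<noteq> 0" "\<bar>s\<bar> < e" "\<bar>t\<bar> < e" for s t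
    proof -
      have "\<bar>l (D t) - l (D s)\<bar> \<le> K * (\<bar>t\<bar> + \<bar>s\<bar>)"
        using near[of t] near[of s] that by (simp add: distrib_left)
      moreover have "l ((D t - D s) /\<^sub>R (\<bar>t\<bar> + \<bar>s\<bar>)) = (l (D t) - l (D s)) / (\<bar>t\<bar> + \<bar>s\<bar>)"
        by (rule linear_functional_quotient[OF F l(1)]) (use that in \<open>auto intro!: DT\<close>)
      moreover have "\<bar>t\<bar> + \<bar>s\<bar> > 0" using that by linarith
      ultimately show ?thesis by (simp add: abs_divide pos_divide_le_eq)
    qed
    then show ?thesis by (intro exI[of _ K]) auto
  qed
  obtain d where "limitin F D d (at 0)"
  proof (rule frechet_Cauchy_at_0_convergent[OF fr e(1)])
    show "D t \<in> topspace F" if "t \<noteq> 0" "\<bar>t\<bar> < e" for t using that by (intro DT) simp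
    fix p assume p: "continuous_seminorm F p"
    obtain C where C: "C \<ge> 0" "\<And>x. x \<in> ?B \<Longrightarrow> p x \<le> C"
      using nuclear_weakly_bounded_imp_bounded[OF nuc B wb p] by blast
    have "p (D t - D s) \<le> C * (\<bar>t\<bar> + \<bar>s\<bar>)" if "s \<noteq> 0" "t \<noteq> 0" "\<bar>s\<bar> < e" "\<bar>t\<bar> < e" for s t
    proof -
      have "p ((D t - D s) /\<^sub>R (\<bar>t\<bar> + \<bar>s\<bar>)) \<le> C" using that by (intro C(2)) force
      moreover have "D t - D s \<in> topspace F" using that by (intro T DT) auto
      moreover have "\<bar>t\<bar> + \<bar>s\<bar> > 0" using that by linarith
      ultimately show ?thesis
        using continuous_seminormD(2)[OF p, of "D t - D s" "inverse (\<bar>t\<bar> + \<bar>s\<bar>)"]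
        by (simp add: inverse_eq_divide pos_divide_le_eq)
    qed
    then show "\<exists>C. \<forall>s t. s \<noteq> 0 \<longrightarrow> t \<noteq> 0 \<longrightarrow> \<bar>s\<bar> < e \<longrightarrow> \<bar>t\<bar> < e \<longrightarrow> p (D t - D s) \<le> C * (\<bar>t\<bar> + \<bar>s\<bar>)"
      by blast
  qed
  then show thesis using that unfolding has_directional_derivative_def D_def by blast
qed

lemma has_directional_derivative_linear_functional:
  assumes E: "vector_topology E" and F: "vector_topology F"
    and l: "linear_functional F l" "continuous_map F euclideanreal l"
    and U: "openin E U" and gU: "\<And>x. x \<in> U \<Longrightarrow> g x \<in> topspace F"
    and x: "x \<in> U" and v: "v \<in> topspace E" and d: "has_directional_derivative F g x v d"
  shows "has_directional_derivative euclideanreal (\<lambda>x. l (g x)) x v (l d)"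
proof -
  have "limitin euclideanreal (l \<circ> (\<lambda>t. (g (x + t *\<^sub>R v) - g x) /\<^sub>R t)) (l d) (at 0)"
    by (rule continuous_map_limit[OF l(2) d[unfolded has_directional_derivative_def]])
  moreover have "\<forall>\<^sub>F t in at 0. (l \<circ> (\<lambda>t. (g (x + t *\<^sub>R v) - g x) /\<^sub>R t)) t = (l (g (x + t *\<^sub>R v)) - l (g x)) /\<^sub>R t"
    using eventually_line_in[OF E U x v]
  proof eventually_elim
    case (elim t)
    then show ?case using linear_functional_quotient[OF F l(1) gU[OF elim] gU[OF x], of t]
      by (simp add: divide_inverse mult.commute)
  qed
  ultimately show ?thesis
    unfolding has_directional_derivative_def by (rule limitin_transform_eventually[rotated])
qed

text \<open>
  If all \<open>l \<circ> g\<close> are smooth then \<open>g\<close> is continuous and has directional derivatives, and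
  \<open>l \<circ> dg = d(l \<circ> g)\<close> is again smooth for all \<open>l\<close>. Hence \<open>dg\<close> satisfies the hypotheses in place of \<open>g\<close>, on
  \<open>E\<^sup>2\<^sup>m\<close>, and the induction runs. This is where the assumption on the \<open>c\<^sup>\<infinity>\<close>-topology of all powers of
  \<open>E\<close> is used.
\<close>

lemma weakly_smooth_imp_Ck_on:
  assumes lcE: "E \<in> c_infinity_power_spaces" and fr: "frechet_space F" and nuc: "nuclear_space F"
  shows "1 \<le> m \<Longrightarrow> openin (power_space E m) U \<Longrightarrow> (\<And>x. x \<in> U \<Longrightarrow> g x \<in> topspace F) \<Longrightarrow>
    (\<And>l k. linear_functional F l \<Longrightarrow> continuous_map F euclideanreal l \<Longrightarrow>
      Ck_on k m E euclideanreal U (\<lambda>x. l (g x))) \<Longrightarrow> Ck_on k m E F U g"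
proof (induction k arbitrary: m U g)
  have lc: "locally_convex_space E" and cinf: "\<And>n. 1 \<le> n \<Longrightarrow> c_infinity_topology (power_space E n) = power_space E n"
    using lcE by (auto simp: c_infinity_power_spaces_def)
  have E: "vector_topology E" using lc by (rule locally_convex_imp_vector_topology)
  have F: "vector_topology F"
    using fr by (simp add: frechet_space_def locally_convex_imp_vector_topology)
  have HF: "Hausdorff_space F" using F by (simp add: vector_topology_def)
  {
    case 0
    show ?case
      unfolding Ck_on.simps by (rule weakly_C1_imp_continuous[where g = g, OF lc cinf[OF 0(1)] nuc 0(2) 0(3) 0(4)])
  next
    case (Suc k)
    have dd: "has_directional_derivative F g (base_point m z) (direction m z) (differential m F g z)"
      if z: "z \<in> tangent_domain m E U" for z
    proof -
      have "base_point m z \<in> U" "direction m z \<in> topspace (power_space E m)"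
        using z by (auto simp: tangent_domain_def)
      then obtain d where d: "has_directional_derivative F g (base_point m z) (direction m z) d"
        using weakly_C2_imp_directional_derivative[where g = g, OF E fr nuc Suc.prems(2) Suc.prems(3) Suc.prems(4)] by metis
      then show ?thesis using differential_eq[OF HF d] by simp
    qed
    have "Ck_on k (2 * m) E F (tangent_domain m E U) (differential m F g)"
    proof (rule Suc.IH)
      show "1 \<le> 2 * m" using Suc.prems(1) by simp
      show T: "openin (power_space E (2 * m)) (tangent_domain m E U)" by (rule openin_tangent_domain[OF Suc.prems(2)])
      show "differential m F g z \<in> topspace F" if "z \<in> tangent_domain m E U" for z
        using dd[OF that] unfolding has_directional_derivative_def by (rule limitin_topspace)
      fix l k assume l: "linear_functional F l" "continuous_map F euclideanreal l"
      have "differential m euclideanreal (\<lambda>x. l (g x)) z = l (differential m F g z)"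
        if z: "z \<in> tangent_domain m E U" for z
      proof (rule differential_eq[OF Hausdorff_space_euclidean])
        show "has_directional_derivative euclideanreal (\<lambda>x. l (g x)) (base_point m z) (direction m z)
           (l (differential m F g z))"
          using z by (intro has_directional_derivative_linear_functional[OF vector_topology_power_space[OF E] F l
                Suc.prems(2) Suc.prems(3) _ _ dd[OF z]]) (auto simp: tangent_domain_def)
      qed
      then show "Ck_on k (2 * m) E euclideanreal (tangent_domain m E U) (\<lambda>z. l (differential m F g z))"
        by (rule Ck_on_cong[OF E Hausdorff_space_euclidean T _ Ck_on_SucD(2)[OF Hausdorff_space_euclidean Suc.prems(4)[OF l]]])
    qed
    then show ?case
      by (intro Ck_on_SucI[OF E HF Suc.prems(2) _ dd])
        (rule weakly_C1_imp_continuous[where g = g, OF lc cinf[OF Suc.prems(1)] nuc Suc.prems(2) Suc.prems(3) Suc.prems(4)])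
  }
qed

section \<open>A flat function\<close>

primrec flat_poly :: "nat \<Rightarrow> real poly" where
  "flat_poly 0 = 1"
| "flat_poly (Suc j) = [:0, 0, 1:] * (flat_poly j - pderiv (flat_poly j))"

text \<open>
  The successive derivatives of \<open>exp (-1/t)\<close> for \<open>t > 0\<close>, extended by \<open>0\<close>. In \<open>u = 1/t\<close> each of them is a
  polynomial times \<open>exp (-u)\<close>, and \<open>d/dt = - u\<^sup>2 d/du\<close> gives the recursion for the polynomials.
\<close>

definition flat :: "nat \<Rightarrow> real \<Rightarrow> real" where
  "flat j t = (if t > 0 then poly (flat_poly j) (1 / t) * exp (- (1 / t)) else 0)"

lemma flat_0_pos: "t > 0 \<Longrightarrow> flat 0 t > 0"
  by (simp add: flat_def)

lemma flat_nonneg_arg: "t \<le> 0 \<Longrightarrow> flat j t = 0"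
  by (simp add: flat_def)

lemma poly_div_exp_tendsto_0:
  fixes p :: "real poly"
  shows "((\<lambda>u. poly p u / exp u) \<longlongrightarrow> 0) at_top"
proof -
  have "((\<lambda>u. \<Sum>i\<le>degree p. coeff p i * (u ^ i / exp u)) \<longlongrightarrow> 0) at_top"
    by (intro tendsto_null_sum tendsto_mult_right_zero tendsto_power_div_exp_0)
  then show ?thesis by (simp add: poly_altdef sum_divide_distrib)
qed

lemma flat_has_derivative: "(flat j has_real_derivative flat (Suc j) t) (at t)"
proof -
  consider "t > 0" | "t < 0" | "t = 0" by linarith
  then show ?thesis
  proof cases
    case 1
    let ?P = "flat_poly j"
    have "((\<lambda>t. poly ?P (1 / t) * exp (- (1 / t))) has_real_derivative flat (Suc j) t) (at t)"
    proof -
      have inv: "((\<lambda>t. 1 / t) has_real_derivative - (1 / t\<^sup>2)) (at t)"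
        using 1 by (auto intro!: derivative_eq_intros simp: power2_eq_square)
      have "((\<lambda>t. poly ?P (1 / t)) has_real_derivative poly (pderiv ?P) (1 / t) * - (1 / t\<^sup>2)) (at t)"
        by (rule DERIV_chain2[OF poly_DERIV inv])
      moreover have "((\<lambda>t. exp (- (1 / t))) has_real_derivative exp (- (1 / t)) * (1 / t\<^sup>2)) (at t)"
        using DERIV_chain2[OF DERIV_exp DERIV_minus[OF inv]] by simp
      ultimately have "((\<lambda>t. poly ?P (1 / t) * exp (- (1 / t))) has_real_derivative
         poly (pderiv ?P) (1 / t) * - (1 / t\<^sup>2) * exp (- (1 / t)) + exp (- (1 / t)) * (1 / t\<^sup>2) * poly ?P (1 / t)) (at t)"
        by (rule DERIV_mult)
      moreover have "poly (pderiv ?P) (1 / t) * - (1 / t\<^sup>2) * exp (- (1 / t)) + exp (- (1 / t)) * (1 / t\<^sup>2) * poly ?P (1 / t)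
          = flat (Suc j) t"
        using 1 by (simp add: flat_def field_simps power2_eq_square)
      ultimately show ?thesis by simp
    qed
    then show ?thesis
      by (rule has_field_derivative_transform_within_open[where S = "{0<..}"]) (use 1 in \<open>auto simp: flat_def\<close>)
  next
    case 2
    have "((\<lambda>t. 0) has_real_derivative flat (Suc j) t) (at t)" using 2 by (simp add: flat_def)
    then show ?thesis
      by (rule has_field_derivative_transform_within_open[where S = "{..<0}"]) (use 2 in \<open>auto simp: flat_def\<close>)
  next
    case 3
    \<comment> \<open>At \<open>0\<close> the difference quotient is \<open>flat j h / h\<close>; on the right it is a polynomial in \<open>u = 1/h\<close> times
      \<open>exp (-u)\<close> with \<open>u \<rightarrow> \<infinity>\<close>.\<close>
    have l: "((\<lambda>h. flat j h / h) \<longlongrightarrow> 0) (at_left 0)"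
      by (rule tendsto_eventually) (simp add: eventually_at_filter flat_def)
    have "((\<lambda>u. poly ([:0, 1:] * flat_poly j) u / exp u) \<longlongrightarrow> 0) at_top"
      by (rule poly_div_exp_tendsto_0)
    from filterlim_compose[OF this filterlim_inverse_at_top_right]
    have "((\<lambda>h. poly ([:0, 1:] * flat_poly j) (inverse h) / exp (inverse h)) \<longlongrightarrow> 0) (at_right (0::real))" .
    moreover have "\<forall>\<^sub>F h in at_right 0. poly ([:0, 1:] * flat_poly j) (inverse h) / exp (inverse h) = flat j h / h"
      using eventually_at_right_less[of "0::real"]
      by eventually_elim (simp add: flat_def exp_minus field_simps)
    ultimately have r: "((\<lambda>h. flat j h / h) \<longlongrightarrow> 0) (at_right 0)"
      by (rule Lim_transform_eventually)
    have "((\<lambda>h. flat j h / h) \<longlongrightarrow> 0) (at 0)"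
      using l r by (rule filterlim_split_at)
    then show ?thesis using 3 by (simp add: DERIV_def flat_nonneg_arg)
  qed
qed

lemma inverse_power_has_derivative:
  fixes t :: real
  assumes "t > 0"
  shows "((\<lambda>t. (-1) ^ j * fact j * inverse t ^ Suc j) has_real_derivative
    (-1) ^ Suc j * fact (Suc j) * inverse t ^ Suc (Suc j)) (at t)"
proof -
  have "((\<lambda>t. (-1) ^ j * fact j * inverse t ^ Suc j) has_real_derivative
    (-1) ^ j * fact j * (real (Suc j) * (inverse t ^ j * - (inverse t ^ Suc (Suc 0))))) (at t)"
    using assms DERIV_power[OF DERIV_inverse[of t UNIV], of "Suc j"] by (intro DERIV_cmult) (simp add: mult_ac)
  then show ?thesis by (rule back_subst[of "\<lambda>d. (_ has_real_derivative d) (at t)"]) (simp add: algebra_simps)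
qed

lemma Ck_on_inverse:
  assumes E: "vector_topology E" and U: "openin (power_space E m) U"
    and f: "Ck_on k m E euclideanreal U f" and pos: "\<And>x. x \<in> U \<Longrightarrow> f x > 0"
  shows "Ck_on k m E euclideanreal U (\<lambda>x. inverse (f x))"
  using Ck_on_compose_real[where \<rho> = "\<lambda>j t. (-1) ^ j * fact j * inverse t ^ Suc j" and S = "{0<..}" and j = 0,
      OF E inverse_power_has_derivative U f] pos by auto

section \<open>Smooth maps on open sets\<close>

lemma openin_singleton_domain:
  assumes "openin E U"
  shows "openin (power_space E 1) {x \<in> topspace (power_space E 1). x 0 \<in> U}"
  by (rule openin_continuous_map_preimage[OF continuous_map_component assms]) simp

lemma smooth_on_subset: "smooth_on E F U f \<Longrightarrow> V \<subseteq> U \<Longrightarrow> smooth_on E F V f"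
  unfolding smooth_on_def by (fast intro: Ck_on_subset)

lemma smooth_on_cong:
  assumes "vector_topology E" "Hausdorff_space F" "openin E U" "\<And>x. x \<in> U \<Longrightarrow> f x = g x" "smooth_on E F U f"
  shows "smooth_on E F U g"
  unfolding smooth_on_def
proof
  fix k
  have "Ck_on k 1 E F {x \<in> topspace (power_space E 1). x 0 \<in> U} (\<lambda>x. f (x 0))"
    using assms(5) by (simp add: smooth_on_def)
  then show "Ck_on k 1 E F {x \<in> topspace (power_space E 1). x 0 \<in> U} (\<lambda>x. g (x 0))"
    by (rule Ck_on_cong[OF assms(1,2) openin_singleton_domain[OF assms(3)], rotated]) (simp add: assms(4))
qed

lemma smooth_on_local:
  assumes F: "Hausdorff_space F"
    and loc: "\<And>x. x \<in> U \<Longrightarrow> x \<in> topspace E \<Longrightarrow> \<exists>V. openin E V \<and> x \<in> V \<and> smooth_on E F (U \<inter> V) f"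
  shows "smooth_on E F U f"
  unfolding smooth_on_def
proof
  fix k
  let ?D = "\<lambda>U. {x \<in> topspace (power_space E 1). x 0 \<in> U}"
  show "Ck_on k 1 E F (?D U) (\<lambda>x. f (x 0))"
  proof (rule Ck_on_local[OF F])
    fix x assume x: "x \<in> ?D U"
    then have "x 0 \<in> U" "x 0 \<in> topspace E" by (auto simp: topspace_power_space)
    from loc[OF this] obtain V where V: "openin E V" "x 0 \<in> V" "smooth_on E F (U \<inter> V) f" by blast
    have "?D U \<inter> ?D V = ?D (U \<inter> V)" by auto
    then have "Ck_on k 1 E F (?D U \<inter> ?D V) (\<lambda>x. f (x 0))" using V(3) by (simp add: smooth_on_def)
    moreover have "x \<in> ?D V" using x V(2) by simp
    ultimately show "\<exists>W. openin (power_space E 1) W \<and> x \<in> W \<and> Ck_on k 1 E F (?D U \<inter> W) (\<lambda>x. f (x 0))"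
      using openin_singleton_domain[OF V(1)] by blast
  qed
qed

lemma smooth_on_imp_continuous_map:
  assumes E: "vector_topology E" and U: "U \<subseteq> topspace E" and f: "smooth_on E F U f"
  shows "continuous_map (subtopology E U) F f"
proof -
  let ?D = "{x \<in> topspace (power_space E 1). x 0 \<in> U}"
  have "Ck_on 0 1 E F ?D (\<lambda>x. f (x 0))" using f unfolding smooth_on_def by blast
  then have c: "continuous_map (subtopology (power_space E 1) ?D) F (\<lambda>x. f (x 0))" by simp
  have "continuous_map (subtopology E U) (subtopology (power_space E 1) ?D) (\<lambda>x i. if i = (0::nat) then x else 0)"
    unfolding continuous_map_in_subtopology continuous_map_power_space
    using U by (auto simp: topspace_power_space continuous_map_from_subtopology continuous_map_id[unfolded id_def])
  from continuous_map_compose[OF this c] show ?thesis by (simp add: o_def)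
qed

lemma smooth_on_const:
  assumes "vector_topology E" "openin E U"
  shows "smooth_on E euclideanreal U (\<lambda>x. c)"
  unfolding smooth_on_def by (intro allI Ck_on_const[OF assms(1)] openin_singleton_domain assms(2))

lemma smooth_on_mult:
  assumes "vector_topology E" "openin E U" "smooth_on E euclideanreal U f" "smooth_on E euclideanreal U g"
  shows "smooth_on E euclideanreal U (\<lambda>x. f x * g x)"
  using assms(3,4) unfolding smooth_on_def
  by (intro allI Ck_on_mult[OF assms(1) openin_singleton_domain[OF assms(2)]]) blast+

lemma smooth_on_linear:
  assumes "vector_topology E" "openin E U" "linear_functional E l" "continuous_map E euclideanreal l"
  shows "smooth_on E euclideanreal U l"
  unfolding smooth_on_def
  by (intro allI Ck_on_linear[OF assms(1,3,4) openin_singleton_domain[OF assms(2)]]) simp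

lemma smooth_on_compose:
  assumes E: "vector_topology E" and F: "vector_topology F" and U: "openin E U" and V: "openin F V"
    and g: "smooth_on E F U g" and gU: "g ` U \<subseteq> V" and f: "smooth_on F euclideanreal V f"
  shows "smooth_on E euclideanreal U (f \<circ> g)"
  unfolding smooth_on_def
proof
  fix k
  let ?U = "{x \<in> topspace (power_space E 1). x 0 \<in> U}" and ?V = "{x \<in> topspace (power_space F 1). x 0 \<in> V}"
  have "Ck_on k 1 E euclideanreal ?U (\<lambda>x. (\<lambda>y. f (y 0)) (tuple 1 (\<lambda>i x. g (x 0)) x))"
  proof (rule Ck_on_compose[OF E F openin_singleton_domain[OF U] openin_singleton_domain[OF V]])
    show "Ck_on k 1 E F ?U (\<lambda>x. g (x 0))" using g by (simp add: smooth_on_def)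
    show "Ck_on k 1 F euclideanreal ?V (\<lambda>y. f (y 0))" using f by (simp add: smooth_on_def)
    show "tuple 1 (\<lambda>i x. g (x 0)) x \<in> ?V" if "x \<in> ?U" for x
      using that gU openin_subset[OF V] by (auto simp: tuple_def topspace_power_space image_subset_iff)
  qed
  then show "Ck_on k 1 E euclideanreal ?U (\<lambda>x. (f \<circ> g) (x 0))" by (simp add: tuple_def)
qed

section \<open>Bump functions\<close>

text \<open>
  Nuclearity provides Hilbertian seminorms: with \<open>w n = p (y n) / a n\<close> the form
  \<open>B x z = (\<Sum>n. w n * f n x * f n z)\<close> converges because \<open>\<Sum>n. a n * p (y n)\<close> does. The last estimate, which
  says that \<open>p\<close> is small where \<open>B x x\<close> is, follows from \<open>p x \<le> (\<Sum>n. \<bar>f n x\<bar> * p (y n))\<close> by the inequality between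
  arithmetic and geometric mean in each term.
\<close>

lemma nuclear_quadratic_form:
  assumes nuc: "nuclear_space F" and p: "continuous_seminorm F p"
  obtains B M where "continuous_map (prod_topology F F) euclideanreal (\<lambda>(x, y). B x y)"
    "\<And>x. x \<in> topspace F \<Longrightarrow> linear_functional F (B x)"
    "\<And>x y. B x y = B y x" "\<And>x. x \<in> topspace F \<Longrightarrow> 0 \<le> B x x" "0 \<le> M"
    "\<And>x \<delta>. x \<in> topspace F \<Longrightarrow> \<delta> > 0 \<Longrightarrow> p x \<le> (\<delta> * M + B x x / \<delta>) / 2"
proof -
  have F: "vector_topology F"
    using nuc by (simp add: nuclear_space_def locally_convex_imp_vector_topology)
  obtain q where q: "continuous_seminorm F q" and "nuclear_canonical_map F q p"
    using nuc p by (auto simp: nuclear_space_def)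
  then obtain f a y where H: "\<forall>n. linear_functional F (f n) \<and> 0 \<le> a n \<and> (\<forall>x\<in>topspace F. \<bar>f n x\<bar> \<le> a n * q x)"
    "\<forall>n. y n \<in> topspace F" "summable (\<lambda>n. a n * p (y n))"
    "\<forall>x\<in>topspace F. (\<lambda>N. p (x - (\<Sum>n<N. f n x *\<^sub>R y n))) \<longlonglongrightarrow> 0"
    unfolding nuclear_canonical_map_def by (elim exE conjE)
  have lf: "\<And>n. linear_functional F (f n)" and a: "\<And>n. 0 \<le> a n"
    and fa: "\<And>n x. x \<in> topspace F \<Longrightarrow> \<bar>f n x\<bar> \<le> a n * q x"
    and y: "\<And>n. y n \<in> topspace F" and sm: "summable (\<lambda>n. a n * p (y n))"
    and lim: "\<And>x. x \<in> topspace F \<Longrightarrow> (\<lambda>N. p (x - (\<Sum>n<N. f n x *\<^sub>R y n))) \<longlonglongrightarrow> 0"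
    using H by simp_all
  have py: "0 \<le> p (y n)" for n using seminorm_nonneg[OF F p y] .
  have qn: "0 \<le> q x" if "x \<in> topspace F" for x using seminorm_nonneg[OF F q that] .
  \<comment> \<open>If \<open>a n = 0\<close> then \<open>f n\<close> vanishes, and the value \<open>w n = 0\<close> given by the division is harmless.\<close>
  define w where "w n = p (y n) / a n" for n
  define b where "b n x z = w n * f n x * f n z" for n x z
  have w: "0 \<le> w n" for n using a py by (simp add: w_def)
  have b_le: "\<bar>b n x z\<bar> \<le> a n * p (y n) * (q x * q z)" if x: "x \<in> topspace F" and z: "z \<in> topspace F" for n x z
  proof (cases "a n = 0")
    case True
    then show ?thesis by (simp add: b_def w_def)
  next
    case False
    have "\<bar>b n x z\<bar> = w n * (\<bar>f n x\<bar> * \<bar>f n z\<bar>)" using w[of n] by (simp add: b_def abs_mult)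
    also have "\<dots> \<le> w n * ((a n * q x) * (a n * q z))"
      using fa[OF x] fa[OF z] w a qn[OF x] by (intro mult_left_mono mult_mono) auto
    also have "\<dots> = a n * p (y n) * (q x * q z)" using False by (simp add: w_def)
    finally show ?thesis .
  qed
  have sb: "summable (\<lambda>n. \<bar>b n x z\<bar>)" if "x \<in> topspace F" "z \<in> topspace F" for x z
    by (rule summable_comparison_test'[OF summable_mult2[OF sm, of "q x * q z"], of 0])
      (use b_le[OF that] in simp)
  note sb' = summable_rabs_cancel[OF sb]
  define B where "B x z = (\<Sum>n. b n x z)" for x z
  define M where "M = (\<Sum>n. a n * p (y n))"
  have M: "0 \<le> M" unfolding M_def using a py by (intro suminf_nonneg sm) simp
  have sym: "B x z = B z x" for x z by (simp add: B_def b_def mult_ac)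
  have lin: "linear_functional F (B x)" if x: "x \<in> topspace F" for x
    unfolding linear_functional_def
  proof (intro conjI ballI allI)
    fix u v assume uv: "u \<in> topspace F" "v \<in> topspace F"
    have "(\<lambda>n. b n x (u + v)) = (\<lambda>n. b n x u + b n x v)"
      using lf uv by (auto simp: linear_functional_def b_def algebra_simps)
    then show "B x (u + v) = B x u + B x v"
      unfolding B_def using suminf_add[OF sb'[OF x uv(1)] sb'[OF x uv(2)]] by simp
  next
    fix c u assume u: "u \<in> topspace F"
    have "(\<lambda>n. b n x (c *\<^sub>R u)) = (\<lambda>n. c * b n x u)"
      using lf u by (auto simp: linear_functional_def b_def)
    then show "B x (c *\<^sub>R u) = c * B x u"
      unfolding B_def using suminf_mult[OF sb'[OF x u]] by simp
  qed
  have B_le: "\<bar>B x z\<bar> \<le> M * (q x * q z)" if x: "x \<in> topspace F" and z: "z \<in> topspace F" for x z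
  proof -
    have "\<bar>B x z\<bar> \<le> (\<Sum>n. \<bar>b n x z\<bar>)" unfolding B_def by (rule summable_rabs[OF sb[OF x z]])
    also have "\<dots> \<le> (\<Sum>n. a n * p (y n) * (q x * q z))"
      by (rule suminf_le[OF b_le[OF x z] sb[OF x z] summable_mult2[OF sm]])
    also have "\<dots> = M * (q x * q z)" unfolding M_def by (rule suminf_mult2[OF sm, symmetric])
    finally show ?thesis .
  qed
  have cont: "continuous_map (prod_topology F F) euclideanreal (\<lambda>(x, y). B x y)"
  proof (rule continuous_map_real_criterion)
    fix z0 and e :: real assume z0: "z0 \<in> topspace (prod_topology F F)" and e: "e > 0"
    obtain x0 y0 where xy0: "z0 = (x0, y0)" "x0 \<in> topspace F" "y0 \<in> topspace F" using z0 by auto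
    define r where "r z = M * (q (fst z - x0) * q (snd z)) + M * (q x0 * q (snd z - y0))" for z
    have qc: "continuous_map (prod_topology F F) euclideanreal (\<lambda>z. q (g z))"
      if "continuous_map (prod_topology F F) F g" for g
      using continuous_map_compose[OF that continuous_seminormD(3)[OF q]] by (simp add: o_def)
    have "continuous_map (prod_topology F F) euclideanreal r"
      unfolding r_def
      by (intro continuous_map_add continuous_map_real_mult continuous_map_canonical_const qc
          continuous_map_minus_vector[OF F] continuous_map_fst continuous_map_snd)
        (simp_all add: continuous_map_const xy0)
    define Q where "Q = {z \<in> topspace (prod_topology F F). r z \<in> {..<e}}"
    have o: "openin (prod_topology F F) Q"
      unfolding Q_def by (rule openin_continuous_map_preimage[OF \<open>continuous_map (prod_topology F F) euclideanreal r\<close>]) simp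
    have "\<bar>B u v - B x0 y0\<bar> < e" if u: "u \<in> topspace F" and v: "v \<in> topspace F" and ruv: "r (u, v) < e" for u v
    proof -
      note T = vector_topologyD(3)[OF F]
      have "B (u - x0) v = B u v - B x0 v"
        using linear_functional_diff[OF F lin[OF v] u xy0(2)] by (simp add: sym)
      moreover have "B x0 (v - y0) = B x0 v - B x0 y0"
        using linear_functional_diff[OF F lin[OF xy0(2)] v xy0(3)] .
      ultimately have "\<bar>B u v - B x0 y0\<bar> \<le> \<bar>B (u - x0) v\<bar> + \<bar>B x0 (v - y0)\<bar>" by linarith
      also have "\<dots> \<le> r (u, v)"
        using B_le[OF T[OF u xy0(2)] v] B_le[OF xy0(2) T[OF v xy0(3)]] by (simp add: r_def)
      finally show ?thesis using ruv by simp
    qed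
    moreover have "r z0 < e" using e xy0 seminorm_0[OF F q] by (simp add: r_def)
    ultimately show "\<exists>U. openin (prod_topology F F) U \<and> z0 \<in> U \<and>
        (\<forall>z\<in>U. \<bar>(case z of (x, y) \<Rightarrow> B x y) - (case z0 of (x, y) \<Rightarrow> B x y)\<bar> < e)"
      using z0 xy0(1) o by (intro exI[of _ Q]) (auto simp: Q_def)
  qed
  have pos: "0 \<le> B x x" if x: "x \<in> topspace F" for x
    unfolding B_def using w by (intro suminf_nonneg sb'[OF x x]) (simp add: b_def mult.assoc)
  have "p x \<le> (\<delta> * M + B x x / \<delta>) / 2" if x: "x \<in> topspace F" and \<delta>: "\<delta> > 0" for x \<delta>
  proof -
    note S = nuclear_seminorm_le_suminf[where f = f and a = a and c = "q x", OF F p y sm fa[OF x] x lim[OF x]]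
    have t: "\<bar>f n x\<bar> * p (y n) \<le> (a n * p (y n)) * (\<delta> / 2) + b n x x * (1 / (2 * \<delta>))" for n
    proof (cases "a n = 0")
      case True
      then show ?thesis using fa[OF x, of n] by (simp add: b_def w_def)
    next
      case False
      then have an: "a n > 0" using a[of n] by simp
      have "0 \<le> (\<bar>f n x\<bar> - a n * \<delta>)\<^sup>2" by simp
      then have "2 * (\<bar>f n x\<bar> * (a n * \<delta>)) \<le> (f n x)\<^sup>2 + (a n * \<delta>)\<^sup>2" by (simp add: power2_diff algebra_simps)
      then have "\<bar>f n x\<bar> \<le> a n * (\<delta> / 2) + (f n x)\<^sup>2 / a n * (1 / (2 * \<delta>))"
        using an \<delta> by (simp add: field_simps power2_eq_square)
      from mult_right_mono[OF this py[of n]] show ?thesis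
        by (simp add: b_def w_def algebra_simps power2_eq_square)
    qed
    have sr: "summable (\<lambda>n. (a n * p (y n)) * (\<delta> / 2) + b n x x * (1 / (2 * \<delta>)))"
      by (intro summable_add summable_mult2 sm sb'[OF x x])
    have "p x \<le> (\<Sum>n. \<bar>f n x\<bar> * p (y n))" by (rule S(2))
    also have "\<dots> \<le> (\<Sum>n. (a n * p (y n)) * (\<delta> / 2) + b n x x * (1 / (2 * \<delta>)))"
      by (rule suminf_le[OF t S(1) sr])
    also have "\<dots> = M * (\<delta> / 2) + B x x * (1 / (2 * \<delta>))"
      unfolding M_def B_def
      by (simp only: suminf_add[OF summable_mult2[OF sm] summable_mult2[OF sb'[OF x x]], symmetric]
          suminf_mult2[OF sm] suminf_mult2[OF sb'[OF x x]])
    also have "\<dots> = (\<delta> * M + B x x / \<delta>) / 2" using \<delta> by (simp add: field_simps)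
    finally show ?thesis .
  qed
  from that[OF cont lin sym pos M this] show thesis by blast
qed

text \<open>
  A smooth function of a quadratic form. With \<open>s x = B (x - c) (x - c) / \<delta>\<close> and the flat function \<open>e\<close> vanishing
  exactly on the nonpositive reals, the quotient \<open>e (1 - s) / (e (1 - s) + e (s - 1/2))\<close> is \<open>1\<close> for \<open>s \<le> 1/2\<close> and \<open>0\<close> for
  \<open>s \<ge> 1\<close>; its denominator never vanishes.
\<close>

lemma nuclear_bump_function:
  assumes nuc: "nuclear_space F" and W: "openin F W" and c: "c \<in> W"
  obtains b V where "smooth_on F euclideanreal (topspace F) b" "openin F V" "c \<in> V"
    "\<And>x. x \<in> V \<Longrightarrow> b x = 1" "\<And>x. x \<in> topspace F \<Longrightarrow> x \<notin> W \<Longrightarrow> b x = 0"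
proof -
  have lc: "locally_convex_space F" using nuc by (simp add: nuclear_space_def)
  have F: "vector_topology F" using lc by (rule locally_convex_imp_vector_topology)
  have cT: "c \<in> topspace F" using openin_subset[OF W] c by blast
  obtain p where p: "continuous_seminorm F p" "\<And>x. x \<in> topspace F \<Longrightarrow> p (x - c) < 1 \<Longrightarrow> x \<in> W"
    using seminorm_inside_neighbourhood[OF lc W c] by blast
  obtain B M where B: "continuous_map (prod_topology F F) euclideanreal (\<lambda>(x, y). B x y)"
    and lin: "\<And>x. x \<in> topspace F \<Longrightarrow> linear_functional F (B x)"
    and sym: "\<And>x y. B x y = B y x" and pos: "\<And>x. x \<in> topspace F \<Longrightarrow> 0 \<le> B x x" and M: "0 \<le> M"
    and pB: "\<And>x \<delta>. x \<in> topspace F \<Longrightarrow> \<delta> > 0 \<Longrightarrow> p x \<le> (\<delta> * M + B x x / \<delta>) / 2"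
    using nuclear_quadratic_form[OF nuc p(1)] by metis
  have lin': "linear_functional F (\<lambda>x. B x y)" if "y \<in> topspace F" for y
    using lin[OF that] by (simp add: sym[of _ y])
  \<comment> \<open>Chosen so that \<open>s x < 1\<close> forces \<open>p (x - c) < 1\<close> in the estimate for \<open>p\<close>.\<close>
  define \<delta> where "\<delta> = 1 / (M + 1)"
  have \<delta>: "\<delta> > 0" "\<delta> * M < 1" using M by (auto simp: \<delta>_def)
  define s where "s x = B (x - c) (x - c) / \<delta>" for x
  define b where "b x = flat 0 (1 - s x) * inverse (flat 0 (1 - s x) + flat 0 (s x - 1 / 2))" for x
  have flat_ge: "0 \<le> flat 0 t" for t using flat_0_pos[of t] flat_nonneg_arg[of t 0] by fastforce
  have den: "flat 0 (1 - t) + flat 0 (t - 1 / 2) > 0" for t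
  proof (cases "t < 1")
    case True then show ?thesis using flat_0_pos[of "1 - t"] flat_ge[of "t - 1/2"] by simp
  next
    case False then show ?thesis using flat_0_pos[of "t - 1/2"] flat_ge[of "1 - t"] by simp
  qed
  have s_eq: "(B x x + (- 2 * B c x + B c c)) * (1 / \<delta>) = s x" if x: "x \<in> topspace F" for x
  proof -
    have xc: "x - c \<in> topspace F" using vector_topologyD(3)[OF F x cT] .
    have "B (x - c) (x - c) = B (x - c) x - B (x - c) c" by (rule linear_functional_diff[OF F lin[OF xc] x cT])
    also have "B (x - c) x = B x x - B c x" by (rule linear_functional_diff[OF F lin'[OF x] x cT])
    also have "B (x - c) c = B x c - B c c" by (rule linear_functional_diff[OF F lin'[OF cT] x cT])
    finally show ?thesis by (simp add: s_def sym[of x c])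
  qed
  let ?D = "{x \<in> topspace (power_space F 1). x 0 \<in> topspace F}"
  have D: "openin (power_space F 1) ?D" by (rule openin_singleton_domain) simp
  have "smooth_on F euclideanreal (topspace F) b"
    unfolding smooth_on_def
  proof
    fix k
    have Bc: "continuous_map F euclideanreal (B c)"
    proof -
      have "continuous_map F (prod_topology F F) (\<lambda>x. (c, x))"
        by (intro continuous_map_pairedI) (simp_all add: continuous_map_const cT continuous_map_id[unfolded id_def])
      from continuous_map_compose[OF this B] show ?thesis by (simp add: o_def)
    qed
    have C1: "Ck_on k 1 F euclideanreal ?D (\<lambda>x. B (x 0) (x 0))"
      by (rule Ck_on_bilinear[OF F B lin lin' D]) simp_all
    have C2: "Ck_on k 1 F euclideanreal ?D (\<lambda>x. B c (x 0))"
      by (rule Ck_on_linear[OF F lin[OF cT] Bc D]) simp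
    have "Ck_on k 1 F euclideanreal ?D (\<lambda>x. (B (x 0) (x 0) + (- 2 * B c (x 0) + B c c)) * (1 / \<delta>))"
      by (rule Ck_on_mult[OF F D Ck_on_add[OF F D C1 Ck_on_add[OF F D Ck_on_mult[OF F D Ck_on_const[OF F D] C2]
              Ck_on_const[OF F D]]] Ck_on_const[OF F D]])
    then have S: "Ck_on k 1 F euclideanreal ?D (\<lambda>x. s (x 0))"
      by (rule Ck_on_cong[OF F Hausdorff_space_euclidean D, rotated]) (rule s_eq, simp)
    have S1: "Ck_on k 1 F euclideanreal ?D (\<lambda>x. 1 - s (x 0))"
      using Ck_on_add[OF F D Ck_on_const[OF F D, of k 1] Ck_on_mult[OF F D Ck_on_const[OF F D, of k "-1"] S]] by simp
    have S2: "Ck_on k 1 F euclideanreal ?D (\<lambda>x. s (x 0) - 1 / 2)"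
      using Ck_on_add[OF F D S Ck_on_const[OF F D, of k "-1/2"]] by simp
    have f1: "Ck_on k 1 F euclideanreal ?D (\<lambda>x. flat 0 (1 - s (x 0)))"
      by (rule Ck_on_compose_real[where S = UNIV and \<rho> = flat and j = 0, OF F flat_has_derivative D S1]) simp
    have f2: "Ck_on k 1 F euclideanreal ?D (\<lambda>x. flat 0 (s (x 0) - 1 / 2))"
      by (rule Ck_on_compose_real[where S = UNIV and \<rho> = flat and j = 0, OF F flat_has_derivative D S2]) simp
    show "Ck_on k 1 F euclideanreal ?D (\<lambda>x. b (x 0))"
      unfolding b_def by (rule Ck_on_mult[OF F D f1 Ck_on_inverse[OF F D Ck_on_add[OF F D f1 f2] den]])
  qed
  moreover define V where "V = {x \<in> topspace F. B (x - c) (x - c) \<in> {..<\<delta> / 2}}"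
  have "openin F V"
  proof -
    have "continuous_map F (prod_topology F F) (\<lambda>x. (x - c, x - c))"
      by (intro continuous_map_pairedI continuous_map_minus_vector[OF F])
        (simp_all add: continuous_map_const cT continuous_map_id[unfolded id_def])
    from continuous_map_compose[OF this B]
    have "continuous_map F euclideanreal (\<lambda>x. B (x - c) (x - c))" by (simp add: o_def)
    from openin_continuous_map_preimage[OF this, of "{..<\<delta> / 2}"] show ?thesis by (simp add: V_def)
  qed
  moreover have "c \<in> V"
  proof -
    have "B 0 0 = 0" using linear_functional_diff[OF F lin[OF vector_topologyD(1)[OF F]] cT cT] by simp
    then show ?thesis using cT \<delta> by (simp add: V_def)
  qed
  moreover have "b x = 1" if "x \<in> V" for x
  proof -
    have "s x < 1 / 2" using that \<delta> by (simp add: V_def s_def divide_less_eq)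
    then have "flat 0 (s x - 1 / 2) = 0" "flat 0 (1 - s x) > 0"
      by (auto intro: flat_nonneg_arg flat_0_pos)
    then show ?thesis by (simp add: b_def)
  qed
  moreover have "b x = 0" if x: "x \<in> topspace F" and "x \<notin> W" for x
  proof -
    have "\<not> s x < 1"
    proof
      assume "s x < 1"
      then have "(\<delta> * M + s x) / 2 < 1" using \<delta> by simp
      with pB[OF vector_topologyD(3)[OF F x cT] \<delta>(1)] have "p (x - c) < 1" by (simp add: s_def)
      with p(2)[OF x] that show False by blast
    qed
    then have "flat 0 (1 - s x) = 0" by (intro flat_nonneg_arg) simp
    then show ?thesis by (simp add: b_def)
  qed
  ultimately show thesis by (rule that)
qed

section \<open>Charts and smooth functions\<close>

lemma is_chartD:
  assumes "is_chart \<E> M (U, \<phi>, E)"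
  shows "E \<in> \<E>" "openin M U" "openin E (\<phi> ` U)" "inj_on \<phi> U"
    "continuous_map (subtopology M U) E \<phi>"
    "openin M W \<Longrightarrow> W \<subseteq> U \<Longrightarrow> openin E (\<phi> ` W)"
    "openin M W \<Longrightarrow> W \<subseteq> U \<Longrightarrow> is_chart \<E> M (W, \<phi>, E)"
proof -
  show E: "E \<in> \<E>" and U: "openin M U" and \<phi>U: "openin E (\<phi> ` U)"
    using assms by (auto simp: is_chart_def)
  have h: "homeomorphic_map (subtopology M U) (subtopology E (\<phi> ` U)) \<phi>"
    using assms by (simp add: is_chart_def)
  have tU: "topspace (subtopology M U) = U" using openin_subset[OF U] by auto
  have t\<phi>U: "topspace (subtopology E (\<phi> ` U)) = \<phi> ` U" using openin_subset[OF \<phi>U] by auto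
  show "inj_on \<phi> U" using homeomorphic_imp_injective_map[OF h] tU by simp
  show "continuous_map (subtopology M U) E \<phi>"
    using homeomorphic_imp_continuous_map[OF h] by (simp add: continuous_map_in_subtopology)
  show op: "openin E (\<phi> ` W)" if W: "openin M W" "W \<subseteq> U" for W
  proof -
    have "openin (subtopology M U) W" using W U by (simp add: openin_open_subtopology)
    then have "openin (subtopology E (\<phi> ` U)) (\<phi> ` W)"
      using homeomorphic_imp_open_map[OF h] by (simp add: open_map_def)
    then show ?thesis using \<phi>U by (simp add: openin_open_subtopology)
  qed
  show "is_chart \<E> M (W, \<phi>, E)" if W: "openin M W" "W \<subseteq> U" for W
  proof -
    have "homeomorphic_map (subtopology (subtopology M U) W) (subtopology (subtopology E (\<phi> ` U)) (\<phi> ` W)) \<phi>"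
      by (rule homeomorphic_map_subtopologies[OF h]) (use tU t\<phi>U W(2) in auto)
    moreover have "U \<inter> W = W" "\<phi> ` U \<inter> \<phi> ` W = \<phi> ` W" using W(2) by auto
    ultimately have "homeomorphic_map (subtopology M W) (subtopology E (\<phi> ` W)) \<phi>"
      by (simp add: subtopology_subtopology)
    then show ?thesis using E W op by (simp add: is_chart_def)
  qed
qed

lemma smooth_manifoldD:
  assumes "smooth_manifold \<E> M \<A>"
  shows "c \<in> \<A> \<Longrightarrow> is_chart \<E> M c"
    and "x \<in> topspace M \<Longrightarrow> \<exists>U \<phi> E. (U, \<phi>, E) \<in> \<A> \<and> x \<in> U"
    and "c \<in> \<A> \<Longrightarrow> c' \<in> \<A> \<Longrightarrow> smoothly_compatible c c'"
    and "is_chart \<E> M c \<Longrightarrow> (\<And>c'. c' \<in> \<A> \<Longrightarrow> smoothly_compatible c c') \<Longrightarrow> c \<in> \<A>"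
proof -
  have at: "smooth_atlas \<E> M \<A>" and mx: "\<forall>c. is_chart \<E> M c \<and> (\<forall>c' \<in> \<A>. smoothly_compatible c c') \<longrightarrow> c \<in> \<A>"
    using assms[unfolded smooth_manifold_def, THEN conjunct2, THEN conjunct1]
      assms[unfolded smooth_manifold_def, THEN conjunct2, THEN conjunct2] .
  show "is_chart \<E> M c" if "c \<in> \<A>" using at that unfolding smooth_atlas_def by blast
  show "smoothly_compatible c c'" if "c \<in> \<A>" "c' \<in> \<A>" using at that unfolding smooth_atlas_def by blast
  show "c \<in> \<A>" if "is_chart \<E> M c" "\<And>c'. c' \<in> \<A> \<Longrightarrow> smoothly_compatible c c'"
    using mx[rule_format, of c] that by blast
  assume "x \<in> topspace M"
  then have "x \<in> (\<Union>c \<in> \<A>. fst c)" using at by (simp add: smooth_atlas_def)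
  then show "\<exists>U \<phi> E. (U, \<phi>, E) \<in> \<A> \<and> x \<in> U" by force
qed

text \<open>
  By maximality: the transition maps of a restricted chart are restrictions of those of the chart.
\<close>

lemma restricted_chart_in_atlas:
  assumes man: "smooth_manifold \<E> M \<A>" and \<E>: "\<forall>E\<in>\<E>. vector_topology E"
    and c: "(U, \<phi>, E) \<in> \<A>" and W: "openin M W" "W \<subseteq> U"
  shows "(W, \<phi>, E) \<in> \<A>"
proof (rule smooth_manifoldD(4)[OF man])
  note chart = smooth_manifoldD(1)[OF man c]
  show "is_chart \<E> M (W, \<phi>, E)" by (rule is_chartD(7)[OF chart W])
  fix c' assume c': "c' \<in> \<A>"
  obtain V \<psi> F where [simp]: "c' = (V, \<psi>, F)" by (cases c')
  have chart': "is_chart \<E> M (V, \<psi>, F)" using smooth_manifoldD(1)[OF man c'] by simp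
  have E: "vector_topology E" using \<E> is_chartD(1)[OF chart] by blast
  have F: "Hausdorff_space F" using \<E> is_chartD(1)[OF chart'] by (auto simp: vector_topology_def)
  have comp: "smooth_on F E (\<psi> ` (U \<inter> V)) (\<phi> \<circ> inv_into V \<psi>)"
    "smooth_on E F (\<phi> ` (U \<inter> V)) (\<psi> \<circ> inv_into U \<phi>)"
    using smooth_manifoldD(3)[OF man c c'] by (auto simp: smoothly_compatible_def)
  have "smooth_on E F (\<phi> ` (W \<inter> V)) (\<psi> \<circ> inv_into W \<phi>)"
  proof (rule smooth_on_cong[OF E F])
    show "openin E (\<phi> ` (W \<inter> V))"
      using W by (intro is_chartD(6)[OF chart]) (auto intro: openin_Int is_chartD(2)[OF chart'])
    show "smooth_on E F (\<phi> ` (W \<inter> V)) (\<psi> \<circ> inv_into U \<phi>)"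
      by (rule smooth_on_subset[OF comp(2)]) (use W(2) in auto)
    show "(\<psi> \<circ> inv_into U \<phi>) x = (\<psi> \<circ> inv_into W \<phi>) x" if "x \<in> \<phi> ` (W \<inter> V)" for x
    proof -
      obtain m where m: "m \<in> W" "x = \<phi> m" using \<open>x \<in> \<phi> ` (W \<inter> V)\<close> by blast
      have "inj_on \<phi> U" by (rule is_chartD(4)[OF chart])
      then have "inv_into U \<phi> x = m" "inv_into W \<phi> x = m"
        using m W(2) by (auto intro!: inv_into_f_eq intro: inj_on_subset)
      then show ?thesis by simp
    qed
  qed
  moreover have "smooth_on F E (\<psi> ` (W \<inter> V)) (\<phi> \<circ> inv_into V \<psi>)"
    by (rule smooth_on_subset[OF comp(1)]) (use W(2) in auto)
  ultimately show "smoothly_compatible (W, \<phi>, E) c'" by (simp add: smoothly_compatible_def)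
qed

lemma smooth_on_real_id: "smooth_on euclideanreal euclideanreal UNIV (\<lambda>x. x)"
  by (rule smooth_on_linear[OF vector_topology_euclideanreal])
    (simp_all add: linear_functional_def continuous_map_id[unfolded id_def])

lemma identity_in_real_atlas: "(UNIV, id, euclideanreal) \<in> real_atlas"
  using smooth_on_real_id
  by (simp add: real_atlas_def is_chart_def smoothly_compatible_def id_def o_def inv_id[unfolded id_def]
      homeomorphic_map_id[unfolded id_def])

lemma real_atlas_smooth:
  assumes "(V, \<theta>, R) \<in> real_atlas"
  shows "R = euclideanreal" "open V" "smooth_on euclideanreal euclideanreal V \<theta>"
  using assms by (auto simp: real_atlas_def is_chart_def smoothly_compatible_def)

text \<open>
  Smoothness into \<open>\<real>\<close> is tested against all charts of the real line, but only the identity chart matters, since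
  the others are smooth functions of it. Continuity follows because the chart domains cover \<open>M\<close>.
\<close>

lemma smooth_functions_iff:
  assumes man: "smooth_manifold \<E> M \<A>" and \<E>: "\<forall>E\<in>\<E>. vector_topology E"
  shows "f \<in> smooth_functions M \<A> \<longleftrightarrow>
    (\<forall>U \<phi> E. (U, \<phi>, E) \<in> \<A> \<longrightarrow> smooth_on E euclideanreal (\<phi> ` U) (f \<circ> inv_into U \<phi>))"
    (is "_ \<longleftrightarrow> ?R")
proof
  assume "f \<in> smooth_functions M \<A>"
  then have s: "smooth_map M \<A> euclideanreal real_atlas f" by (simp add: smooth_functions_def)
  show ?R
  proof (intro allI impI)
    fix U \<phi> E assume "(U, \<phi>, E) \<in> \<A>"
    with s identity_in_real_atlas have "smooth_on E euclideanreal (\<phi> ` U) (id \<circ> f \<circ> inv_into U \<phi>)"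
      unfolding smooth_map_def by fastforce
    then show "smooth_on E euclideanreal (\<phi> ` U) (f \<circ> inv_into U \<phi>)" by simp
  qed
next
  assume R: ?R
  have "continuous_map (subtopology M (topspace M)) euclideanreal f"
  proof (rule continuous_map_local)
    fix x assume "x \<in> topspace M"
    then obtain U \<phi> E where c: "(U, \<phi>, E) \<in> \<A>" "x \<in> U" using smooth_manifoldD(2)[OF man] by blast
    note chart = smooth_manifoldD(1)[OF man c(1)]
    have E: "vector_topology E" using \<E> is_chartD(1)[OF chart] by blast
    have "continuous_map (subtopology E (\<phi> ` U)) euclideanreal (f \<circ> inv_into U \<phi>)"
      using R c by (intro smooth_on_imp_continuous_map[OF E openin_subset[OF is_chartD(3)[OF chart]]]) blast
    moreover have "continuous_map (subtopology M U) (subtopology E (\<phi> ` U)) \<phi>"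
      using is_chartD(5)[OF chart] by (auto simp: continuous_map_in_subtopology)
    ultimately have "continuous_map (subtopology M U) euclideanreal ((f \<circ> inv_into U \<phi>) \<circ> \<phi>)"
      by (rule continuous_map_compose[rotated])
    then have "continuous_map (subtopology M U) euclideanreal f"
      by (rule continuous_map_eq) (use is_chartD(4)[OF chart] in auto)
    moreover have "topspace M \<inter> U = U" using openin_subset[OF is_chartD(2)[OF chart]] by auto
    ultimately show "\<exists>V. openin M V \<and> x \<in> V \<and> continuous_map (subtopology M (topspace M \<inter> V)) euclideanreal f"
      using is_chartD(2)[OF chart] c(2) by (intro exI[of _ U]) simp
  qed
  then have "continuous_map M euclideanreal f" by simp
  moreover have "smooth_on E R (\<phi> ` U) (\<theta> \<circ> f \<circ> inv_into U \<phi>)"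
    if c: "(U, \<phi>, E) \<in> \<A>" and r: "(V, \<theta>, R) \<in> real_atlas" and sub: "f ` U \<subseteq> V" for U \<phi> E V \<theta> R
  proof -
    note chart = smooth_manifoldD(1)[OF man c]
    have E: "vector_topology E" using \<E> is_chartD(1)[OF chart] by blast
    have "smooth_on E euclideanreal (\<phi> ` U) (\<theta> \<circ> (f \<circ> inv_into U \<phi>))"
    proof (rule smooth_on_compose[OF E vector_topology_euclideanreal is_chartD(3)[OF chart]])
      show "openin euclideanreal V" using real_atlas_smooth(2)[OF r] by simp
      show "smooth_on E euclideanreal (\<phi> ` U) (f \<circ> inv_into U \<phi>)" using R c by blast
      show "smooth_on euclideanreal euclideanreal V \<theta>" by (rule real_atlas_smooth(3)[OF r])
      show "(f \<circ> inv_into U \<phi>) ` \<phi> ` U \<subseteq> V" using sub is_chartD(4)[OF chart] by auto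
    qed
    then show ?thesis using real_atlas_smooth(1)[OF r] by (simp add: comp_assoc)
  qed
  ultimately show "f \<in> smooth_functions M \<A>"
    by (auto simp: smooth_functions_def smooth_map_def)
qed

text \<open>
  Smoothness of \<open>\<Phi>\<close> speaks only about charts whose domain is mapped into a single chart domain
  of \<open>N\<close>. Around a given point such a chart arises by restriction, and there the chain rule applies.
\<close>

lemma smooth_map_pullback:
  assumes M: "smooth_manifold \<E> M \<A>" and \<E>: "\<forall>E\<in>\<E>. vector_topology E"
    and N: "smooth_manifold \<F> N \<B>" and \<F>: "\<forall>F\<in>\<F>. vector_topology F"
    and \<Phi>: "smooth_map M \<A> N \<B> \<Phi>" and f: "f \<in> smooth_functions N \<B>"
  shows "f \<circ> \<Phi> \<in> smooth_functions M \<A>"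
  unfolding smooth_functions_iff[OF M \<E>]
proof (intro allI impI)
  fix U \<phi> E assume c: "(U, \<phi>, E) \<in> \<A>"
  note chart = smooth_manifoldD(1)[OF M c]
  have E: "vector_topology E" using \<E> is_chartD(1)[OF chart] by blast
  have cont: "continuous_map M N \<Phi>" using \<Phi> by (simp add: smooth_map_def)
  show "smooth_on E euclideanreal (\<phi> ` U) (f \<circ> \<Phi> \<circ> inv_into U \<phi>)"
  proof (rule smooth_on_local[OF Hausdorff_space_euclidean])
    fix e assume "e \<in> \<phi> ` U"
    then obtain x where x: "x \<in> U" "e = \<phi> x" by blast
    have xM: "x \<in> topspace M" using x(1) openin_subset[OF is_chartD(2)[OF chart]] by blast
    then have "\<Phi> x \<in> topspace N" using cont by (auto simp: continuous_map_def)
    then obtain V \<psi> F where d: "(V, \<psi>, F) \<in> \<B>" "\<Phi> x \<in> V" using smooth_manifoldD(2)[OF N] by blast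
    note chart' = smooth_manifoldD(1)[OF N d(1)]
    have F: "vector_topology F" using \<F> is_chartD(1)[OF chart'] by blast
    define W where "W = U \<inter> {x \<in> topspace M. \<Phi> x \<in> V}"
    have W: "openin M W" "W \<subseteq> U"
      unfolding W_def
      by (auto intro: openin_Int is_chartD(2)[OF chart] openin_continuous_map_preimage[OF cont is_chartD(2)[OF chart']])
    have \<Phi>W: "\<Phi> ` W \<subseteq> V" by (auto simp: W_def)
    have "(W, \<phi>, E) \<in> \<A>" by (rule restricted_chart_in_atlas[OF M \<E> c W])
    then have 1: "smooth_on E F (\<phi> ` W) (\<psi> \<circ> \<Phi> \<circ> inv_into W \<phi>)"
      using \<Phi> d(1) \<Phi>W unfolding smooth_map_def by fastforce
    have 2: "smooth_on F euclideanreal (\<psi> ` V) (f \<circ> inv_into V \<psi>)"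
      using f d(1) unfolding smooth_functions_iff[OF N \<F>] by blast
    have inj: "inj_on \<phi> U" "inj_on \<phi> W" "inj_on \<psi> V"
      using is_chartD(4)[OF chart] is_chartD(4)[OF chart'] W(2) by (auto intro: inj_on_subset)
    have \<phi>W: "openin E (\<phi> ` W)" by (rule is_chartD(6)[OF chart W])
    have "smooth_on E euclideanreal (\<phi> ` W) ((f \<circ> inv_into V \<psi>) \<circ> (\<psi> \<circ> \<Phi> \<circ> inv_into W \<phi>))"
      by (rule smooth_on_compose[OF E F \<phi>W is_chartD(3)[OF chart'] 1 _ 2]) (use \<Phi>W inj in auto)
    then have "smooth_on E euclideanreal (\<phi> ` W) (f \<circ> \<Phi> \<circ> inv_into U \<phi>)"
      by (rule smooth_on_cong[OF E Hausdorff_space_euclidean \<phi>W, rotated]) (use \<Phi>W inj W(2) in \<open>auto simp: subset_iff\<close>)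
    moreover have "\<phi> ` U \<inter> \<phi> ` W = \<phi> ` W" using W(2) by auto
    moreover have "e \<in> \<phi> ` W" using x xM d(2) by (auto simp: W_def)
    ultimately show "\<exists>V. openin E V \<and> e \<in> V \<and> smooth_on E euclideanreal (\<phi> ` U \<inter> V) (f \<circ> \<Phi> \<circ> inv_into U \<phi>)"
      using \<phi>W by (intro exI[of _ "\<phi> ` W"]) simp
  qed
qed

text \<open>
  Multiply the local function \<open>l \<circ> \<psi>\<close> with a bump function that is \<open>1\<close> near \<open>\<psi> y\<close> and extend by zero. Regularity of
  \<open>N\<close> gives a set \<open>C \<subseteq> V\<close> that is closed in \<open>N\<close> and outside of which the product vanishes; without it
  the extension could fail to be smooth at boundary points of \<open>V\<close>.
\<close>

lemma coordinate_functional_extends: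
  assumes nuc: "nuclear_space F" and N: "smooth_manifold {F} N \<B>" and reg: "regular_space N"
    and d: "(V, \<psi>, F) \<in> \<B>" and y: "y \<in> V"
    and l: "linear_functional F l" "continuous_map F euclideanreal l"
  obtains f S where "f \<in> smooth_functions N \<B>" "openin N S" "y \<in> S" "S \<subseteq> V" "\<And>n. n \<in> S \<Longrightarrow> f n = l (\<psi> n)"
proof -
  have F: "vector_topology F"
    using nuc by (simp add: nuclear_space_def locally_convex_imp_vector_topology)
  have \<F>: "\<forall>F'\<in>{F}. vector_topology F'" using F by simp
  note chart = smooth_manifoldD(1)[OF N d]
  have V: "openin N V" by (rule is_chartD(2)[OF chart])
  have inj: "inj_on \<psi> V" by (rule is_chartD(4)[OF chart])
  have VF: "\<psi> ` V \<subseteq> topspace F" by (rule openin_subset[OF is_chartD(3)[OF chart]])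
  have "neighbourhood_base_of (closedin N) N" using reg by (simp add: neighbourhood_base_of_closedin)
  from this[unfolded neighbourhood_base_of, rule_format, OF conjI[OF V y]]
  obtain W C where W: "openin N W" "closedin N C" "y \<in> W" "W \<subseteq> C" "C \<subseteq> V" by blast
  have WV: "W \<subseteq> V" using W by blast
  from nuclear_bump_function[OF nuc is_chartD(6)[OF chart W(1) WV] imageI[OF W(3)]]
  obtain b V0 where b: "smooth_on F euclideanreal (topspace F) b" "openin F V0" "\<psi> y \<in> V0"
    "\<And>x. x \<in> V0 \<Longrightarrow> b x = 1" "\<And>x. x \<in> topspace F \<Longrightarrow> x \<notin> \<psi> ` W \<Longrightarrow> b x = 0"
    by blast
  define f where "f n = (if n \<in> V then b (\<psi> n) * l (\<psi> n) else 0)" for n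
  have bl: "smooth_on F euclideanreal (topspace F) (\<lambda>x. b x * l x)"
    by (intro smooth_on_mult[OF F _ b(1)] smooth_on_linear[OF F _ l]) simp_all
  have f0: "f n = 0" if "n \<notin> C" for n
  proof (cases "n \<in> V")
    case True
    have "\<psi> n \<notin> \<psi> ` W" using that True W(4) WV inj by (auto dest: inj_onD)
    then show ?thesis using b(5) VF True by (auto simp: f_def)
  qed (simp add: f_def)
  have "f \<in> smooth_functions N \<B>"
    unfolding smooth_functions_iff[OF N \<F>]
  proof (intro allI impI)
    fix V' \<psi>' F' assume d': "(V', \<psi>', F') \<in> \<B>"
    note chart' = smooth_manifoldD(1)[OF N d']
    have F': "F' = F" using is_chartD(1)[OF chart'] by simp
    have V': "openin N V'" by (rule is_chartD(2)[OF chart'])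
    have inj': "inj_on \<psi>' V'" by (rule is_chartD(4)[OF chart'])
    \<comment> \<open>\<open>V\<close> and the complement of \<open>C\<close> cover \<open>N\<close>: on \<open>V\<close> the chain rule with the transition map applies, off \<open>C\<close> the
      function is zero.\<close>
    show "smooth_on F' euclideanreal (\<psi>' ` V') (f \<circ> inv_into V' \<psi>')"
    proof (rule smooth_on_local[OF Hausdorff_space_euclidean])
      fix z assume "z \<in> \<psi>' ` V'"
      then obtain n where n: "n \<in> V'" "z = \<psi>' n" by blast
      show "\<exists>O'. openin F' O' \<and> z \<in> O' \<and> smooth_on F' euclideanreal (\<psi>' ` V' \<inter> O') (f \<circ> inv_into V' \<psi>')"
      proof (cases "n \<in> V")
        case True
        let ?O = "\<psi>' ` (V \<inter> V')"
        have O: "openin F' ?O" by (rule is_chartD(6)[OF chart']) (auto intro: openin_Int V V')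
        have tr: "smooth_on F' F ?O (\<psi> \<circ> inv_into V' \<psi>')"
          using smooth_manifoldD(3)[OF N d d'] by (simp add: smoothly_compatible_def)
        have "smooth_on F' euclideanreal ?O ((\<lambda>x. b x * l x) \<circ> (\<psi> \<circ> inv_into V' \<psi>'))"
          by (rule smooth_on_compose[OF F[folded F'] F O openin_topspace tr _ bl]) (use VF inj' in auto)
        then have "smooth_on F' euclideanreal ?O (f \<circ> inv_into V' \<psi>')"
          by (rule smooth_on_cong[OF F[folded F'] Hausdorff_space_euclidean O, rotated]) (use inj' in \<open>auto simp: f_def\<close>)
        moreover have "\<psi>' ` V' \<inter> ?O = ?O" by auto
        ultimately show ?thesis using O n True by (intro exI[of _ ?O]) auto
      next
        case False
        let ?O = "\<psi>' ` (V' - C)"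
        have O: "openin F' ?O" by (rule is_chartD(6)[OF chart']) (auto intro: openin_diff V' W(2))
        have "smooth_on F' euclideanreal ?O (\<lambda>_. 0)" by (rule smooth_on_const[OF F[folded F'] O])
        then have "smooth_on F' euclideanreal ?O (f \<circ> inv_into V' \<psi>')"
          by (rule smooth_on_cong[OF F[folded F'] Hausdorff_space_euclidean O, rotated]) (use inj' f0 in auto)
        moreover have "\<psi>' ` V' \<inter> ?O = ?O" by auto
        moreover have "n \<notin> C" using False W(5) by blast
        ultimately show ?thesis using O n by (intro exI[of _ ?O]) auto
      qed
    qed
  qed
  note f_smooth = this
  define S where "S = {n \<in> topspace (subtopology N V). \<psi> n \<in> V0}"
  have "openin (subtopology N V) S"
    unfolding S_def by (rule openin_continuous_map_preimage[OF is_chartD(5)[OF chart] b(2)])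
  then have S: "openin N S" "S \<subseteq> V" using V by (simp_all add: openin_open_subtopology)
  from S(1) have "openin N S" .
  moreover have "y \<in> S" using y b(3) openin_subset[OF V] by (auto simp: S_def)
  moreover note S(2)
  moreover have "f n = l (\<psi> n)" if "n \<in> S" for n using that b(4) by (simp add: S_def f_def)
  ultimately show thesis using f_smooth by (intro that)
qed

section \<open>Detecting smoothness by smooth functions\<close>

theorem theoremC:
  fixes M :: "'m topology" and \<A> :: "('m, 'e::real_vector) chart set"
    and N :: "'n topology" and \<B> :: "('n, 'f::real_vector) chart set"
    and F :: "'f topology"
    and \<Phi> :: "'m \<Rightarrow> 'n"
  assumes "smooth_manifold c_infinity_power_spaces M \<A>"
    and "frechet_space F" and "nuclear_space F"
    and "smooth_manifold {F} N \<B>" and "regular_space N"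
    and "continuous_map M N \<Phi>"
  shows "smooth_map M \<A> N \<B> \<Phi> \<longleftrightarrow>
    (\<forall>f \<in> smooth_functions N \<B>. f \<circ> \<Phi> \<in> smooth_functions M \<A>)"
proof
  have \<E>: "\<forall>E\<in>(c_infinity_power_spaces :: 'e topology set). vector_topology E"
    by (simp add: c_infinity_power_spaces_def locally_convex_imp_vector_topology)
  have F: "vector_topology F"
    using assms(2) by (simp add: frechet_space_def locally_convex_imp_vector_topology)
  then have \<F>: "\<forall>F'\<in>{F}. vector_topology F'" by simp
  show "\<forall>f \<in> smooth_functions N \<B>. f \<circ> \<Phi> \<in> smooth_functions M \<A>" if "smooth_map M \<A> N \<B> \<Phi>"
    using smooth_map_pullback[OF assms(1) \<E> assms(4) \<F> that] by blast
  assume pull: "\<forall>f \<in> smooth_functions N \<B>. f \<circ> \<Phi> \<in> smooth_functions M \<A>"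
  have "smooth_on E F' (\<phi> ` U) (\<psi> \<circ> \<Phi> \<circ> inv_into U \<phi>)"
    if c: "(U, \<phi>, E) \<in> \<A>" and d: "(V, \<psi>, F') \<in> \<B>" and sub: "\<Phi> ` U \<subseteq> V" for U \<phi> E V \<psi> F'
  proof -
    note chart = smooth_manifoldD(1)[OF assms(1) c]
    note chart' = smooth_manifoldD(1)[OF assms(4) d]
    have F': "F' = F" using is_chartD(1)[OF chart'] by simp
    have E: "vector_topology E" by (rule bspec[OF \<E> is_chartD(1)[OF chart]])
    have inj: "inj_on \<phi> U" by (rule is_chartD(4)[OF chart])
    let ?g = "\<psi> \<circ> \<Phi> \<circ> inv_into U \<phi>"
    have gF: "?g e \<in> topspace F" if e: "e \<in> \<phi> ` U" for e
    proof -
      obtain x where x: "x \<in> U" "e = \<phi> x" using e by blast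
      then have "\<psi> (\<Phi> x) \<in> \<psi> ` V" using sub by blast
      then show ?thesis
        using x inj openin_subset[OF is_chartD(3)[OF chart']] F' by auto
    qed
    have weak: "smooth_on E euclideanreal (\<phi> ` U) (l \<circ> ?g)"
      if l: "linear_functional F l" "continuous_map F euclideanreal l" for l
    proof (rule smooth_on_local[OF Hausdorff_space_euclidean])
      fix e assume "e \<in> \<phi> ` U"
      then obtain x where x: "x \<in> U" "e = \<phi> x" by blast
      obtain f S where f: "f \<in> smooth_functions N \<B>" "openin N S" "\<Phi> x \<in> S" "S \<subseteq> V" "\<And>n. n \<in> S \<Longrightarrow> f n = l (\<psi> n)"
        using coordinate_functional_extends[OF assms(3,4,5) d[unfolded F'] _ l, of "\<Phi> x"] sub x(1) by blast
      \<comment> \<open>On \<open>W\<close> the functions \<open>f \<circ> \<Phi>\<close> and \<open>l \<circ> \<psi> \<circ> \<Phi>\<close> agree.\<close>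
      define W where "W = U \<inter> {x \<in> topspace M. \<Phi> x \<in> S}"
      have W: "openin M W" "W \<subseteq> U"
        unfolding W_def
        by (auto intro: openin_Int is_chartD(2)[OF chart] openin_continuous_map_preimage[OF assms(6) f(2)])
      have \<phi>W: "openin E (\<phi> ` W)" by (rule is_chartD(6)[OF chart W])
      have "smooth_on E euclideanreal (\<phi> ` U) (f \<circ> \<Phi> \<circ> inv_into U \<phi>)"
        using pull f(1) c unfolding smooth_functions_iff[OF assms(1) \<E>] by blast
      then have "smooth_on E euclideanreal (\<phi> ` W) (f \<circ> \<Phi> \<circ> inv_into U \<phi>)"
        by (rule smooth_on_subset) (use W(2) in auto)
      then have "smooth_on E euclideanreal (\<phi> ` W) (l \<circ> ?g)"
        by (rule smooth_on_cong[OF E Hausdorff_space_euclidean \<phi>W, rotated])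
          (use inj W(2) f(5) in \<open>auto simp: W_def\<close>)
      moreover have "\<phi> ` U \<inter> \<phi> ` W = \<phi> ` W" using W(2) by auto
      moreover have "e \<in> \<phi> ` W"
        using x f(3) openin_subset[OF is_chartD(2)[OF chart]] by (auto simp: W_def)
      ultimately show "\<exists>V. openin E V \<and> e \<in> V \<and> smooth_on E euclideanreal (\<phi> ` U \<inter> V) (l \<circ> ?g)"
        using \<phi>W by (intro exI[of _ "\<phi> ` W"]) simp
    qed
    have "smooth_on E F (\<phi> ` U) ?g"
      unfolding smooth_on_def
    proof
      fix k
      show "Ck_on k 1 E F {x \<in> topspace (power_space E 1). x 0 \<in> \<phi> ` U} (\<lambda>x. ?g (x 0))"
      proof (rule weakly_smooth_imp_Ck_on[OF is_chartD(1)[OF chart] assms(2,3)])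
        show "openin (power_space E 1) {x \<in> topspace (power_space E 1). x 0 \<in> \<phi> ` U}"
          by (rule openin_singleton_domain[OF is_chartD(3)[OF chart]])
        show "?g (x 0) \<in> topspace F" if "x \<in> {x \<in> topspace (power_space E 1). x 0 \<in> \<phi> ` U}" for x
          using gF that by blast
        fix l k assume "linear_functional F l" "continuous_map F euclideanreal l"
        from weak[OF this]
        show "Ck_on k 1 E euclideanreal {x \<in> topspace (power_space E 1). x 0 \<in> \<phi> ` U} (\<lambda>x. l (?g (x 0)))"
          by (simp add: smooth_on_def)
      qed simp
    qed
    then show ?thesis using F' by simp
  qed
  then show "smooth_map M \<A> N \<B> \<Phi>" using assms(6) by (auto simp: smooth_map_def)
qed

end
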